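(* Let $n=2$, let $H$ be a periodic function such that $H''=-h$, and let $r$ be the number of bounded connected components of $\mathbb{R}^2\setminus \mathrm{Im}(H)$. Then for $\lambda$ large enough, the repulsive problem $$u''(t)-\frac{u(t)}{|u(t)|^{q+1}}=\lambda h(t),\qquad u(0)=u(1),\quad u'(0)=u'(1)$$ for a vector function $u:[0,1]\to\mathbb{R}^n=\mathbb{R}^2$ admits at least $r+1$ solutions.
   Context: Here $q\ge 2$, and $h\in C([0,1],\mathbb{R}^2)$ satisfies $\overline{h}:=\int_0^1 h(t)\,dt=0$. The function $H$ is a periodic second primitive of $-h$, i.e. $H(0)=H(1)$ and $H'(0)=H'(1)$; it is unique up to translations. The function $u$ describes the motion of a particle under a repulsive singular central force and a perturbation $\lambda h$.
   Formalization: The formal theorem assumes r ≥ 1, because for r = 0 the claim fails: with h = 0 and H constant, any periodic solution would satisfy (u·u')' = |u'|² + |u|^{1-q} > 0, which is impossible. *)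

theory Defs
  imports "HOL-Analysis.Analysis"
begin

text \<open>
  One-sided derivatives are taken at the end points of the interval, and the boundary conditions
  are imposed on the function and on its first derivative \<open>v'\<close>, which is unique.
\<close>

definition periodic_with_second_deriv ::
    "(real \<Rightarrow> 'a::real_normed_vector) \<Rightarrow> (real \<Rightarrow> 'a) \<Rightarrow> bool" where
  "periodic_with_second_deriv v w \<longleftrightarrow>
     (\<exists>v'. (\<forall>t\<in>{0..1}. (v has_vector_derivative v' t) (at t within {0..1}) \<and>
                       (v' has_vector_derivative w t) (at t within {0..1})) \<and>
           v 0 = v 1 \<and> v' 0 = v' 1)"

text \<open>
  The complement of a \<open>C\<^sup>2\<close> closed plane curve can have infinitely many bounded components, and \<open>card\<close>
  is then \<open>0\<close>, so a count of them by \<open>card\<close> is meaningful only when this set is finite.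
\<close>

definition bounded_components :: "'a::metric_space set \<Rightarrow> 'a set set" where
  "bounded_components S = {C \<in> components S. bounded C}"

text \<open>
  A solution never meets the singularity at the origin.  Restricting to \<open>extensional {0..1}\<close>
  makes equality of elements the same as equality of functions on \<open>[0,1]\<close>, so that counting
  elements counts solutions.  Continuity of \<open>u''\<close> follows from the equation when \<open>h\<close> is continuous.
\<close>

definition repulsive_solutions ::
    "real \<Rightarrow> real \<Rightarrow> (real \<Rightarrow> real^2) \<Rightarrow> (real \<Rightarrow> real^2) set" where
  "repulsive_solutions q l h =
     {u \<in> extensional {0..1}.
        (\<forall>t\<in>{0..1}. u t \<noteq> 0) \<and>
        (\<exists>u''. periodic_with_second_deriv u u'' \<and>
           (\<forall>t\<in>{0..1}. u'' t - u t /\<^sub>R (norm (u t) powr (q + 1)) = l *\<^sub>R h t))}"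

end

theory Submission
  imports Defs
begin

text \<open>
  Put \<open>u = l z\<close> and \<open>e = l powr - (q + 1)\<close>, so that \<open>z'' = e z / |z|^(q+1) + h\<close>, and truncate the force to
  be linear in a ball of tiny radius \<open>d\<close>.  With \<open>y = z + H\<close> the forcing disappears and periodic solutions are
  zeros of the displacement \<open>f\<close> of the time-one map of \<open>y'' = e force (y - H)\<close> on \<open>R^2 x R^2\<close>.

  Far away \<open>f\<close> is homotopic to the identity, so its total degree is 1.  The linear core contributes one
  spurious zero, of degree 1; an energy estimate shows that all other zeros avoid the core and are solutions.
  In each bounded component \<open>D\<close> of the complement of the curve, small \<open>e\<close> permits a reduction to the initial
  point \<open>p\<close>: the reduced map is the gradient of an action close to \<open>e\<close> times the potential
  generated by the curve, which tends to minus infinity at the frontier of \<open>D\<close> because \<open>q \<ge> 2\<close>.  The action has an interior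
  maximum, and if this is its only critical point then its gradient has degree 1 there, as
  discrete gradient ascent contracts a superlevel set towards the maximum.

  If there were only \<open>r\<close> solutions, one in each of \<open>r\<close> bounded components, then the degrees would add up to
  \<open>r + 1\<close> instead of 1, contradicting \<open>r \<ge> 1\<close>.
\<close>

section \<open>The integral of the Jacobian determinant\<close>

text \<open>Degree is never defined. Its only trace is a count: a map that equals the identity far
  away and a translation near each of its finitely many zeros has exactly one zero, because an
  integral of a Jacobian can be computed in two ways. So every region in play must have degree +1,
  and each local analysis ends in a homotopy on a frontier to \<open>\<lambda>x. x - z\<close>. This
  is where the plane matters: around a maximum the gradient is deformed to minus the identity, which
  in dimension two is connected to the identity through a rotation. The order of quantifiers is the
  main obstacle. The truncation radius that excludes spurious solutions depends on \<open>e\<close>,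
  while the smallness of \<open>e\<close> needed by the reduction depends on the truncation radius.
  The circle is broken by building the tubes with a fixed radius \<open>d1\<close>: their orbits
  keep away from the ball of that radius, so they are orbits for every smaller radius too. The extra
  solution is not located. It is only shown that the zeros found in the tubes cannot be all the
  zeros outside the core.\<close>

lemma poly_extrapolation:
  fixes X :: "'a::field set"
  assumes "finite X" "card X = Suc n"
  shows "\<exists>c. \<forall>p. degree p \<le> n \<longrightarrow> poly p a = (\<Sum>x\<in>X. c x * poly p x)"
proof -
  define l where "l x = (\<Prod>y\<in>X-{x}. smult (inverse (x - y)) [:- y, 1:])" for x
  have lxx: "poly (l x) x = 1" for x
  proof -
    have "poly (smult (inverse (x - y)) [:- y, 1:]) x = 1" if "y \<in> X - {x}" for y
      using that left_inverse[of "x - y"] by (auto simp: algebra_simps)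
    then show ?thesis unfolding l_def poly_prod by (intro prod.neutral) blast
  qed
  have lxy: "poly (l x) y = 0" if "x \<in> X" "y \<in> X" "x \<noteq> y" for x y
    using that assms(1) by (auto simp: l_def poly_prod)
  have degl: "degree (l x) \<le> n" if "x \<in> X" for x
  proof -
    have "degree (l x) \<le> (\<Sum>y\<in>X-{x}. degree (smult (inverse (x - y)) [:- y, 1:]))"
      unfolding l_def by (rule degree_prod_sum_le [unfolded o_def]) (use assms(1) in simp)
    also have "\<dots> \<le> (\<Sum>y\<in>X-{x}. 1)"
      by (intro sum_mono) simp
    finally show ?thesis using that assms by simp
  qed
  have "poly p a = (\<Sum>x\<in>X. poly (l x) a * poly p x)" if p: "degree p \<le> n" for p
  proof -
    define q where "q = (\<Sum>x\<in>X. smult (poly p x) (l x))"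
    have "poly q y = poly p y" if "y \<in> X" for y
    proof -
      have "poly q y = (\<Sum>x\<in>X. poly p x * poly (l x) y)"
        by (simp add: q_def poly_sum)
      also have "\<dots> = (\<Sum>x\<in>X. if x = y then poly p y else 0)"
        using that by (intro sum.cong) (auto simp: lxx lxy)
      finally show ?thesis using that assms(1) by simp
    qed
    moreover have "degree q \<le> n"
      unfolding q_def by (intro degree_sum_le assms) (use degl in \<open>auto intro: order_trans[OF degree_smult_le]\<close>)
    ultimately have "p = q"
      using p assms(2) by (intro poly_eqI_degree[where A=X]) auto
    then have "poly p a = poly q a" by (rule arg_cong)
    also have "\<dots> = (\<Sum>x\<in>X. poly (l x) a * poly p x)"
      unfolding q_def poly_sum poly_smult by (simp add: mult.commute)
    finally show ?thesis .
  qed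
  then show ?thesis by (intro exI[of _ "\<lambda>x. poly (l x) a"]) simp
qed

lemma det_pencil_poly:
  fixes A :: "real^'n::finite^'n"
  shows "\<exists>p. degree p \<le> CARD('n) \<and> (\<forall>s. poly p s = det (mat 1 + s *\<^sub>R A))"
proof -
  define e where "e i j = [: (mat 1 :: real^'n^'n) $ i $ j, A $ i $ j :]" for i j :: 'n
  define p where "p = (\<Sum>\<sigma> | \<sigma> permutes UNIV. smult (of_int (sign \<sigma>)) (\<Prod>i\<in>UNIV. e i (\<sigma> i)))"
  have "degree p \<le> CARD('n)"
    unfolding p_def
  proof (intro degree_sum_le order_trans[OF degree_smult_le])
    fix \<sigma> :: "'n \<Rightarrow> 'n"
    have "degree (\<Prod>i\<in>UNIV. e i (\<sigma> i)) \<le> (\<Sum>i\<in>UNIV. degree (e i (\<sigma> i)))"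
      by (rule degree_prod_sum_le[unfolded o_def]) simp
    also have "\<dots> \<le> (\<Sum>i\<in>(UNIV::'n set). 1)"
      by (intro sum_mono) (simp add: e_def)
    finally show "degree (\<Prod>i\<in>UNIV. e i (\<sigma> i)) \<le> CARD('n)" by simp
  qed (simp add: finite_permutations)
  moreover have "poly p s = det (mat 1 + s *\<^sub>R A)" for s
    by (simp add: p_def det_def poly_sum poly_prod e_def)
  ultimately show ?thesis by blast
qed

text \<open>A continuity argument: the determinant is 1 at parameter 0, so losing positivity would
  produce a parameter \<open>u\<close> and a nonzero \<open>x\<close> with
  \<open>x = - u A x\<close>, impossible because \<open>u * L < 1\<close>.\<close>

lemma det_pencil_pos:
  fixes A :: "real^'n::finite^'n"
  assumes A: "\<And>x. norm (A *v x) \<le> L * norm x" and s: "0 \<le> s" "s * L < 1"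
  shows "det (mat 1 + s *\<^sub>R A) > 0"
proof (rule ccontr)
  obtain p where p: "\<And>s. poly p s = det (mat 1 + s *\<^sub>R A)"
    using det_pencil_poly[of A] by auto
  assume "\<not> ?thesis"
  then have "poly p s \<le> 0" "poly p 0 \<ge> 0" by (auto simp: p)
  then obtain u where u: "0 \<le> u" "u \<le> s" "poly p u = 0"
    using IVT2[of "poly p" s 0 0] s by auto
  then have "det (mat 1 + u *\<^sub>R A) = 0" by (simp add: p)
  then obtain x where x: "x \<noteq> 0" "(mat 1 + u *\<^sub>R A) *v x = 0"
    using invertible_det_nz matrix_left_invertible_ker invertible_left_inverse by blast
  then have "norm x = norm (u *\<^sub>R (A *v x))"
    by (metis (no_types) add.commute add_eq_0_iff matrix_vector_mult_add_rdistrib matrix_vector_mul_lid norm_minus_cancel scaleR_matrix_vector_assoc)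
  also have "\<dots> \<le> u * (L * norm x)"
    using u A by (simp add: mult_left_mono)
  finally have "1 \<le> u * L" using x by (simp add: mult.assoc[symmetric])
  moreover have "u * L < 1"
  proof (cases "L \<ge> 0")
    case True
    then show ?thesis using u s mult_right_mono[of u s L] by linarith
  next
    case False
    then have "u * L \<le> 0" using u by (simp add: mult_nonneg_nonpos)
    then show ?thesis by simp
  qed
  ultimately show False by simp
qed

text \<open>\<open>x + g x = y\<close> says that \<open>x\<close> is a fixed point of
  \<open>\<lambda>x. y - g x\<close>, which is a contraction.\<close>

lemma bij_add_contraction:
  fixes g :: "'a::banach \<Rightarrow> 'a"
  assumes g: "c-lipschitz_on UNIV g" and "c < 1"
  shows "bij (\<lambda>x. x + g x)"
proof (rule bijI)
  have c: "c \<ge> 0" using g lipschitz_on_nonneg by blast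
  show "inj (\<lambda>x. x + g x)"
  proof (rule injI)
    fix x y assume "x + g x = y + g y"
    then have "dist x y = dist (g y) (g x)"
      by (metis add_diff_add diff_self dist_norm eq_iff_diff_eq_0 add_diff_cancel_left' diff_add_eq diff_diff_eq2 add.commute)
    also have "\<dots> \<le> c * dist x y"
      using g by (metis UNIV_I dist_commute lipschitz_onD)
    finally show "x = y"
      using \<open>c < 1\<close> by (metis dist_eq_0_iff linorder_not_less mult.commute mult_less_cancel_left2 zero_less_dist_iff)
  qed
  show "surj (\<lambda>x. x + g x)"
  proof (rule surjI[of _ "\<lambda>y. THE x. y - g x = x"])
    fix y
    have "\<exists>!x. x \<in> UNIV \<and> y - g x = x"
      by (rule Banach_fix[of _ c]) (use g c \<open>c < 1\<close> in \<open>auto simp: complete_UNIV dist_norm lipschitz_on_def norm_minus_commute\<close>)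
    then have "y - g (THE x. y - g x = x) = (THE x. y - g x = x)"
      using theI'[of "\<lambda>x. y - g x = x"] by simp
    then show "(THE x. y - g x = x) + g (THE x. y - g x = x) = y"
      by (simp add: algebra_simps)
  qed
qed

lemma lipschitz_derivative_norm_le:
  assumes "(f has_derivative D) (at x)" "L-lipschitz_on UNIV f"
  shows "norm (D h) \<le> L * norm h"
proof (cases "h = 0")
  case True
  interpret bounded_linear D using assms(1) has_derivative_bounded_linear by blast
  show ?thesis using True by (simp add: zero)
next
  case False
  interpret bounded_linear D using assms(1) has_derivative_bounded_linear by blast
  have "norm (D h) \<le> L * norm h + e" if "e > 0" for e
  proof -
    define e' where "e' = e / norm h"
    have "e' > 0" using that False by (simp add: e'_def)
    then obtain d where d: "d > 0" "\<And>y. norm (y - x) < d \<Longrightarrow> norm (f y - f x - D (y - x)) \<le> e' * norm (y - x)"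
      using assms(1) unfolding has_derivative_at_alt by blast
    define t where "t = d / (2 * norm h)"
    have t: "t > 0" "norm (t *\<^sub>R h) < d" using d(1) False by (auto simp: t_def)
    have "norm (f (x + t *\<^sub>R h) - f x - D (t *\<^sub>R h)) \<le> e' * norm (t *\<^sub>R h)"
      using d(2)[of "x + t *\<^sub>R h"] t by simp
    moreover have "norm (f (x + t *\<^sub>R h) - f x) \<le> L * norm (t *\<^sub>R h)"
      using lipschitz_on_normD[OF assms(2), of "x + t *\<^sub>R h" x] by simp
    ultimately have "norm (D (t *\<^sub>R h)) \<le> L * norm (t *\<^sub>R h) + e' * norm (t *\<^sub>R h)"
      using norm_triangle_ineq3[of "f (x + t *\<^sub>R h) - f x" "D (t *\<^sub>R h)"] by linarith
    then have "t * norm (D h) \<le> t * (L * norm h + e' * norm h)"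
      using t by (simp add: scaleR algebra_simps)
    then show ?thesis using t False by (simp add: e'_def)
  qed
  then show ?thesis by (rule field_le_epsilon)
qed

text \<open>The interpolation argument of Milnor and Rogers. For small \<open>s\<close> the map
  \<open>\<lambda>x. x + s *\<^sub>R g x\<close> permutes the ball, so the change of variables
  formula makes the integral of its Jacobian the volume of the ball. That Jacobian is a polynomial
  in \<open>s\<close>, and its integral, constant at enough small \<open>s\<close>, keeps this value
  at \<open>s = 1\<close>, where the map is \<open>f\<close>. Lipschitz maps that are differentiable
  off a null set suffice, which allows piecewise definitions.\<close>

theorem has_integral_det_derivative_eq_ball:
  fixes f :: "real^'n::{finite,wellorder} \<Rightarrow> real^'n::_"
  assumes lip: "L-lipschitz_on UNIV f"
    and out: "\<And>x. x \<notin> ball 0 R \<Longrightarrow> f x = x"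
    and N: "negligible N"
    and diff: "\<And>x. x \<notin> N \<Longrightarrow> f differentiable (at x)"
  shows "((\<lambda>x. det (matrix (frechet_derivative f (at x)))) has_integral
           measure lebesgue (ball 0 R :: (real^'n::_) set)) (ball 0 R)"
proof -
  define g where "g x = f x - x" for x
  define K where "K = L + 1"
  have K: "K \<ge> 1" using lipschitz_on_nonneg[OF lip] by (simp add: K_def)
  have lipg: "K-lipschitz_on UNIV g"
    unfolding g_def K_def using lip lipschitz_on_id by (rule lipschitz_on_diff)
  define A where "A x = matrix (frechet_derivative f (at x)) - mat 1" for x
  have derg: "(g has_derivative (*v) (A x)) (at x)" if "x \<notin> N" for x
  proof -
    have f': "(f has_derivative frechet_derivative f (at x)) (at x)"
      using diff[OF that] frechet_derivative_works by blast
    then have "linear (frechet_derivative f (at x))"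
      using has_derivative_linear by blast
    then have "(*v) (A x) = (\<lambda>h. frechet_derivative f (at x) h - h)"
      by (auto simp: A_def matrix_vector_mult_diff_rdistrib matrix_works)
    moreover have "(g has_derivative (\<lambda>h. frechet_derivative f (at x) h - h)) (at x)"
      unfolding g_def by (intro derivative_intros f')
    ultimately show ?thesis by simp
  qed
  define S where "S = ball (0::real^'n::_) R - N"
  have Sm: "S \<in> sets lebesgue"
    unfolding S_def using N by (intro sets.Diff) (auto simp: negligible_imp_sets)
  have neg: "negligible ((\<lambda>x. x + s *\<^sub>R g x) ` N)" for s
  proof (rule negligible_locally_Lipschitz_image[OF order_refl N])
    fix x
    have "norm (y + s *\<^sub>R g y - (x + s *\<^sub>R g x)) \<le> (1 + \<bar>s\<bar> * K) * norm (y - x)" for y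
    proof -
      have "norm (y + s *\<^sub>R g y - (x + s *\<^sub>R g x)) \<le> norm (y - x) + norm (s *\<^sub>R (g y - g x))"
        by (metis add_diff_add norm_triangle_ineq scaleR_right_diff_distrib)
      also have "\<dots> \<le> norm (y - x) + \<bar>s\<bar> * (K * norm (y - x))"
        using lipschitz_on_normD[OF lipg] by (simp add: mult_left_mono)
      finally show ?thesis by (simp add: algebra_simps)
    qed
    then show "\<exists>T B. open T \<and> x \<in> T \<and> (\<forall>y\<in>N \<inter> T. norm (y + s *\<^sub>R g y - (x + s *\<^sub>R g x)) \<le> B * norm (y - x))"
      by blast
  qed
  have int: "((\<lambda>x. det (mat 1 + s *\<^sub>R A x)) has_integral measure lebesgue (ball 0 R :: (real^'n::_) set)) S"
    if s: "0 < s" "s * K < 1" for s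
  proof -
    define h where "h x = x + s *\<^sub>R g x" for x
    have bij: "bij h"
      unfolding h_def
      by (rule bij_add_contraction[of "s * K"]) (use s lipschitz_on_cmult_nonneg[OF lipg, of s] in auto)
    have fixd: "h x = x" if "x \<notin> ball 0 R" for x
      using that out by (simp add: h_def g_def)
    have hball: "h ` ball 0 R = ball 0 R"
    proof -
      have "h ` (- ball 0 R) = - ball 0 R"
        using fixd by force
      then have "- (h ` ball 0 R) = - ball 0 R"
        using bij by (metis bij_image_Compl_eq)
      then show ?thesis by blast
    qed
    \<comment> \<open>The image of \<open>S\<close> differs from the ball only within the image of
      the null set \<open>N\<close>, which is null because \<open>h\<close> is Lipschitz.\<close>
    have sym: "negligible (ball 0 R - h ` S \<union> (h ` S - ball 0 R))"
    proof (rule negligible_subset)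
      show "negligible (h ` N)" using neg[of s] by (simp add: h_def[abs_def])
      show "ball 0 R - h ` S \<union> (h ` S - ball 0 R) \<subseteq> h ` N"
        using hball by (auto simp: S_def)
    qed
    have "h ` S \<in> lmeasurable \<and> measure lebesgue (h ` S) = measure lebesgue (ball (0::real^'n::_) R)"
      using lmeasurable_negligible_symdiff[OF lmeasurable_ball sym] measure_negligible_symdiff[OF lmeasurable_ball sym]
      by simp
    moreover have "(h has_derivative (*v) (mat 1 + s *\<^sub>R A x)) (at x within S)" if "x \<in> S" for x
    proof -
      have "((\<lambda>x. x + s *\<^sub>R g x) has_derivative (\<lambda>k. k + s *\<^sub>R (A x *v k))) (at x)"
        by (intro derivative_intros derg) (use that in \<open>auto simp: S_def\<close>)
      moreover have "(\<lambda>k. k + s *\<^sub>R (A x *v k)) = (*v) (mat 1 + s *\<^sub>R A x)"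
        by (auto simp: matrix_vector_mult_add_rdistrib scaleR_matrix_vector_assoc)
      ultimately show ?thesis
        by (auto simp: h_def[abs_def] intro: has_derivative_at_withinI)
    qed
    moreover have "inj_on h S"
      using bij bij_is_inj inj_on_subset by blast
    ultimately have "((\<lambda>x. \<bar>det (matrix ((*v) (mat 1 + s *\<^sub>R A x)))\<bar>) has_integral measure lebesgue (ball (0::real^'n::_) R)) S"
      using has_measure_differentiable_image[OF Sm, of h "\<lambda>x. (*v) (mat 1 + s *\<^sub>R A x)"] by blast
    moreover have "\<bar>det (matrix ((*v) (mat 1 + s *\<^sub>R A x)))\<bar> = det (mat 1 + s *\<^sub>R A x)" if "x \<in> S" for x
    proof -
      have "det (mat 1 + s *\<^sub>R A x) > 0"
        by (rule det_pencil_pos[of _ K])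
           (use that s lipschitz_derivative_norm_le[OF derg lipg] in \<open>auto simp: S_def\<close>)
      then show ?thesis by simp
    qed
    ultimately show ?thesis
      by (subst has_integral_cong) auto
  qed
  \<comment> \<open>These are \<open>CARD('n) + 1\<close> distinct nodes; at each of them
    \<open>s * K = 1 / (real i + 2) < 1\<close>, so \<open>int\<close> applies.\<close>
  define X where "X = (\<lambda>i. 1 / (K * (real i + 2))) ` {..<Suc CARD('n)}"
  have X: "0 < s" "s * K < 1" if "s \<in> X" for s
  proof -
    obtain i where i: "s = 1 / (K * (real i + 2))" using \<open>s \<in> X\<close> by (auto simp: X_def)
    have "K * (real i + 2) > 0" using K by simp
    then show "0 < s" by (simp add: i)
    have "s * K = 1 / (real i + 2)" using K by (simp add: i)
    then show "s * K < 1" by simp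
  qed
  have "inj_on (\<lambda>i. 1 / (K * (real i + 2))) {..<Suc CARD('n)}"
  proof (rule inj_onI)
    fix i j assume "1 / (K * (real i + 2)) = 1 / (K * (real j + 2))"
    then have "K * (real i + 2) = K * (real j + 2)"
      by (metis divide_divide_eq_right mult_1 div_by_1)
    then show "i = j" using K by simp
  qed
  then have "finite X" "card X = Suc CARD('n)"
    by (auto simp: X_def card_image)
  then obtain c where c: "\<And>p. degree p \<le> CARD('n) \<Longrightarrow> poly p 1 = (\<Sum>s\<in>X. c s * poly p s)"
    using poly_extrapolation[of X "CARD('n)" 1] by blast
  \<comment> \<open>Extrapolation of the constant polynomial 1: a weighted sum of equal volumes is
    that volume. The weights are applied under the integral, so integrability of the Jacobian at
    \<open>s = 1\<close> comes out as well.\<close>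
  have c1: "(\<Sum>s\<in>X. c s) = 1" using c[of 1] by simp
  have "((\<lambda>x. \<Sum>s\<in>X. c s * det (mat 1 + s *\<^sub>R A x)) has_integral
          (\<Sum>s\<in>X. c s * measure lebesgue (ball (0::real^'n::_) R))) S"
    by (intro has_integral_sum has_integral_mult_right int X \<open>finite X\<close>)
  moreover have "(\<Sum>s\<in>X. c s * det (mat 1 + s *\<^sub>R A x)) = det (matrix (frechet_derivative f (at x)))" for x
  proof -
    obtain p where p: "degree p \<le> CARD('n)" "\<And>s. poly p s = det (mat 1 + s *\<^sub>R A x)"
      using det_pencil_poly[of "A x"] by auto
    show ?thesis using c[OF p(1)] unfolding p(2) by (simp add: A_def)
  qed
  ultimately have "((\<lambda>x. det (matrix (frechet_derivative f (at x)))) has_integral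
           measure lebesgue (ball 0 R :: (real^'n::_) set)) S"
    using c1 by (simp add: sum_distrib_right[symmetric])
  then show ?thesis
    by (subst has_integral_spike_set_eq[of "ball 0 R" S]) (auto simp: S_def intro: negligible_subset[OF N])
qed

section \<open>Lipschitz functions\<close>

text \<open>The constant is hidden so that the closure properties compose without
  bookkeeping.\<close>

definition lipschitz_fun_on :: "'a::metric_space set \<Rightarrow> ('a \<Rightarrow> 'b::metric_space) \<Rightarrow> bool" where
  "lipschitz_fun_on S f \<longleftrightarrow> (\<exists>L. L-lipschitz_on S f)"

lemma lipschitz_fun_onI: "(\<And>x y. x \<in> S \<Longrightarrow> y \<in> S \<Longrightarrow> dist (f x) (f y) \<le> L * dist x y) \<Longrightarrow> lipschitz_fun_on S f"
  unfolding lipschitz_fun_on_def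
  by (rule exI[of _ "\<bar>L\<bar>"], rule lipschitz_onI) (auto intro: order_trans[OF _ mult_right_mono[OF abs_ge_self]])

lemma lipschitz_fun_onE:
  assumes "lipschitz_fun_on S f"
  obtains L where "L \<ge> 0" "\<And>x y. x \<in> S \<Longrightarrow> y \<in> S \<Longrightarrow> dist (f x) (f y) \<le> L * dist x y"
  using assms unfolding lipschitz_fun_on_def lipschitz_on_def by blast

lemma lipschitz_fun_on_continuous: "lipschitz_fun_on S f \<Longrightarrow> continuous_on S f"
  unfolding lipschitz_fun_on_def using lipschitz_on_continuous_on by blast

lemma lipschitz_fun_on_const [intro]: "lipschitz_fun_on S (\<lambda>x. c)"
  unfolding lipschitz_fun_on_def using lipschitz_on_constant by blast

lemma lipschitz_fun_on_id [intro]: "lipschitz_fun_on S (\<lambda>x. x)"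
  unfolding lipschitz_fun_on_def using lipschitz_on_id by blast

lemma lipschitz_fun_on_add [intro]:
  fixes f g :: "'a::metric_space \<Rightarrow> 'b::real_normed_vector"
  shows "lipschitz_fun_on S f \<Longrightarrow> lipschitz_fun_on S g \<Longrightarrow> lipschitz_fun_on S (\<lambda>x. f x + g x)"
  unfolding lipschitz_fun_on_def using lipschitz_on_add by blast

lemma lipschitz_fun_on_diff [intro]:
  fixes f g :: "'a::metric_space \<Rightarrow> 'b::real_normed_vector"
  shows "lipschitz_fun_on S f \<Longrightarrow> lipschitz_fun_on S g \<Longrightarrow> lipschitz_fun_on S (\<lambda>x. f x - g x)"
  unfolding lipschitz_fun_on_def using lipschitz_on_diff by blast

lemma lipschitz_fun_on_compose:
  assumes "lipschitz_fun_on S f" "lipschitz_fun_on T g" "f ` S \<subseteq> T"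
  shows "lipschitz_fun_on S (\<lambda>x. g (f x))"
proof -
  obtain L where "L-lipschitz_on S f" using assms(1) by (auto simp: lipschitz_fun_on_def)
  moreover obtain M where "M-lipschitz_on (f ` S) g"
    using assms(2,3) by (auto simp: lipschitz_fun_on_def intro: lipschitz_on_subset)
  ultimately have "(M * L)-lipschitz_on S (g \<circ> f)" by (rule lipschitz_on_compose)
  then show ?thesis by (auto simp: lipschitz_fun_on_def o_def)
qed

lemma lipschitz_fun_on_linear:
  "bounded_linear f \<Longrightarrow> lipschitz_fun_on S f"
  unfolding lipschitz_fun_on_def using bounded_linear.lipschitz_boundE by blast

lemma lipschitz_fun_on_norm:
  fixes f :: "'a::metric_space \<Rightarrow> 'b::real_normed_vector"
  assumes "lipschitz_fun_on S f"
  shows "lipschitz_fun_on S (\<lambda>x. norm (f x))"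
proof -
  have "lipschitz_fun_on UNIV (norm :: 'b \<Rightarrow> real)"
    by (rule lipschitz_fun_onI[of _ _ 1]) (simp add: dist_norm norm_triangle_ineq3)
  then show ?thesis using lipschitz_fun_on_compose[OF assms, of UNIV norm] by simp
qed

lemma lipschitz_fun_on_max_const:
  assumes "lipschitz_fun_on S f"
  shows "lipschitz_fun_on S (\<lambda>x. max (c::real) (f x))"
proof -
  have "lipschitz_fun_on UNIV (max c)"
    by (rule lipschitz_fun_onI[of _ _ 1]) (auto simp: dist_real_def max_def)
  then show ?thesis using lipschitz_fun_on_compose[OF assms, of UNIV "max c"] by simp
qed

lemma lipschitz_fun_on_min_const:
  assumes "lipschitz_fun_on S f"
  shows "lipschitz_fun_on S (\<lambda>x. min (c::real) (f x))"
proof -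
  have "lipschitz_fun_on UNIV (min c)"
    by (rule lipschitz_fun_onI[of _ _ 1]) (auto simp: dist_real_def min_def)
  then show ?thesis using lipschitz_fun_on_compose[OF assms, of UNIV "min c"] by simp
qed

lemma lipschitz_fun_on_scaleR:
  fixes g :: "'a::metric_space \<Rightarrow> 'b::real_normed_vector"
  assumes "compact S" "lipschitz_fun_on S f" "lipschitz_fun_on S g"
  shows "lipschitz_fun_on S (\<lambda>x. f x *\<^sub>R g x)"
proof -
  obtain L where L: "L \<ge> 0" "\<And>x y. x \<in> S \<Longrightarrow> y \<in> S \<Longrightarrow> dist (f x) (f y) \<le> L * dist x y"
    using lipschitz_fun_onE[OF assms(2)] by metis
  obtain M where M: "M \<ge> 0" "\<And>x y. x \<in> S \<Longrightarrow> y \<in> S \<Longrightarrow> dist (g x) (g y) \<le> M * dist x y"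
    using lipschitz_fun_onE[OF assms(3)] by metis
  have "bounded (f ` S)" "bounded (g ` S)"
    using assms by (auto intro!: compact_imp_bounded compact_continuous_image lipschitz_fun_on_continuous)
  then obtain A B where A: "\<And>x. x \<in> S \<Longrightarrow> \<bar>f x\<bar> \<le> A" and B: "\<And>x. x \<in> S \<Longrightarrow> norm (g x) \<le> B"
    by (auto simp: bounded_iff)
  show ?thesis
  proof (rule lipschitz_fun_onI)
    fix x y assume xy: "x \<in> S" "y \<in> S"
    have "f x *\<^sub>R g x - f y *\<^sub>R g y = f x *\<^sub>R (g x - g y) + (f x - f y) *\<^sub>R g y"
      by (simp add: algebra_simps)
    then have "norm (f x *\<^sub>R g x - f y *\<^sub>R g y) \<le> \<bar>f x\<bar> * norm (g x - g y) + \<bar>f x - f y\<bar> * norm (g y)"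
      by (metis norm_scaleR norm_triangle_ineq)
    also have "\<dots> \<le> A * (M * dist x y) + (L * dist x y) * B"
      using A[OF xy(1)] B[OF xy(2)] L(2)[OF xy] M(2)[OF xy] L(1) M(1)
      by (intro add_mono mult_mono) (auto simp: dist_norm)
    finally show "dist (f x *\<^sub>R g x) (f y *\<^sub>R g y) \<le> (A * M + L * B) * dist x y"
      by (simp add: dist_norm algebra_simps)
  qed
qed

lemma lipschitz_fun_on_mult:
  fixes f g :: "'a::metric_space \<Rightarrow> real"
  assumes "compact S" "lipschitz_fun_on S f" "lipschitz_fun_on S g"
  shows "lipschitz_fun_on S (\<lambda>x. f x * g x)"
  using lipschitz_fun_on_scaleR[OF assms] by simp

lemma lipschitz_fun_on_sum:
  fixes f :: "'i \<Rightarrow> 'a::metric_space \<Rightarrow> 'b::real_normed_vector"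
  assumes "\<And>i. i \<in> I \<Longrightarrow> lipschitz_fun_on S (f i)"
  shows "lipschitz_fun_on S (\<lambda>x. \<Sum>i\<in>I. f i x)"
  using assms by (induction I rule: infinite_finite_induct) auto

lemma lipschitz_fun_on_polynomial_function:
  fixes p :: "'a::real_normed_vector \<Rightarrow> 'b::euclidean_space"
  assumes p: "polynomial_function p" and S: "compact S"
  shows "lipschitz_fun_on S p"
proof -
  have "lipschitz_fun_on S (q::'a\<Rightarrow>real)" if "real_polynomial_function q" for q
    using that by (induction rule: real_polynomial_function.induct)
      (auto intro: lipschitz_fun_on_linear lipschitz_fun_on_mult[OF S])
  moreover have "real_polynomial_function (\<lambda>x. p x \<bullet> b)" for b
    using p bounded_linear_inner_left unfolding polynomial_function_def o_def by blast
  ultimately have "lipschitz_fun_on S (\<lambda>x. \<Sum>b\<in>Basis. (p x \<bullet> b) *\<^sub>R b)"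
    by (intro lipschitz_fun_on_sum lipschitz_fun_on_scaleR[OF S] lipschitz_fun_on_const) auto
  then show ?thesis by (simp add: euclidean_representation)
qed

text \<open>Composing \<open>f - id\<close> with the nearest point projection onto the ball gives a
  Lipschitz map and changes nothing: outside the ball the projection lands on the sphere, where
  \<open>f - id\<close> vanishes just as it does outside.\<close>

lemma lipschitz_extension_by_id:
  fixes f :: "'a::euclidean_space \<Rightarrow> 'a"
  assumes lip: "lipschitz_fun_on (cball 0 R) f" and out: "\<And>x. norm x \<ge> R \<Longrightarrow> f x = x" and "R > 0"
  shows "lipschitz_fun_on UNIV f"
proof -
  define g where "g x = f x - x" for x
  have "lipschitz_fun_on (cball 0 R) g"
    unfolding g_def using lip by (intro lipschitz_fun_on_diff lipschitz_fun_on_id)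
  moreover have "lipschitz_fun_on UNIV (closest_point (cball (0::'a) R))"
    using \<open>R > 0\<close> by (intro lipschitz_fun_onI[of _ _ 1]) (simp add: closest_point_lipschitz)
  moreover have "range (closest_point (cball (0::'a) R)) \<subseteq> cball 0 R"
    using \<open>R > 0\<close> closest_point_in_set[of "cball (0::'a) R"] by auto
  ultimately have "lipschitz_fun_on UNIV (\<lambda>x. g (closest_point (cball 0 R) x))"
    by (intro lipschitz_fun_on_compose[of UNIV _ "cball 0 R" g])
  moreover have "g (closest_point (cball 0 R) x) = g x" for x
  proof (cases "norm x \<le> R")
    case True
    then show ?thesis by (simp add: closest_point_self)
  next
    case False
    have "interior (cball (0::'a) R) \<noteq> {}" using \<open>R > 0\<close> by simp
    moreover have "closest_point (cball 0 R) x \<in> rel_frontier (cball 0 R)"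
    proof (rule closest_point_in_rel_frontier)
      show "x \<in> affine hull cball 0 R - rel_interior (cball 0 R)"
        using calculation False by (simp add: affine_hull_nonempty_interior rel_interior_nonempty_interior)
    qed (use \<open>R > 0\<close> in auto)
    ultimately have "closest_point (cball 0 R) x \<in> frontier (cball 0 R)"
      by (simp add: rel_frontier_nonempty_interior)
    then have "norm (closest_point (cball 0 R) x) = R"
      using \<open>R > 0\<close> by simp
    then show ?thesis using out[of "closest_point (cball 0 R) x"] out[of x] False by (simp add: g_def)
  qed
  ultimately have "lipschitz_fun_on UNIV (\<lambda>x. g x + x)"
    by auto
  then show ?thesis by (simp add: g_def)
qed

section \<open>Differentiability of cutoff functions and degenerate Jacobians\<close>

lemma differentiable_clamp01:
  fixes u :: "'a::real_normed_vector \<Rightarrow> real"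
  assumes u: "u differentiable (at x)" and "u x \<noteq> 0" "u x \<noteq> 1"
  shows "(\<lambda>x. max 0 (min 1 (u x))) differentiable (at x)"
proof -
  have c: "isCont u x" using u differentiable_imp_continuous_within by blast
  consider "u x < 0" | "0 < u x" "u x < 1" | "1 < u x" using assms by linarith
  then obtain v where v: "v differentiable (at x)" "\<forall>\<^sub>F y in at x. max 0 (min 1 (u y)) = v y" "max 0 (min 1 (u x)) = v x"
  proof cases
    case 1
    then have "\<forall>\<^sub>F y in at x. u y < 0" using c by (simp add: isCont_def order_tendstoD)
    then show ?thesis using 1 by (intro that[of "\<lambda>_. 0"]) (auto elim!: eventually_mono)
  next
    case 2
    then have "\<forall>\<^sub>F y in at x. 0 < u y \<and> u y < 1" using c by (simp add: isCont_def order_tendstoD eventually_conj_iff)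
    then show ?thesis using 2 u by (intro that[of u]) (auto elim!: eventually_mono)
  next
    case 3
    then have "\<forall>\<^sub>F y in at x. 1 < u y" using c by (simp add: isCont_def order_tendstoD)
    then show ?thesis using 3 by (intro that[of "\<lambda>_. 1"]) (auto elim!: eventually_mono)
  qed
  then obtain D where "(v has_derivative D) (at x)" by (auto simp: differentiable_def)
  then have "((\<lambda>x. max 0 (min 1 (u x))) has_derivative D) (at x)"
    by (rule has_derivative_transform_eventually) (use v(2,3) in \<open>auto elim!: eventually_mono\<close>)
  then show ?thesis by (auto simp: differentiable_def)
qed

text \<open>If the derivative were invertible, some direction \<open>h\<close> would satisfy
  \<open>D h = f x\<close>. Along it \<open>f \<bullet> f\<close> has derivative
  \<open>2 * (f x \<bullet> f x)\<close>, but this function is locally constant and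
  \<open>f x\<close> is not 0.\<close>

lemma det_derivative_norm_const:
  fixes f :: "real^'n \<Rightarrow> real^'n"
  assumes f: "(f has_derivative D) (at x)" and c: "\<forall>\<^sub>F y in nhds x. norm (f y) = c" and "c > 0"
  shows "det (matrix D) = 0"
proof (rule ccontr)
  assume "det (matrix D) \<noteq> 0"
  have lin: "linear D" using f has_derivative_linear by blast
  have "invertible (matrix D)" using \<open>det (matrix D) \<noteq> 0\<close> invertible_det_nz by blast
  then obtain B where B: "matrix D ** B = mat 1" unfolding invertible_def by blast
  define h where "h = B *v f x"
  have "D h = matrix D *v (B *v f x)" using lin by (simp add: h_def matrix_works)
  then have h: "D h = f x" by (simp add: matrix_vector_mul_assoc B)
  have d1: "((\<lambda>y. f y \<bullet> f y) has_derivative (\<lambda>h. f x \<bullet> D h + D h \<bullet> f x)) (at x)"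
    by (intro derivative_intros f)
  have d2: "((\<lambda>y. f y \<bullet> f y) has_derivative (\<lambda>h. 0)) (at x)"
    by (rule has_derivative_transform_eventually[of "\<lambda>_. c\<^sup>2"])
      (use c in \<open>auto simp: eventually_nhds_conv_at power2_norm_eq_inner[symmetric] elim!: eventually_mono\<close>)
  have "f x \<bullet> D h + D h \<bullet> f x = 0"
    using fun_cong[OF has_derivative_unique[OF d1 d2], of h] .
  then have "f x = 0" using h by simp
  moreover have "norm (f x) = c" using c by (rule eventually_nhds_x_imp_x)
  ultimately show False using \<open>c > 0\<close> by simp
qed

section \<open>Maps that are translations near their zeros\<close>

text \<open>A continuous map is replaced by one regular enough for the Jacobian integral without
  gaining zeros. A polynomial approximation \<open>Q\<close> is blended with the translations near
  \<open>Z\<close> and with the identity outside. \<open>F\<close> already equals these models where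
  the blending takes place, so \<open>G\<close> stays between \<open>F\<close> and \<open>Q\<close>,
  while \<open>F\<close> is bounded away from 0 off \<open>Z\<close>.\<close>

lemma smooth_translation_germs:
  fixes F :: "'a::euclidean_space \<Rightarrow> 'a"
  assumes contF: "continuous_on UNIV F"
    and R: "R > 0" "\<And>x. norm x \<ge> R \<Longrightarrow> F x = x"
    and Z: "finite Z" and r: "r > 0" "\<And>z x. z \<in> Z \<Longrightarrow> dist z x < r \<Longrightarrow> F x = x - z"
    and nz: "\<And>x. F x = 0 \<Longrightarrow> x \<in> Z"
  obtains G N \<eta> where
    "lipschitz_fun_on (cball 0 (R + 1)) G" "negligible N" "\<And>x. x \<notin> N \<Longrightarrow> G differentiable (at x)"
    "\<And>x. norm x \<ge> R + 1 \<Longrightarrow> G x = x"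
    "0 < \<eta>" "\<eta> < R" "\<And>z x. z \<in> Z \<Longrightarrow> dist z x < 2 * \<eta> \<Longrightarrow> G x = x - z"
    "\<And>x. norm (G x) \<le> \<eta> \<Longrightarrow> \<exists>z\<in>Z. dist z x \<le> \<eta>"
    "pairwise (\<lambda>z z'. \<eta> < dist z z' / 2) Z" "\<And>z. z \<in> Z \<Longrightarrow> ball z \<eta> \<subseteq> ball 0 R"
proof -
  \<comment> \<open>Points of \<open>Z\<close> are then at least \<open>4 * s\<close> apart, so the
    cutoffs around them, which vanish from radius \<open>2 * s\<close> on, do not overlap.\<close>
  define s where "s = min r R / 4"
  have s: "s > 0" "4 * s \<le> r" "4 * s \<le> R" using r R by (auto simp: s_def)
  have FZ: "F z = 0" if "z \<in> Z" for z using r that by fastforce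
  have sep: "4 * s \<le> dist z z'" if "z \<in> Z" "z' \<in> Z" "z \<noteq> z'" for z z'
    using r(2)[OF that(1), of z'] FZ[OF that(2)] that(3) s by (force simp: not_le[symmetric])
  have inR: "norm x < R" if "z \<in> Z" "dist z x < 4 * s" for z x
  proof (rule ccontr)
    assume "\<not> norm x < R"
    then have x: "norm x \<ge> R" by simp
    then have "x - z = x" using r(2)[OF that(1), of x] R(2)[OF x] that(2) s by auto
    then show False using x that s by (simp add: dist_norm)
  qed
  define C where "C = cball 0 (R + 1) - (\<Union>z\<in>Z. ball z s)"
  have "compact C" unfolding C_def by (intro compact_diff) auto
  have "\<exists>e>0. \<forall>x\<in>C. e \<le> norm (F x)"
  proof (cases "C = {}")
    case False
    have "continuous_on C (\<lambda>x. norm (F x))"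
      by (intro continuous_intros continuous_on_subset[OF contF]) auto
    then obtain x0 where x0: "x0 \<in> C" "\<forall>x\<in>C. norm (F x0) \<le> norm (F x)"
      using continuous_attains_inf[OF \<open>compact C\<close> False] by blast
    then have "F x0 \<noteq> 0" using nz[of x0] s by (force simp: C_def)
    then show ?thesis using x0 by (intro exI[of _ "norm (F x0)"]) auto
  qed (auto intro: exI[of _ 1])
  then obtain e where e: "e > 0" "\<And>x. x \<in> C \<Longrightarrow> e \<le> norm (F x)" by blast
  obtain Q where Q: "polynomial_function Q" "\<And>x. x \<in> cball 0 (R + 1) \<Longrightarrow> norm (F x - Q x) < e / 2"
    using Stone_Weierstrass_polynomial_function[OF compact_cball continuous_on_subset[OF contF subset_UNIV], of "e/2"] e
    by fastforce
  \<comment> \<open>The cutoffs are clamps of polynomials in the squared norm: around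
    \<open>z\<close> the clamp of \<open>u\<close> is 1 up to radius \<open>s\<close> and 0 from
    \<open>sqrt 2 * s\<close> on. In \<open>v\<close>, \<open>2 * R + 1\<close> is the difference of
    the squares of \<open>R + 1\<close> and \<open>R\<close>. Differentiability can fail only on the
    spheres where \<open>u\<close> or \<open>v\<close> is 0 or 1.\<close>
  define u where "u z x = 2 - (x - z) \<bullet> (x - z) / s\<^sup>2" for z x :: 'a
  define v where "v x = (x \<bullet> x - R\<^sup>2) / (2 * R + 1)" for x :: 'a
  define \<phi> where "\<phi> z x = max 0 (min 1 (u z x))" for z x
  define \<psi> where "\<psi> x = max 0 (min 1 (v x))" for x
  have phi1: "\<phi> z x = 1" if "dist z x \<le> s" for z x
  proof -
    have "norm (x - z) ^ 2 \<le> s ^ 2" using that by (intro power_mono) (auto simp: dist_norm norm_minus_commute)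
    then show ?thesis using s by (simp add: \<phi>_def u_def power2_norm_eq_inner)
  qed
  have phi0: "\<phi> z x = 0" if "dist z x \<ge> 2 * s" for z x
  proof -
    have "(2 * s) ^ 2 \<le> norm (x - z) ^ 2" using that s by (intro power_mono) (auto simp: dist_norm norm_minus_commute)
    then have "4 \<le> (x - z) \<bullet> (x - z) / s\<^sup>2" using s by (simp add: power2_norm_eq_inner field_simps)
    then show ?thesis by (simp add: \<phi>_def u_def)
  qed
  have psi0: "\<psi> x = 0" if "norm x \<le> R" for x
  proof -
    have "norm x ^ 2 \<le> R ^ 2" using that by (intro power_mono) auto
    then show ?thesis using R by (simp add: \<psi>_def v_def power2_norm_eq_inner divide_nonpos_pos)
  qed
  have psi1: "\<psi> x = 1" if "norm x \<ge> R + 1" for x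
  proof -
    have "(R + 1) ^ 2 \<le> norm x ^ 2" using that R by (intro power_mono) auto
    then have "1 \<le> v x" using R by (simp add: v_def power2_norm_eq_inner field_simps power2_sum)
    then show ?thesis by (simp add: \<psi>_def)
  qed
  define G where "G x = Q x + (\<Sum>z\<in>Z. \<phi> z x *\<^sub>R (x - z - Q x)) + \<psi> x *\<^sub>R (x - Q x)" for x
  have sum1: "(\<Sum>z\<in>Z. \<phi> z x *\<^sub>R (x - z - Q x)) = \<phi> z x *\<^sub>R (x - z - Q x)"
    if z: "z \<in> Z" "dist z x < 2 * s" for z x
  proof -
    have "\<phi> z' x = 0" if "z' \<in> Z - {z}" for z'
      using sep[of z z'] z that dist_triangle[of z z' x] by (intro phi0) (auto simp: dist_commute)
    then have "(\<Sum>z\<in>Z. \<phi> z x *\<^sub>R (x - z - Q x)) = (\<Sum>z\<in>{z}. \<phi> z x *\<^sub>R (x - z - Q x))"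
      using Z z by (intro sum.mono_neutral_right) auto
    then show ?thesis by simp
  qed
  have sum0: "(\<Sum>z\<in>Z. \<phi> z x *\<^sub>R (x - z - Q x)) = 0" if "\<And>z. z \<in> Z \<Longrightarrow> dist z x \<ge> 2 * s" for x
    using phi0 that by (intro sum.neutral) auto
  have near: "\<exists>c\<in>{0..1}. G x = F x + c *\<^sub>R (Q x - F x)" for x
  proof (cases "\<exists>z\<in>Z. dist z x < 2 * s")
    case True
    then obtain z where z: "z \<in> Z" "dist z x < 2 * s" by blast
    have "G x = Q x + \<phi> z x *\<^sub>R (F x - Q x)"
      using sum1[OF z] psi0[of x] inR[OF z(1), of x] r(2)[OF z(1), of x] z(2) s by (simp add: G_def)
    then show ?thesis
      by (intro bexI[of _ "1 - \<phi> z x"]) (auto simp: algebra_simps \<phi>_def)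
  next
    case False
    then have *: "G x = Q x + \<psi> x *\<^sub>R (x - Q x)" using sum0[of x] by (force simp: G_def)
    show ?thesis
    proof (cases "norm x \<ge> R")
      case True
      then show ?thesis using * R(2)[OF True]
        by (intro bexI[of _ "1 - \<psi> x"]) (auto simp: algebra_simps \<psi>_def)
    next
      case False
      then show ?thesis using * psi0[of x] by (intro bexI[of _ 1]) auto
    qed
  qed
  \<comment> \<open>\<open>s / 2\<close> keeps the balls of radius \<open>2 * \<eta>\<close> inside
    the region where the cutoff is 1; \<open>e / 2\<close> makes
    \<open>norm (G x) \<le> \<eta>\<close> impossible on \<open>C\<close>, where \<open>F\<close>
    has norm at least \<open>e\<close> and \<open>G\<close> is closer to \<open>F\<close> than
    \<open>e / 2\<close>.\<close>
  define \<eta> where "\<eta> = min (s / 2) (e / 2)"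
  have \<eta>: "0 < \<eta>" "\<eta> \<le> s / 2" "\<eta> \<le> e / 2" using s e by (auto simp: \<eta>_def)
  have Gfar: "G x = x" if "norm x \<ge> R + 1" for x
  proof -
    have "2 * s \<le> dist z x" if "z \<in> Z" for z
      using inR[OF that, of x] \<open>norm x \<ge> R + 1\<close> s by (cases "dist z x < 4 * s") auto
    then show ?thesis using sum0[of x] psi1[OF that] by (simp add: G_def)
  qed
  have Gnear: "G x = x - z" if "z \<in> Z" "dist z x < 2 * \<eta>" for z x
    using sum1[OF that(1), of x] psi0[of x] inR[OF that(1), of x] that(2) \<eta> s phi1[of z x] by (simp add: G_def)
  have Gsmall: "\<exists>z\<in>Z. dist z x \<le> \<eta>" if small: "norm (G x) \<le> \<eta>" for x
  proof -
    have xR: "norm x \<le> R + 1"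
      using Gfar[of x] small \<eta> s by (cases "norm x \<ge> R + 1") auto
    have "x \<notin> C"
    proof
      assume "x \<in> C"
      then have "e \<le> norm (F x)" using e by simp
      obtain c where c: "c \<in> {0..1}" "G x = F x + c *\<^sub>R (Q x - F x)" using near by blast
      have "norm (F x) \<le> norm (G x) + norm (c *\<^sub>R (Q x - F x))"
        by (metis c(2) add_diff_cancel_right' norm_triangle_ineq4)
      also have "norm (c *\<^sub>R (Q x - F x)) \<le> norm (F x - Q x)"
        using c(1) mult_left_le_one_le[of "norm (Q x - F x)" c] by (auto simp: norm_minus_commute)
      also have "\<dots> < e / 2" using Q(2)[of x] xR by simp
      finally show False using \<open>e \<le> norm (F x)\<close> small \<eta> by simp
    qed
    then obtain z where z: "z \<in> Z" "dist z x < s" using xR by (auto simp: C_def)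
    then have "G x = x - z"
      using sum1[OF z(1), of x] psi0[of x] inR[OF z(1), of x] s phi1[of z x] by (simp add: G_def)
    then show ?thesis using z small by (auto simp: dist_norm norm_minus_commute)
  qed
  define N where "N = (\<Union>z\<in>Z. sphere z s \<union> sphere z (sqrt 2 * s)) \<union> sphere 0 R \<union> sphere 0 (R + 1)"
  have "negligible N"
    unfolding N_def using Z by (auto intro!: negligible_Un negligible_Union negligible_sphere)
  have diffQ: "Q differentiable (at x)" for x
    using Q(1) differentiable_at_polynomial_function by blast
  have diff: "G differentiable (at x)" if "x \<notin> N" for x
  proof -
    have "\<phi> z differentiable (at x)" if "z \<in> Z" for z
      unfolding \<phi>_def[abs_def]
    proof (rule differentiable_clamp01)
      show "u z differentiable at x"
        unfolding u_def[abs_def] using s by (intro derivative_intros) auto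
      have "dist z x \<noteq> s" "dist z x \<noteq> sqrt 2 * s" using \<open>x \<notin> N\<close> that by (auto simp: N_def)
      then have "(norm (x - z))\<^sup>2 \<noteq> s\<^sup>2" "(norm (x - z))\<^sup>2 \<noteq> (sqrt 2 * s)\<^sup>2"
        using s by (auto simp: power2_eq_iff_nonneg dist_norm norm_minus_commute simp del: real_sqrt_mult)
      then show "u z x \<noteq> 0" "u z x \<noteq> 1"
        using s by (auto simp: u_def power2_norm_eq_inner field_simps power_mult_distrib)
    qed
    moreover have "\<psi> differentiable (at x)"
      unfolding \<psi>_def[abs_def]
    proof (rule differentiable_clamp01)
      show "v differentiable at x"
        unfolding v_def[abs_def] using R by (intro derivative_intros) auto
      have "norm x \<noteq> R" "norm x \<noteq> R + 1" using \<open>x \<notin> N\<close> by (auto simp: N_def)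
      then have "(norm x)\<^sup>2 \<noteq> R\<^sup>2" "(norm x)\<^sup>2 \<noteq> (R + 1)\<^sup>2"
        using R by (auto simp: power2_eq_iff_nonneg)
      then show "v x \<noteq> 0" "v x \<noteq> 1"
        using R by (auto simp: v_def power2_norm_eq_inner field_simps power2_sum)
    qed
    ultimately show ?thesis
      unfolding G_def[abs_def] using Z diffQ by (intro derivative_intros differentiable_scaleR differentiable_sum) auto
  qed
  have lipQ: "lipschitz_fun_on (cball 0 (R + 1)) Q"
    by (rule lipschitz_fun_on_polynomial_function[OF Q(1) compact_cball])
  have lipi: "lipschitz_fun_on (cball 0 (R + 1)) (\<lambda>x. (x - z) \<bullet> (x - z))" for z :: 'a
  proof -
    have "lipschitz_fun_on (cball 0 (R + 1)) (\<lambda>x. norm (x - z) * norm (x - z))"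
      by (intro lipschitz_fun_on_mult lipschitz_fun_on_norm lipschitz_fun_on_diff) auto
    then show ?thesis by (simp add: power2_norm_eq_inner[symmetric] power2_eq_square)
  qed
  have "lipschitz_fun_on (cball 0 (R + 1)) (u z)" for z
    unfolding u_def[abs_def] divide_inverse
    by (intro lipschitz_fun_on_mult lipschitz_fun_on_diff lipi) auto
  then have lipphi: "lipschitz_fun_on (cball 0 (R + 1)) (\<phi> z)" for z
    unfolding \<phi>_def[abs_def] by (intro lipschitz_fun_on_max_const lipschitz_fun_on_min_const)
  have "lipschitz_fun_on (cball 0 (R + 1)) v"
    unfolding v_def[abs_def] divide_inverse using lipi[of 0]
    by (intro lipschitz_fun_on_mult lipschitz_fun_on_diff) auto
  then have lippsi: "lipschitz_fun_on (cball 0 (R + 1)) \<psi>"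
    unfolding \<psi>_def[abs_def] by (intro lipschitz_fun_on_max_const lipschitz_fun_on_min_const)
  have lipG: "lipschitz_fun_on (cball 0 (R + 1)) G"
    unfolding G_def[abs_def]
    by (intro lipschitz_fun_on_add lipschitz_fun_on_sum lipschitz_fun_on_scaleR lipschitz_fun_on_diff
        lipQ lipphi lippsi lipschitz_fun_on_id lipschitz_fun_on_const compact_cball)
  show ?thesis
  proof (rule that[OF lipG \<open>negligible N\<close> diff Gfar \<open>\<eta> > 0\<close> _ Gnear Gsmall])
    show "\<eta> < R" using \<eta> s by simp
    show "pairwise (\<lambda>z z'. \<eta> < dist z z' / 2) Z"
      using sep \<eta> s by (force simp: pairwise_def)
    show "ball z \<eta> \<subseteq> ball 0 R" if "z \<in> Z" for z
      using inR[OF that] \<eta> s by (auto simp: subset_iff)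
  qed
qed

text \<open>For the map \<open>f\<close> of the proof, the Jacobian has integral over the ball of
  radius \<open>S\<close> equal to the volume, since \<open>f\<close> is the identity further out.
  It also vanishes wherever \<open>f\<close> takes values in the sphere of radius \<open>S\<close>,
  and on the ball of radius \<open>\<eta>\<close> around a zero it is
  \<open>(S / \<eta>) ^ CARD('n)\<close>, so each zero contributes that volume once. Hence there is
  exactly one.\<close>

theorem card_translation_zeros:
  fixes F :: "real^'n::{finite,wellorder} \<Rightarrow> real^'n::_"
  assumes contF: "continuous_on UNIV F"
    and R: "R > 0" "\<And>x. norm x \<ge> R \<Longrightarrow> F x = x"
    and Z: "finite Z" and r: "r > 0" "\<And>z x. z \<in> Z \<Longrightarrow> dist z x < r \<Longrightarrow> F x = x - z"
    and nz: "\<And>x. F x = 0 \<Longrightarrow> x \<in> Z"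
  shows "card Z = 1"
proof -
  obtain G N \<eta> where
    lipG: "lipschitz_fun_on (cball 0 (R + 1)) G" and N: "negligible N"
    and diffG: "\<And>x. x \<notin> N \<Longrightarrow> G differentiable (at x)"
    and Gfar: "\<And>x. norm x \<ge> R + 1 \<Longrightarrow> G x = x"
    and \<eta>: "0 < \<eta>" "\<eta> < R" and Gnear: "\<And>z x. z \<in> Z \<Longrightarrow> dist z x < 2 * \<eta> \<Longrightarrow> G x = x - z"
    and Gsmall: "\<And>x. norm (G x) \<le> \<eta> \<Longrightarrow> \<exists>z\<in>Z. dist z x \<le> \<eta>"
    and sep: "pairwise (\<lambda>z z'. \<eta> < dist z z' / 2) Z"
    and inR: "\<And>z. z \<in> Z \<Longrightarrow> ball z \<eta> \<subseteq> ball 0 R"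
    using smooth_translation_germs[OF assms] by blast
  have lipGU: "lipschitz_fun_on UNIV G"
    using lipschitz_extension_by_id[OF lipG Gfar] R by simp
  have "bounded (G ` cball 0 (R + 1))"
    by (intro compact_imp_bounded compact_continuous_image lipschitz_fun_on_continuous[OF lipG]) auto
  then obtain B where B: "\<And>x. norm x \<le> R + 1 \<Longrightarrow> norm (G x) \<le> B"
    unfolding bounded_iff by auto (metis (no_types) mem_cball_0)
  \<comment> \<open>\<open>S\<close> exceeds \<open>R + 1\<close> and all values
    \<open>norm (G x)\<close> with \<open>norm x \<le> R + 1\<close>, so
    \<open>norm (G x) \<ge> S\<close> can only happen where \<open>G x = x\<close>.\<close>
  define S where "S = max B (R + 1) + 1"
  have S: "S > R + 1" "S > 0" "S > \<eta>" using R \<eta> by (auto simp: S_def)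
  have GS: "norm (G x) < S" if "norm x \<le> R + 1" for x
    using B[OF that] by (simp add: S_def)
  text \<open>\<open>f\<close> follows \<open>G\<close> by the radial map that blows the ball of radius \<open>\<eta>\<close> up to radius \<open>S\<close>,
    collapses the shell around it onto the sphere of radius \<open>S\<close> and is the identity further out.\<close>
  define f where "f x = max S (norm (G x)) *\<^sub>R (inverse (max \<eta> (norm (G x))) *\<^sub>R G x)" for x
  have f_far: "f x = x" if "norm x \<ge> S" for x
  proof -
    have "x \<noteq> 0" using that S by auto
    then show ?thesis using Gfar[of x] that S by (simp add: f_def max_def)
  qed
  have f_near: "f x = (S / \<eta>) *\<^sub>R (x - z)" if "z \<in> Z" "dist z x < \<eta>" for z x
    using Gnear[of z x] that \<eta> S by (simp add: f_def max_def dist_norm norm_minus_commute divide_inverse)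
  have f_mid: "norm (f x) = S" if "norm (G x) > \<eta>" "norm (G x) < S" for x
  proof -
    have "G x \<noteq> 0" using that \<eta> by auto
    then show ?thesis using that S by (simp add: f_def max_def)
  qed
  have lipf: "lipschitz_fun_on (cball 0 S) f"
  proof -
    have lipG': "lipschitz_fun_on (cball 0 S) G"
      using lipGU lipschitz_on_subset[OF _ subset_UNIV] unfolding lipschitz_fun_on_def by blast
    have "lipschitz_fun_on {\<eta>..} (inverse :: real \<Rightarrow> real)"
    proof (rule lipschitz_fun_onI)
      fix x y assume "x \<in> {\<eta>..}" "y \<in> {\<eta>..}"
      then have xy: "\<eta> \<le> x" "\<eta> \<le> y" by auto
      then have "inverse x - inverse y = (y - x) * (inverse x * inverse y)"
        using \<eta> by (simp add: field_simps)
      moreover have "inverse x * inverse y \<le> inverse \<eta> * inverse \<eta>"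
        using xy \<eta> by (intro mult_mono le_imp_inverse_le) auto
      ultimately show "dist (inverse x) (inverse y) \<le> (inverse \<eta> * inverse \<eta>) * dist x y"
        using xy \<eta> by (simp add: dist_real_def abs_mult abs_minus_commute mult.commute mult_left_mono del: inverse_mult_distrib)
    qed
    then have "lipschitz_fun_on (cball 0 S) (\<lambda>x. inverse (max \<eta> (norm (G x))))"
      by (intro lipschitz_fun_on_compose[of "cball 0 S" "\<lambda>x. max \<eta> (norm (G x))" "{\<eta>..}" inverse]
          lipschitz_fun_on_max_const lipschitz_fun_on_norm lipG') auto
    then show ?thesis
      unfolding f_def[abs_def]
      by (intro lipschitz_fun_on_scaleR lipschitz_fun_on_max_const lipschitz_fun_on_norm lipG' compact_cball)
  qed
  obtain L where L: "L-lipschitz_on UNIV f"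
    using lipschitz_extension_by_id[OF lipf f_far] S by (auto simp: lipschitz_fun_on_def)
  define M where "M = N \<union> (\<Union>z\<in>Z. sphere z \<eta>) \<union> sphere 0 S"
  have M: "negligible M"
    unfolding M_def using Z N by (auto intro!: negligible_Un negligible_Union negligible_sphere)
  have normG: "norm (G x) \<noteq> \<eta>" "norm (G x) \<noteq> S" if "x \<notin> M" for x
  proof -
    show "norm (G x) \<noteq> \<eta>"
    proof
      assume "norm (G x) = \<eta>"
      then obtain z where z: "z \<in> Z" "dist z x \<le> \<eta>" using Gsmall[of x] by auto
      then have "G x = x - z" using Gnear[of z x] \<eta> by auto
      then have "x \<in> sphere z \<eta>" using \<open>norm (G x) = \<eta>\<close> by (simp add: dist_norm norm_minus_commute)
      then show False using that z by (auto simp: M_def)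
    qed
    show "norm (G x) \<noteq> S"
      using that GS[of x] Gfar[of x] by (cases "norm x \<le> R + 1") (auto simp: M_def)
  qed
  have contG: "continuous_on UNIV G"
    by (rule lipschitz_fun_on_continuous[OF lipGU])
  have cases: "(\<exists>z\<in>Z. dist z x < \<eta>) \<or> (\<eta> < norm (G x) \<and> norm (G x) < S) \<or> norm x > S" if xM: "x \<notin> M" for x
  proof -
    consider "norm (G x) < \<eta>" | "\<eta> < norm (G x)" "norm (G x) < S" | "norm (G x) > S"
      using normG[OF xM] by linarith
    then show ?thesis
    proof cases
      case 1
      then obtain z where z: "z \<in> Z" "dist z x \<le> \<eta>" using Gsmall[of x] by auto
      then have "G x = x - z" using Gnear[of z x] \<eta> by auto
      then show ?thesis using 1 z by (auto simp: dist_norm norm_minus_commute)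
    next
      case 3
      then show ?thesis using GS[of x] Gfar[of x] by (cases "norm x \<le> R + 1") auto
    qed auto
  qed
  have ev_near: "\<forall>\<^sub>F y in nhds x. f y = (S / \<eta>) *\<^sub>R (y - z)" if "z \<in> Z" "dist z x < \<eta>" for z x
  proof -
    have "\<forall>\<^sub>F y in nhds x. y \<in> ball z \<eta>" using that by (intro eventually_nhds_in_open) auto
    then show ?thesis by (rule eventually_mono) (use f_near that in auto)
  qed
  have ev_mid: "\<forall>\<^sub>F y in nhds x. \<eta> < norm (G y) \<and> norm (G y) < S" if "\<eta> < norm (G x)" "norm (G x) < S" for x
  proof -
    have "open {y. \<eta> < norm (G y) \<and> norm (G y) < S}"
      by (intro open_Collect_conj open_Collect_less continuous_intros contG)
    then show ?thesis using that eventually_nhds_in_open by fastforce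
  qed
  have der_near: "(f has_derivative (\<lambda>h. (S / \<eta>) *\<^sub>R h)) (at x)" if "z \<in> Z" "dist z x < \<eta>" for z x
  proof (rule has_derivative_transform_eventually)
    show "((\<lambda>y. (S / \<eta>) *\<^sub>R (y - z)) has_derivative (\<lambda>h. (S / \<eta>) *\<^sub>R h)) (at x)"
      by (auto intro!: derivative_eq_intros)
    show "\<forall>\<^sub>F y in at x. (S / \<eta>) *\<^sub>R (y - z) = f y"
      using ev_near[OF that] by (auto simp: eventually_nhds_conv_at elim: eventually_mono)
    show "(S / \<eta>) *\<^sub>R (x - z) = f x" using f_near[OF that] by simp
  qed simp
  have diff: "f differentiable (at x)" if xM: "x \<notin> M" for x
  proof -
    consider z where "z \<in> Z" "dist z x < \<eta>" | "\<eta> < norm (G x)" "norm (G x) < S" | "norm x > S"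
      using cases[OF xM] by blast
    then show ?thesis
    proof cases
      case 1
      then show ?thesis using der_near differentiable_def by blast
    next
      case 2
      have G': "G differentiable (at x)" using diffG xM by (auto simp: M_def)
      have "G x \<noteq> 0" using 2 \<eta> by auto
      then have "(\<lambda>y. norm (G y)) differentiable (at x)"
        by (intro differentiable_compose[OF differentiable_norm_at G'])
      then have "(\<lambda>y. S *\<^sub>R (inverse (norm (G y)) *\<^sub>R G y)) differentiable (at x)"
        using G' \<open>G x \<noteq> 0\<close> by (intro derivative_intros differentiable_scaleR) auto
      then obtain D where D: "((\<lambda>y. S *\<^sub>R (inverse (norm (G y)) *\<^sub>R G y)) has_derivative D) (at x)"
        by (auto simp: differentiable_def)
      have "\<forall>\<^sub>F y in nhds x. S *\<^sub>R (inverse (norm (G y)) *\<^sub>R G y) = f y"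
        using ev_mid[OF 2] by (rule eventually_mono) (auto simp: f_def max_def)
      then have "(f has_derivative D) (at x)"
        by (intro has_derivative_transform_eventually[OF D]) (auto simp: eventually_nhds_conv_at)
      then show ?thesis by (auto simp: differentiable_def)
    next
      case 3
      have "\<forall>\<^sub>F y in nhds x. y \<in> - cball 0 S" using 3 by (intro eventually_nhds_in_open) auto
      then have "\<forall>\<^sub>F y in nhds x. y = f y" by (rule eventually_mono) (use f_far in auto)
      then have "(f has_derivative (\<lambda>h. h)) (at x)"
        by (intro has_derivative_transform_eventually[OF has_derivative_ident]) (auto simp: eventually_nhds_conv_at)
      then show ?thesis by (auto simp: differentiable_def)
    qed
  qed
  define J where "J x = det (matrix (frechet_derivative f (at x)))" for x
  have "(J has_integral measure lebesgue (ball 0 S :: (real^'n::_) set)) (ball 0 S)"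
    unfolding J_def[abs_def]
    by (rule has_integral_det_derivative_eq_ball[OF L _ M diff]) (use f_far in auto)
  moreover have "(J has_integral (\<Sum>z\<in>Z. (S / \<eta>) ^ CARD('n) * measure lebesgue (ball z \<eta>))) (ball 0 S)"
  proof (rule has_integral_spike[OF M])
    define c where "c = (S / \<eta>) ^ CARD('n)"
    show "((\<lambda>x. \<Sum>z\<in>Z. if x \<in> ball z \<eta> then c else 0) has_integral
            (\<Sum>z\<in>Z. (S / \<eta>) ^ CARD('n) * measure lebesgue (ball z \<eta>))) (ball 0 S)"
    proof (intro has_integral_sum Z)
      fix z assume z: "z \<in> Z"
      have "((\<lambda>x. 1) has_integral measure lebesgue (ball z \<eta>)) (ball z \<eta>)"
        using has_integral_measure_lborel has_integral_iff lmeasure_integral lmeasurable_ball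
          lmeasurable_iff_integrable_on by metis
      then have "((\<lambda>x. c * 1) has_integral (S / \<eta>) ^ CARD('n) * measure lebesgue (ball z \<eta>)) (ball z \<eta>)"
        unfolding c_def by (rule has_integral_mult_right)
      then show "((\<lambda>x. if x \<in> ball z \<eta> then c else 0) has_integral
          (S / \<eta>) ^ CARD('n) * measure lebesgue (ball z \<eta>)) (ball 0 S)"
        using inR[OF z] S by (subst has_integral_restrict) auto
    qed
    fix x assume x: "x \<in> ball 0 S - M"
    show "J x = (\<Sum>z\<in>Z. if x \<in> ball z \<eta> then c else 0)"
    proof (cases "\<exists>z\<in>Z. dist z x < \<eta>")
      case True
      then obtain z where z: "z \<in> Z" "dist z x < \<eta>" by blast
      have "frechet_derivative f (at x) = (\<lambda>h. (S / \<eta>) *\<^sub>R h)"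
        using frechet_derivative_at[OF der_near[OF z]] by simp
      then have "J x = c" by (simp add: J_def c_def det_matrix_scaleR[unfolded fun_eq_iff])
      have "x \<notin> ball z' \<eta>" if "z' \<in> Z - {z}" for z'
        using sep z that dist_triangle[of z z' x] by (force simp: pairwise_def dist_commute)
      then have "(\<Sum>z\<in>Z. if x \<in> ball z \<eta> then c else 0) = (\<Sum>z\<in>{z}. if x \<in> ball z \<eta> then c else 0)"
        using Z z by (intro sum.mono_neutral_right) auto
      then show ?thesis using z \<open>J x = c\<close> by simp
    next
      case False
      then have mid: "\<eta> < norm (G x)" "norm (G x) < S" using cases[of x] x by auto
      have "J x = 0"
        unfolding J_def
      proof (rule det_derivative_norm_const)
        show "(f has_derivative frechet_derivative f (at x)) (at x)"
          using diff[of x] x frechet_derivative_works by blast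
        show "\<forall>\<^sub>F y in nhds x. norm (f y) = S"
          using ev_mid[OF mid] by (rule eventually_mono) (use f_mid in auto)
      qed (use S in auto)
      then show ?thesis using False by (auto intro: sum.neutral)
    qed
  qed
  ultimately have "measure lebesgue (ball 0 S :: (real^'n::_) set) =
      (\<Sum>z\<in>Z. (S / \<eta>) ^ CARD('n) * measure lebesgue (ball z \<eta>))"
    by (rule has_integral_unique)
  also have "\<dots> = (\<Sum>z\<in>Z. measure lebesgue (ball 0 S :: (real^'n::_) set))"
    using \<eta> S by (intro sum.cong) (auto simp: content_ball power_divide)
  finally have "real (card Z) * measure lebesgue (ball 0 S :: (real^'n::_) set) = measure lebesgue (ball 0 S :: (real^'n::_) set)"
    by simp
  moreover have "measure lebesgue (ball 0 S :: (real^'n::_) set) > 0"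
    using S by simp
  ultimately show ?thesis by simp
qed

text \<open>The Jacobian integral needs coordinates; a linear isometry carries the count over to
  phase space, a product of two Euclidean spaces.\<close>

lemma card_translation_zeros_euclidean:
  fixes F :: "'a::euclidean_space \<Rightarrow> 'a"
  assumes dim: "DIM('a) = DIM(real^'n::{finite,wellorder})"
    and contF: "continuous_on UNIV F"
    and R: "R > 0" "\<And>x. norm x \<ge> R \<Longrightarrow> F x = x"
    and Z: "finite Z" and r: "r > 0" "\<And>z x. z \<in> Z \<Longrightarrow> dist z x < r \<Longrightarrow> F x = x - z"
    and nz: "\<And>x. F x = 0 \<Longrightarrow> x \<in> Z"
  shows "card Z = 1"
proof -
  obtain \<phi> :: "'a \<Rightarrow> real^'n::{finite,wellorder}" and \<psi> where lin: "linear \<phi>" "linear \<psi>"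
    and n: "\<And>x. norm (\<phi> x) = norm x" "\<And>y. norm (\<psi> y) = norm y"
    and inv: "\<And>x. \<psi> (\<phi> x) = x" "\<And>y. \<phi> (\<psi> y) = y"
    using isometries_subspaces[OF subspace_UNIV subspace_UNIV, where ?'a='a and ?'b="real^'n::{finite,wellorder}"] dim
    by (metis UNIV_I dim_UNIV)
  have inj: "inj \<phi>" using inv by (metis injI)
  have cont: "continuous_on A \<phi>" "continuous_on B \<psi>" for A B
    using lin by (simp_all add: linear_continuous_on linear_conv_bounded_linear)
  have "card (\<phi> ` Z) = 1"
  proof (rule card_translation_zeros[of "\<lambda>y. \<phi> (F (\<psi> y))" R])
    show "continuous_on UNIV (\<lambda>y. \<phi> (F (\<psi> y)))"
      by (intro continuous_on_compose2[OF cont(1)[of UNIV]] continuous_on_compose2[OF contF] cont) auto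
    show "\<phi> (F (\<psi> x)) = x" if "R \<le> norm x" for x
      using R(2)[of "\<psi> x"] that n inv by simp
    show "finite (\<phi> ` Z)" using Z by simp
    show "\<phi> (F (\<psi> x)) = x - z" if "z \<in> \<phi> ` Z" "dist z x < r" for x z
    proof -
      obtain w where w: "w \<in> Z" "z = \<phi> w" using \<open>z \<in> \<phi> ` Z\<close> by blast
      have "dist w (\<psi> x) = dist z x"
        using n(1)[of "w - \<psi> x"] lin(1) by (simp add: w dist_norm linear_diff inv)
      then have "F (\<psi> x) = \<psi> x - w" using r(2)[OF w(1)] that by simp
      then show ?thesis using lin(1) by (simp add: w linear_diff inv)
    qed
    show "x \<in> \<phi> ` Z" if "\<phi> (F (\<psi> x)) = 0" for x
    proof -
      have "F (\<psi> x) = 0" using that n(1)[of "F (\<psi> x)"] by simp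
      then show ?thesis using nz[of "\<psi> x"] inv(2)[of x] by (metis imageI)
    qed
  qed (use R r in auto)
  then show ?thesis using inj by (simp add: card_image inj_on_subset)
qed

text \<open>On the frontiers \<open>f\<close> is homotopic to the models \<open>x\<close> and
  \<open>x - z i\<close>. Since \<open>f\<close> is free of zeros on the rest of
  \<open>closure \<Omega>\<close>, Borsuk's homotopy extension theorem extends the models over that
  rest without zeros. Filled up with the translations inside the regions and the identity outside,
  the extension is subject to the previous count, with the points \<open>z i\<close> as its only
  zeros.\<close>

theorem card_regions_of_degree_one:
  fixes f :: "'a::euclidean_space \<Rightarrow> 'a"
  assumes dim: "DIM('a) = DIM(real^'n::{finite,wellorder})"
    and \<Omega>: "open \<Omega>" "bounded \<Omega>" "0 \<in> \<Omega>"
    and I: "finite I"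
    and U: "\<And>i. i \<in> I \<Longrightarrow> open (U i)" "\<And>i. i \<in> I \<Longrightarrow> closure (U i) \<subseteq> \<Omega>" "\<And>i. i \<in> I \<Longrightarrow> z i \<in> U i"
    and disj: "\<And>i j. i \<in> I \<Longrightarrow> j \<in> I \<Longrightarrow> i \<noteq> j \<Longrightarrow> closure (U i) \<inter> closure (U j) = {}"
    and contf: "continuous_on (closure \<Omega> - (\<Union>i\<in>I. U i)) f"
    and nz: "\<And>x. x \<in> closure \<Omega> - (\<Union>i\<in>I. U i) \<Longrightarrow> f x \<noteq> 0"
    and hom\<Omega>: "homotopic_with_canon (\<lambda>_. True) (frontier \<Omega>) (- {0}) f (\<lambda>x. x)"
    and homU: "\<And>i. i \<in> I \<Longrightarrow> homotopic_with_canon (\<lambda>_. True) (frontier (U i)) (- {0}) f (\<lambda>x. x - z i)"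
  shows "card I = 1"
proof -
  define T where "T = closure \<Omega> - (\<Union>i\<in>I. U i)"
  define S where "S = frontier \<Omega> \<union> (\<Union>i\<in>I. frontier (U i))"
  define g where "g x = (if \<exists>i\<in>I. x \<in> closure (U i) then x - z (SOME i. i \<in> I \<and> x \<in> closure (U i)) else x)" for x
  have gU: "g x = x - z i" if "i \<in> I" "x \<in> closure (U i)" for i x
  proof -
    have "(SOME i. i \<in> I \<and> x \<in> closure (U i)) = i"
      using that disj by (intro some_equality) auto
    then show ?thesis using that by (auto simp: g_def)
  qed
  have fr\<Omega>: "frontier \<Omega> \<inter> \<Omega> = {}" using \<Omega> by (simp add: frontier_disjoint_eq)
  have frU: "frontier (U i) \<inter> U i = {}" "frontier (U i) \<subseteq> closure (U i)" if "i \<in> I" for i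
    using U(1)[OF that] by (auto simp: frontier_def interior_open)
  have g\<Omega>: "g x = x" if "x \<notin> \<Omega>" for x
    using that U(2) by (auto simp: g_def)
  have closedT: "closed T"
    unfolding T_def using U by (intro closed_Diff) auto
  have ST: "S \<subseteq> T"
  proof
    fix x assume "x \<in> S"
    then consider "x \<in> frontier \<Omega>" | i where "i \<in> I" "x \<in> frontier (U i)" by (auto simp: S_def)
    then show "x \<in> T"
    proof cases
      case 1
      then show ?thesis using fr\<Omega> U(2) closure_subset by (fastforce simp: T_def frontier_def)
    next
      case 2
      have "x \<notin> U j" if "j \<in> I" for j
        using 2 that frU[OF 2(1)] disj[OF 2(1) that] closure_subset[of "U j"] by (cases "j = i") auto
      then show ?thesis using 2 frU[OF 2(1)] U(2)[OF 2(1)] closure_subset[of \<Omega>] by (auto simp: T_def)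
    qed
  qed
  have closedS: "closed S"
    unfolding S_def using I by (intro closed_Un closed_UN) auto
  \<comment> \<open>The frontiers are finitely many pairwise disjoint closed sets, so each is clopen
    in their union and the separate homotopies combine.\<close>
  define \<F> where "\<F> = insert (frontier \<Omega>) ((\<lambda>i. frontier (U i)) ` I)"
  have SF: "S = \<Union>\<F>" by (auto simp: S_def \<F>_def)
  have closedF: "closed X" if "X \<in> \<F>" for X using that by (auto simp: \<F>_def)
  have disjF: "X \<inter> Y = {}" if XY: "X \<in> \<F>" "Y \<in> \<F>" "X \<noteq> Y" for X Y
  proof -
    have *: "frontier \<Omega> \<inter> frontier (U i) = {}" if "i \<in> I" for i
      using fr\<Omega> frU(2)[OF that] U(2)[OF that] by auto
    have **: "frontier (U i) \<inter> frontier (U j) = {}" if "i \<in> I" "j \<in> I" "frontier (U i) \<noteq> frontier (U j)" for i j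
      using that disj[of i j] frU(2) by (cases "i = j") blast+
    show ?thesis using XY * ** unfolding \<F>_def by (smt (verit) imageE insertE Int_commute)
  qed
  have "homotopic_with_canon (\<lambda>_. True) (\<Union>\<F>) (- {0}) f g"
  proof (rule homotopic_on_clopen_Union)
    fix X assume X: "X \<in> \<F>"
    show "closedin (top_of_set (\<Union>\<F>)) X"
      using X closedF by (intro closed_subset) auto
    have "\<Union>\<F> - X = \<Union>(\<F> - {X})" using disjF X by blast
    moreover have "closed (\<Union>(\<F> - {X}))"
      using I closedF by (intro closed_Union) (auto simp: \<F>_def)
    ultimately have "closedin (top_of_set (\<Union>\<F>)) (\<Union>\<F> - X)"
      by (intro closed_subset) auto
    then show "openin (top_of_set (\<Union>\<F>)) X"
      using X by (subst openin_closedin) auto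
    show "homotopic_with_canon (\<lambda>_. True) X (- {0}) f g"
    proof (cases "X = frontier \<Omega>")
      case True
      show ?thesis unfolding True
        by (rule homotopic_with_eq[OF hom\<Omega>]) (use g\<Omega> fr\<Omega> in auto)
    next
      case False
      then obtain i where i: "i \<in> I" "X = frontier (U i)" using X by (auto simp: \<F>_def)
      show ?thesis unfolding i(2)
        by (rule homotopic_with_eq[OF homU[OF i(1)]]) (use gU[OF i(1)] frU(2)[OF i(1)] in auto)
    qed
  qed
  then have hom: "homotopic_with_canon (\<lambda>_. True) S (- {0}) f g" by (simp add: SF)
  have clo: "closedin (top_of_set T) S" using ST closedS by (rule closed_subset)
  obtain g' where g': "continuous_on T g'" "g' ` T \<subseteq> - {0}" "\<And>x. x \<in> S \<Longrightarrow> g' x = g x"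
    by (rule Borsuk_homotopy_extension_homotopic[OF clo _ _ _ hom])
      (use contf nz open_imp_ANR[of "- {0::'a}"] in \<open>auto simp: T_def\<close>)
  define F where "F x = (if x \<in> (\<Union>i\<in>I. U i) then g x else if x \<in> closure \<Omega> then g' x else x)" for x
  have FU: "F x = g x" if "i \<in> I" "x \<in> closure (U i)" for i x
  proof (cases "x \<in> (\<Union>i\<in>I. U i)")
    case False
    then have "x \<in> S" using that by (auto simp: S_def frontier_def interior_open U(1))
    then show ?thesis using False g' ST by (auto simp: F_def T_def)
  qed (simp add: F_def)
  have FT: "F x = g' x" if "x \<in> T" for x using that by (auto simp: F_def T_def)
  have F\<Omega>: "F x = x" if "x \<notin> \<Omega>" for x
  proof (cases "x \<in> closure \<Omega>")
    case True
    then have "x \<in> S" using that \<Omega>(1) by (auto simp: S_def frontier_def interior_open)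
    then show ?thesis using FT g' ST g\<Omega>[OF that] by auto
  next
    case False
    have "x \<notin> (\<Union>i\<in>I. U i)" using that U(2) closure_subset by fastforce
    then show ?thesis using False by (simp add: F_def)
  qed
  have "continuous_on (\<Union>i\<in>I. closure (U i)) F"
  proof (rule continuous_on_closed_Union[OF I])
    fix i assume i: "i \<in> I"
    have "continuous_on (closure (U i)) (\<lambda>x. x - z i)" by (intro continuous_intros)
    then show "continuous_on (closure (U i)) F"
      by (rule continuous_on_eq) (use FU[OF i] gU[OF i] in auto)
  qed auto
  moreover have "continuous_on T F"
    by (rule continuous_on_eq[OF g'(1)]) (use FT in auto)
  moreover have "continuous_on (- \<Omega>) F"
    by (rule continuous_on_eq[OF continuous_on_id]) (use F\<Omega> in auto)
  ultimately have "continuous_on ((\<Union>i\<in>I. closure (U i)) \<union> T \<union> - \<Omega>) F"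
    using I closedT \<Omega> by (intro continuous_on_closed_Un closed_Un) auto
  moreover have "(\<Union>i\<in>I. closure (U i)) \<union> T \<union> - \<Omega> = UNIV"
    using closure_subset unfolding T_def by fastforce
  ultimately have contF: "continuous_on UNIV F" by simp
  obtain R where R: "R > 0" "\<Omega> \<subseteq> ball 0 R"
    using \<Omega>(2) bounded_subset_ballD by blast
  have injz: "inj_on z I"
  proof (rule inj_onI, rule ccontr)
    fix i j assume "i \<in> I" "j \<in> I" "z i = z j" "i \<noteq> j"
    then show False using U(3) disj[of i j] closure_subset by (metis disjoint_iff subsetD)
  qed
  have "\<exists>r>0. \<forall>i\<in>I. ball (z i) r \<subseteq> U i"
    using I U(1,3)
  proof (induction I rule: finite_induct)
    case (insert i J)
    then obtain r where r: "r > 0" "\<forall>i\<in>J. ball (z i) r \<subseteq> U i" by auto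
    moreover obtain e where e: "e > 0" "ball (z i) e \<subseteq> U i"
      using insert.prems openE by (metis insertI1)
    ultimately show ?case
      by (intro exI[of _ "min r e"]) (auto simp: subset_iff)
  qed (auto intro: exI[of _ 1])
  then obtain r where r: "r > 0" "\<And>i. i \<in> I \<Longrightarrow> ball (z i) r \<subseteq> U i" by blast
  have "card (z ` I) = 1"
  proof (rule card_translation_zeros_euclidean[OF dim contF R(1) _ _ r(1)])
    show "F x = x" if "R \<le> norm x" for x
    proof (rule F\<Omega>)
      show "x \<notin> \<Omega>" using R(2) that by (auto simp: subset_iff)
    qed
    show "finite (z ` I)" using I by simp
    show "F x = x - w" if w: "w \<in> z ` I" "dist w x < r" for w x
    proof -
      obtain i where i: "i \<in> I" "w = z i" using w by blast
      then have "x \<in> closure (U i)" using r(2)[OF i(1)] w closure_subset by fastforce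
      then show ?thesis using FU[OF i(1)] gU[OF i(1)] i by simp
    qed
    show "x \<in> z ` I" if Fx: "F x = 0" for x
    proof -
      have "x \<notin> T" using FT[of x] Fx g'(2) by auto
      have "x \<in> \<Omega>" using F\<Omega>[of x] Fx \<Omega>(3) by auto
      then obtain i where i: "i \<in> I" "x \<in> U i"
        using \<open>x \<notin> T\<close> closure_subset[of \<Omega>] by (auto simp: T_def)
      then have "x - z i = 0" using FU[OF i(1)] gU[OF i(1)] closure_subset Fx by (metis subsetD)
      then show ?thesis using i by auto
    qed
  qed
  then show ?thesis using injz by (simp add: card_image)
qed

section \<open>Lipschitz ordinary differential equations\<close>

lemma vector_derivative_nonpos_imp_le:
  fixes f :: "real \<Rightarrow> real"
  assumes "a \<le> b" and "\<And>t. t \<in> {a..b} \<Longrightarrow> (f has_vector_derivative f' t) (at t within {a..b})"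
    and "\<And>t. t \<in> {a..b} \<Longrightarrow> f' t \<le> 0"
  shows "f b \<le> f a"
proof -
  obtain x where x: "x \<in> {a..b}" "f b - f a = (b - a) *\<^sub>R f' x"
    using mvt_very_simple[of a b f "\<lambda>t h. h *\<^sub>R f' t"] assms(1,2)
    unfolding has_vector_derivative_def by auto
  then have "(b - a) * f' x \<le> 0"
    using assms(1,3) by (intro mult_nonneg_nonpos) auto
  then show ?thesis using x by simp
qed

lemma norm_diff_le_of_vector_derivative_bound:
  fixes f :: "real \<Rightarrow> 'a::real_normed_vector"
  assumes "\<And>t. t \<in> {a..b} \<Longrightarrow> (f has_vector_derivative f' t) (at t within {a..b})"
    and "\<And>t. t \<in> {a..b} \<Longrightarrow> norm (f' t) \<le> B" and st: "s \<in> {a..b}" "t \<in> {a..b}"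
  shows "norm (f t - f s) \<le> B * \<bar>t - s\<bar>"
proof -
  have "norm (f t - f s) \<le> B * norm (t - s)"
  proof (rule differentiable_bound[of "{a..b}" f "\<lambda>t h. h *\<^sub>R f' t"])
    show "(f has_derivative (\<lambda>h. h *\<^sub>R f' x)) (at x within {a..b})" if "x \<in> {a..b}" for x
      using assms(1)[OF that] by (simp add: has_vector_derivative_def)
    show "onorm (\<lambda>h. h *\<^sub>R f' x) \<le> B" if "x \<in> {a..b}" for x
      using mult_right_mono[OF assms(2)[OF that] abs_ge_zero] by (intro onorm_le) (simp add: mult.commute)
  qed (use st in auto)
  then show ?thesis by simp
qed

lemma lipschitz_ode_solution_exists:
  fixes \<Phi> :: "real \<Rightarrow> 'a::euclidean_space \<Rightarrow> 'a"
  assumes cont: "continuous_on ({0..1} \<times> UNIV) (\<lambda>(t, x). \<Phi> t x)"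
    and lip: "\<And>t x y. t \<in> {0..1} \<Longrightarrow> norm (\<Phi> t x - \<Phi> t y) \<le> L * norm (x - y)"
  obtains X where "X 0 = a" "\<And>t. t \<in> {0..1} \<Longrightarrow> (X has_vector_derivative \<Phi> t (X t)) (at t within {0..1})"
proof -
  have L: "L \<ge> 0"
  proof -
    obtain b :: 'a where "b \<in> Basis" using nonempty_Basis by blast
    then have "0 \<le> L * 1"
      using order_trans[OF norm_ge_zero lip[of 0 b 0]] by simp
    then show ?thesis by simp
  qed
  define K where "K = L + 1"
  have K: "K > 0" using L by (simp add: K_def)
  text \<open>The weight \<open>exp (- K t)\<close> makes the Picard operator a contraction on the whole interval.\<close>
  define J where "J w s = \<Phi> s (exp (K * s) *\<^sub>R apply_bcontfun w s)" for w :: "real \<Rightarrow>\<^sub>C 'a" and s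
  define F where "F w t = exp (- (K * t)) *\<^sub>R (a + integral {0..t} (J w))" for w t
  have contJ: "continuous_on {0..1} (J w)" for w
  proof -
    have "continuous_on {0..1} (\<lambda>s. (\<lambda>(t, x). \<Phi> t x) (s, exp (K * s) *\<^sub>R apply_bcontfun w s))"
      by (rule continuous_on_compose2[OF cont]) (auto intro!: continuous_intros)
    then show ?thesis by (simp add: J_def[abs_def])
  qed
  have intJ: "J w integrable_on {0..t}" if "t \<in> {0..1}" for w t
    using that by (intro integrable_continuous_real continuous_on_subset[OF contJ]) auto
  \<comment> \<open>Clamping time to [0,1] turns functions on the interval into elements of the
    complete space of bounded continuous functions on the line, where the Banach fixed point theorem
    applies.\<close>
  have "\<exists>g :: real \<Rightarrow>\<^sub>C 'a. \<forall>t. g t = F w (clamp 0 1 t)" for w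
  proof -
    have "continuous_on (cbox 0 1) (F w)"
      unfolding F_def[abs_def] box_real
      by (intro continuous_intros indefinite_integral_continuous_1 intJ) auto
    then show ?thesis
      by (rule continuous_on_cbox_bcontfunE) metis
  qed
  then obtain T :: "(real \<Rightarrow>\<^sub>C 'a) \<Rightarrow> (real \<Rightarrow>\<^sub>C 'a)" where T: "\<And>w t. T w t = F w (clamp 0 1 t)"
    by metis
  have clamp01: "clamp 0 1 t \<in> {0..1}" for t :: real
    using clamp_in_interval[of 0 1 t] by simp
  have contr: "dist (T v) (T w) \<le> (L / K) * dist v w" for v w
  proof (rule dist_bound)
    fix t0
    define t :: real where "t = clamp 0 1 t0"
    have t: "t \<in> {0..1}" using clamp01 by (simp add: t_def)
    have hi: "((\<lambda>s. L * dist v w * exp (K * s)) has_integral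
        L * dist v w * (exp (K * t) / K) - L * dist v w * (exp (K * 0) / K)) {0..t}"
      using t K by (intro fundamental_theorem_of_calculus)
        (auto intro!: derivative_eq_intros simp: has_real_derivative_iff_has_vector_derivative[symmetric])
    have "norm (integral {0..t} (\<lambda>s. J v s - J w s)) \<le> integral {0..t} (\<lambda>s. L * dist v w * exp (K * s))"
    proof (rule Henstock_Kurzweil_Integration.integral_norm_bound_integral)
      show "(\<lambda>s. J v s - J w s) integrable_on {0..t}" by (intro integrable_diff intJ t)
      show "(\<lambda>s. L * dist v w * exp (K * s)) integrable_on {0..t}"
        by (intro integrable_continuous_real continuous_intros)
      fix s assume "s \<in> {0..t}"
      then have "norm (J v s - J w s) \<le> L * norm (exp (K * s) *\<^sub>R (v s - w s))"
        using t unfolding J_def by (intro order_trans[OF lip]) (auto simp: scaleR_diff_right)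
      also have "\<dots> \<le> L * (exp (K * s) * dist v w)"
        using L dist_bounded[of v s w] by (intro mult_left_mono) (auto simp: dist_norm)
      finally show "norm (J v s - J w s) \<le> L * dist v w * exp (K * s)" by (simp add: mult_ac)
    qed
    also have "\<dots> = L * dist v w * (exp (K * t) / K) - L * dist v w * (1 / K)"
      using integral_unique[OF hi] by (simp only: mult_zero_right exp_zero)
    also have "\<dots> \<le> L * dist v w * (exp (K * t) / K)"
      using L K by simp
    finally have *: "norm (integral {0..t} (\<lambda>s. J v s - J w s)) \<le> L * dist v w * (exp (K * t) / K)" .
    have "F v t - F w t = exp (- (K * t)) *\<^sub>R integral {0..t} (\<lambda>s. J v s - J w s)"
      using intJ[OF t] by (simp add: F_def integral_diff algebra_simps)
    then have "norm (F v t - F w t) \<le> exp (- (K * t)) * (L * dist v w * (exp (K * t) / K))"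
      using mult_left_mono[OF *, of "exp (- (K * t))"] by simp
    also have "\<dots> = (exp (- (K * t)) * exp (K * t)) * ((L / K) * dist v w)" by (simp add: field_simps)
    also have "\<dots> = (L / K) * dist v w" by (simp add: exp_minus_inverse mult.commute)
    finally show "dist (T v t0) (T w t0) \<le> (L / K) * dist v w"
      by (simp add: T t_def dist_norm)
  qed
  have "0 \<le> L / K" "L / K < 1" using L K by (auto simp: K_def)
  then obtain w where w: "T w = w"
    using banach_fix_type[of "L / K" T] contr by auto
  define X where "X t = exp (K * t) *\<^sub>R w t" for t
  have Xint: "X t = a + integral {0..t} (J w)" if "t \<in> {0..1}" for t
  proof -
    have "w t = F w t" using T[of w t] w that by (simp add: clamp_cancel_cbox)
    then show ?thesis by (simp add: X_def F_def exp_minus_inverse)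
  qed
  show ?thesis
  proof
    show "X 0 = a" using Xint[of 0] by simp
    fix t :: real assume t: "t \<in> {0..1}"
    have "((\<lambda>u. a + integral {0..u} (J w)) has_vector_derivative J w t) (at t within {0..1})"
      using has_vector_derivative_add[OF has_vector_derivative_const integral_has_vector_derivative[OF contJ t]] by simp
    then have "(X has_vector_derivative J w t) (at t within {0..1})"
      by (rule has_vector_derivative_transform[OF t, rotated]) (use Xint in auto)
    then show "(X has_vector_derivative \<Phi> t (X t)) (at t within {0..1})"
      by (simp add: J_def X_def)
  qed
qed

text \<open>Gronwall's inequality in differential form: \<open>exp (- (2 * L * s))\<close> times the
  squared distance is nonincreasing.\<close>

lemma lipschitz_ode_solutions_dist:
  fixes X Y :: "real \<Rightarrow> 'a::real_inner"
  assumes lip: "\<And>t x y. t \<in> {0..1} \<Longrightarrow> norm (\<Phi> t x - \<Phi> t y) \<le> L * norm (x - y)"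
    and X: "\<And>t. t \<in> {0..1} \<Longrightarrow> (X has_vector_derivative \<Phi> t (X t)) (at t within {0..1})"
    and Y: "\<And>t. t \<in> {0..1} \<Longrightarrow> (Y has_vector_derivative \<Phi> t (Y t)) (at t within {0..1})"
    and t: "t \<in> {0..1}"
  shows "norm (X t - Y t) \<le> exp (L * t) * norm (X 0 - Y 0)"
proof -
  define D where "D s = X s - Y s" for s
  define D' where "D' s = \<Phi> s (X s) - \<Phi> s (Y s)" for s
  define \<phi> where "\<phi> s = exp (- (2 * L * s)) * (D s \<bullet> D s)" for s
  define \<phi>' where "\<phi>' s = exp (- (2 * L * s)) * (2 * (D s \<bullet> D' s) - 2 * L * (D s \<bullet> D s))" for s
  have "\<phi> t \<le> \<phi> 0"
  proof (rule vector_derivative_nonpos_imp_le[of 0 t \<phi> \<phi>'])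
    fix s assume "s \<in> {0..t}"
    then have s: "s \<in> {0..1}" using t by auto
    have "(D has_vector_derivative D' s) (at s within {0..t})"
      unfolding D_def D'_def using t X[OF s] Y[OF s]
      by (intro has_vector_derivative_diff) (auto intro: has_vector_derivative_within_subset)
    then have D: "(D has_derivative (\<lambda>h. h *\<^sub>R D' s)) (at s within {0..t})"
      by (simp add: has_vector_derivative_def)
    show "(\<phi> has_vector_derivative \<phi>' s) (at s within {0..t})"
      unfolding \<phi>_def \<phi>'_def has_vector_derivative_def
      by (rule derivative_eq_intros D refl)+ (auto simp: fun_eq_iff algebra_simps inner_commute)
    have "D s \<bullet> D' s \<le> norm (D s) * norm (D' s)" by (rule norm_cauchy_schwarz)
    also have "\<dots> \<le> norm (D s) * (L * norm (D s))"
      using lip[OF s] by (intro mult_left_mono) (auto simp: D_def D'_def)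
    finally have "D s \<bullet> D' s \<le> L * (D s \<bullet> D s)"
      by (simp add: power2_norm_eq_inner[symmetric] power2_eq_square mult_ac)
    then show "\<phi>' s \<le> 0" by (simp add: \<phi>'_def mult_nonneg_nonpos)
  qed (use t in auto)
  then have "exp (- (2 * L * t)) * (norm (D t))\<^sup>2 \<le> (norm (D 0))\<^sup>2"
    by (simp add: \<phi>_def power2_norm_eq_inner)
  then have "(norm (D t))\<^sup>2 \<le> exp (2 * L * t) * (norm (D 0))\<^sup>2"
    by (simp add: exp_minus field_simps)
  also have "\<dots> = (exp (L * t) * norm (D 0))\<^sup>2"
    by (simp add: power_mult_distrib exp_double[symmetric] mult.assoc)
  finally show ?thesis
    unfolding D_def by (rule power2_le_imp_le) simp
qed

section \<open>The truncated force\<close>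

text \<open>Clamping only the denominator keeps the force radial, hence a gradient, and makes it
  globally Lipschitz, so that orbits exist on all of [0,1].\<close>

definition force :: "real \<Rightarrow> real \<Rightarrow> 'a::real_inner \<Rightarrow> 'a" where
  "force q d z = z /\<^sub>R (max (norm z) d powr (q + 1))"

lemma force_outside: "d \<le> norm z \<Longrightarrow> force q d z = z /\<^sub>R (norm z powr (q + 1))"
  by (simp add: force_def)

lemma force_inside: "norm z \<le> d \<Longrightarrow> force q d z = z /\<^sub>R (d powr (q + 1))"
  by (simp add: force_def max_absorb2)

lemma force_cong: "d \<le> norm z \<Longrightarrow> d' \<le> norm z \<Longrightarrow> force q d z = force q d' z"
  by (simp add: force_def)

lemma inner_force: "x \<bullet> force q d z = (x \<bullet> z) / (max (norm z) d powr (q + 1))"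
  by (simp add: force_def divide_inverse mult.commute)

lemma norm_force: "norm (force q d z) = norm z / (max (norm z) d powr (q + 1))"
  by (simp add: force_def divide_inverse mult.commute)

lemma norm_force_le:
  assumes "d > 0" "q \<ge> 0"
  shows "norm (force q d z) \<le> d powr (- q)"
proof -
  have "norm (force q d z) \<le> max (norm z) d / (max (norm z) d powr (q + 1))"
    unfolding norm_force by (intro divide_right_mono) auto
  also have "\<dots> = max (norm z) d powr (- q)"
    using assms by (simp add: powr_add powr_minus field_simps)
  also have "\<dots> \<le> d powr (- q)"
    using assms by (intro powr_mono2') auto
  finally show ?thesis .
qed

lemma power2_powr: "(x::real) > 0 \<Longrightarrow> (x\<^sup>2) powr c = x powr (2 * c)"
  using powr_powr[of x 2 c] by (simp add: powr_numeral)

lemma powr_minus_diff_le: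
  assumes "0 < x" "x \<le> y" "0 \<le> (a::real)"
  shows "x powr (- a) - y powr (- a) \<le> a * x powr (- a - 1) * (y - x)"
proof (cases "x = y")
  case False
  then have "x < y" using assms by simp
  moreover have "((\<lambda>s. s powr (- a)) has_real_derivative (- a * s powr (- a - 1))) (at s)" if "x \<le> s" for s
    using that assms by (auto intro!: derivative_eq_intros)
  ultimately obtain s where s: "x < s" "s < y" "y powr (- a) - x powr (- a) = (y - x) * (- a * s powr (- a - 1))"
    using MVT2[of x y "\<lambda>s. s powr (- a)" "\<lambda>s. - a * s powr (- a - 1)"] by blast
  have "s powr (- a - 1) \<le> x powr (- a - 1)"
    using s assms by (intro powr_mono2') auto
  then have "(y - x) * (a * s powr (- a - 1)) \<le> (y - x) * (a * x powr (- a - 1))"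
    using assms by (intro mult_left_mono) auto
  then show ?thesis using s(3) by (simp add: mult_ac)
qed simp

text \<open>With clamped norms \<open>b \<le> a\<close> and \<open>k = q + 1\<close>, the difference
  is \<open>a powr (- k)\<close> times \<open>z - w\<close> minus
  \<open>b powr (- k) - a powr (- k)\<close> times \<open>w\<close>. The first part contributes 1
  and the second, by the mean value theorem, \<open>q + 1\<close> to the factor
  \<open>q + 2\<close>.\<close>

lemma force_lipschitz:
  fixes z w :: "'a::real_inner"
  assumes d: "d > 0" and q: "q \<ge> 0"
  shows "norm (force q d z - force q d w) \<le> (q + 2) * d powr (- (q + 1)) * norm (z - w)"
proof -
  have *: "norm (force q d z - force q d w) \<le> (q + 2) * d powr (- (q + 1)) * norm (z - w)"
    if zw: "norm w \<le> norm z" for z w :: 'a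
  proof -
    define a b where "a = max (norm z) d" and "b = max (norm w) d"
    have ab: "0 < b" "b \<le> a" "d \<le> b" "norm w \<le> b" "a - b \<le> norm (z - w)"
      using d zw norm_triangle_ineq2[of z w] by (auto simp: a_def b_def max_def)
    define k where "k = q + 1"
    have k: "k \<ge> 0" using q by (simp add: k_def)
    have "force q d z - force q d w = a powr (- k) *\<^sub>R (z - w) - (b powr (- k) - a powr (- k)) *\<^sub>R w"
      unfolding force_def a_def[symmetric] b_def[symmetric] k_def[symmetric] powr_minus
      by (simp add: algebra_simps)
    then have "norm (force q d z - force q d w) \<le> norm (a powr (- k) *\<^sub>R (z - w)) + norm ((b powr (- k) - a powr (- k)) *\<^sub>R w)"
      by (metis norm_triangle_ineq4)
    also have "\<dots> = a powr (- k) * norm (z - w) + (b powr (- k) - a powr (- k)) * norm w"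
      using ab k powr_mono2'[of "- k" b a] by simp
    also have "\<dots> \<le> d powr (- k) * norm (z - w) + (k * d powr (- k)) * norm (z - w)"
    proof (intro add_mono)
      show "a powr (- k) * norm (z - w) \<le> d powr (- k) * norm (z - w)"
        using ab d k by (intro mult_right_mono powr_mono2') auto
      have "(b powr (- k) - a powr (- k)) * norm w \<le> (k * b powr (- k - 1) * (a - b)) * b"
        using ab k powr_mono2'[of "- k" b a] powr_minus_diff_le[of b a k] by (intro mult_mono) auto
      also have "\<dots> = (k * b powr (- k)) * (a - b)"
        using ab by (simp add: powr_diff)
      also have "\<dots> \<le> (k * d powr (- k)) * norm (z - w)"
        using ab d k by (intro mult_mono mult_left_mono powr_mono2') auto
      finally show "(b powr (- k) - a powr (- k)) * norm w \<le> (k * d powr (- k)) * norm (z - w)" .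
    qed
    finally show ?thesis by (simp add: k_def algebra_simps)
  qed
  show ?thesis
    using *[of w z] *[of z w] by (cases "norm w \<le> norm z") (auto simp: norm_minus_commute)
qed

text \<open>\<open>G\<close> has the force as its gradient, so motion under
  \<open>e *\<^sub>R force q d\<close> alone conserves
  \<open>(norm z')\<^sup>2 / 2 - e * G z\<close>. Outside the core its values are explicit; inside,
  the upper bound is what forms the energy barrier.\<close>

definition force_potential :: "real \<Rightarrow> real \<Rightarrow> ('a::real_inner \<Rightarrow> real) \<Rightarrow> bool" where
  "force_potential q d G \<longleftrightarrow>
     (\<forall>z. (G has_derivative (\<lambda>h. force q d z \<bullet> h)) (at z)) \<and>
     (\<forall>z. d \<le> norm z \<longrightarrow> G z = - (norm z powr (1 - q)) / (q - 1)) \<and>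
     (\<forall>z. norm z \<le> d \<longrightarrow> G z \<le> - (d powr (1 - q)) / (q - 1))"

text \<open>The potential is sought as a function \<open>\<Gamma>\<close> of
  \<open>z \<bullet> z\<close>, which avoids differentiating the norm at the origin; the chain rule
  then asks for the derivative \<open>\<psi>\<close>. From \<open>d\<^sup>2\<close> on,
  \<open>\<Gamma>\<close> is identified with the explicit primitive \<open>B\<close>; below,
  monotonicity gives the bound.\<close>

lemma force_potential_exists:
  assumes d: "d > 0" and q: "q > 1"
  obtains G :: "'a::real_inner \<Rightarrow> real" where "force_potential q d G"
proof -
  define \<psi> where "\<psi> s = max s (d\<^sup>2) powr (- (q + 1) / 2) / 2" for s :: real
  define B where "B s = - (s powr ((1 - q) / 2)) / (q - 1)" for s :: real
  have d2: "d\<^sup>2 > 0" using d by simp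
  have psi0: "\<psi> s \<ge> 0" for s by (simp add: \<psi>_def)
  have cont: "isCont \<psi> s" for s
  proof -
    have "max s (d\<^sup>2) \<noteq> 0" using d2 by linarith
    then show ?thesis unfolding \<psi>_def[abs_def] by (intro continuous_intros) auto
  qed
  have "\<exists>F. \<forall>x. (- \<infinity>::ereal) < ereal x \<longrightarrow> ereal x < (\<infinity>::ereal) \<longrightarrow> (F has_vector_derivative \<psi> x) (at x)"
    by (rule einterval_antiderivative) (use cont in auto)
  then obtain \<Gamma>0 where \<Gamma>0: "\<And>s. (\<Gamma>0 has_real_derivative \<psi> s) (at s)"
    by (auto simp: has_real_derivative_iff_has_vector_derivative)
  define \<Gamma> where "\<Gamma> s = \<Gamma>0 s - \<Gamma>0 (d\<^sup>2) + B (d\<^sup>2)" for s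
  have \<Gamma>: "(\<Gamma> has_real_derivative \<psi> s) (at s)" for s
    unfolding \<Gamma>_def[abs_def] by (auto intro!: derivative_eq_intros \<Gamma>0)
  have B: "(B has_real_derivative \<psi> s) (at s)" if "s \<ge> d\<^sup>2" for s
  proof -
    have s: "s > 0" using that d2 by linarith
    have "- (((1 - q) / 2) * s powr ((1 - q) / 2 - 1)) / (q - 1) = \<psi> s"
    proof -
      have "(1 - q) / 2 - 1 = - (q + 1) / 2" by (simp add: field_simps)
      then show ?thesis using that q by (simp add: \<psi>_def max_absorb1 field_simps)
    qed
    then show ?thesis
      unfolding B_def[abs_def] using s q by (auto intro!: derivative_eq_intros)
  qed
  have out: "\<Gamma> s = B s" if "s \<ge> d\<^sup>2" for s
  proof -
    have "\<exists>c. \<forall>s\<in>{d\<^sup>2..}. \<Gamma> s - B s = c"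
      by (rule has_field_derivative_zero_constant)
        (auto intro!: derivative_eq_intros has_field_derivative_at_within[OF \<Gamma>] has_field_derivative_at_within[OF B])
    then obtain c where c: "\<forall>s\<in>{d\<^sup>2..}. \<Gamma> s - B s = c" by blast
    then have "c = 0" using bspec[OF c, of "d\<^sup>2"] by (simp add: \<Gamma>_def)
    then show ?thesis using c that by auto
  qed
  have ins: "\<Gamma> s \<le> B (d\<^sup>2)" if "s \<le> d\<^sup>2" for s
  proof -
    have "\<Gamma> s \<le> \<Gamma> (d\<^sup>2)"
      using that \<Gamma> by (intro DERIV_nonneg_imp_nondecreasing[of s "d\<^sup>2" \<Gamma>]) (use psi0 in blast)+
    then show ?thesis by (simp add: \<Gamma>_def)
  qed
  define G where "G z = \<Gamma> (z \<bullet> z)" for z :: 'a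
  have Bn: "B (x\<^sup>2) = - (x powr (1 - q)) / (q - 1)" if "x > 0" for x
  proof -
    have "2 * ((1 - q) / 2) = 1 - q" by (simp add: field_simps)
    then show ?thesis using power2_powr[OF that, of "(1 - q) / 2"] by (simp only: B_def)
  qed
  have "force_potential q d G"
    unfolding force_potential_def
  proof (intro conjI allI impI)
    fix z :: 'a
    have m: "max (z \<bullet> z) (d\<^sup>2) = (max (norm z) d)\<^sup>2"
      using d by (simp add: max_def power2_norm_eq_inner[symmetric] abs_le_square_iff[symmetric])
    have "max (norm z) d > 0" using d by simp
    then have psi: "\<psi> (z \<bullet> z) = inverse (max (norm z) d powr (q + 1)) / 2"
    proof -
      have "2 * (- (q + 1) / 2) = - (q + 1)" by (simp add: field_simps)
      then show ?thesis
        using power2_powr[OF \<open>max (norm z) d > 0\<close>, of "- (q + 1) / 2"] unfolding \<psi>_def m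
        by (simp only: powr_minus)
    qed
    have "((\<lambda>z. \<Gamma> (z \<bullet> z)) has_derivative (\<lambda>h. (z \<bullet> h + h \<bullet> z) * \<psi> (z \<bullet> z))) (at z)"
      by (rule has_derivative_compose[of "\<lambda>z. z \<bullet> z" "\<lambda>h. z \<bullet> h + h \<bullet> z" z UNIV \<Gamma> "\<lambda>h. h * \<psi> (z \<bullet> z)"])
        (use \<Gamma>[of "z \<bullet> z"] in \<open>auto intro!: derivative_eq_intros simp: has_field_derivative_def mult_commute_abs\<close>)
    then show "(G has_derivative (\<lambda>h. force q d z \<bullet> h)) (at z)"
      unfolding G_def[abs_def] psi by (simp add: force_def inner_commute mult.commute)
    show "G z = - (norm z powr (1 - q)) / (q - 1)" if "d \<le> norm z"
    proof -
      have "d\<^sup>2 \<le> (norm z)\<^sup>2" using that d by (intro power_mono) auto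
      then show ?thesis using out[of "(norm z)\<^sup>2"] Bn[OF less_le_trans[OF d that]] by (simp add: G_def power2_norm_eq_inner)
    qed
    show "G z \<le> - (d powr (1 - q)) / (q - 1)" if "norm z \<le> d"
    proof -
      have "(norm z)\<^sup>2 \<le> d\<^sup>2" using that by (intro power_mono) auto
      then show ?thesis using ins[of "(norm z)\<^sup>2"] Bn[of d] d by (simp add: G_def power2_norm_eq_inner)
    qed
  qed
  then show ?thesis by (rule that)
qed

section \<open>First order estimates for the potential\<close>

lemma force_potential_mvt:
  fixes z h :: "'a::real_inner"
  assumes "force_potential q d G"
  obtains s where "s \<in> {0..1}" "G (z + h) - G z = force q d (z + s *\<^sub>R h) \<bullet> h"
proof -
  have "((\<lambda>s. G (z + s *\<^sub>R h)) has_derivative (\<lambda>k. force q d (z + s *\<^sub>R h) \<bullet> (k *\<^sub>R h))) (at s within {0..1})" for s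
    using assms unfolding force_potential_def
    by (intro has_derivative_compose[of "\<lambda>s. z + s *\<^sub>R h" "\<lambda>k. k *\<^sub>R h" s "{0..1}" G])
       (auto intro!: derivative_eq_intros)
  from mvt_very_simple[of 0 1 "\<lambda>s. G (z + s *\<^sub>R h)", OF _ this]
  show ?thesis using that by auto
qed

lemma force_potential_lipschitz:
  assumes G: "force_potential q d G" and "d > 0" "q \<ge> 0"
  shows "\<bar>G z - G w\<bar> \<le> d powr (- q) * norm (z - w)"
proof -
  obtain s where "G (w + (z - w)) - G w = force q d (w + s *\<^sub>R (z - w)) \<bullet> (z - w)"
    using force_potential_mvt[OF G] by blast
  then have "\<bar>G z - G w\<bar> \<le> norm (force q d (w + s *\<^sub>R (z - w))) * norm (z - w)"
    using Cauchy_Schwarz_ineq2 by simp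
  also have "\<dots> \<le> d powr (- q) * norm (z - w)"
    using assms by (intro mult_right_mono norm_force_le) auto
  finally show ?thesis .
qed

lemma force_potential_lower_quadratic:
  assumes G: "force_potential q d G" and "d > 0" "q \<ge> 0"
  shows "G (z + h) - G z \<ge> force q d z \<bullet> h - (q + 2) * d powr (- (q + 1)) * (norm h)\<^sup>2"
proof -
  define L where "L = (q + 2) * d powr (- (q + 1))"
  obtain s where s: "s \<in> {0..1}" "G (z + h) - G z = force q d (z + s *\<^sub>R h) \<bullet> h"
    using force_potential_mvt[OF G] by blast
  have "\<bar>(force q d (z + s *\<^sub>R h) - force q d z) \<bullet> h\<bar> \<le> norm (force q d (z + s *\<^sub>R h) - force q d z) * norm h"
    by (rule Cauchy_Schwarz_ineq2)
  also have "\<dots> \<le> (L * norm (s *\<^sub>R h)) * norm h"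
    using force_lipschitz[OF assms(2,3), of "z + s *\<^sub>R h" z] by (intro mult_right_mono) (auto simp: L_def)
  also have "\<dots> \<le> (L * norm h) * norm h"
    using s assms by (intro mult_right_mono mult_left_mono) (auto simp: L_def mult_left_le_one_le)
  finally show ?thesis
    using s by (simp add: L_def inner_diff_left power2_eq_square mult.assoc)
qed

section \<open>The shooting map\<close>

lemma continuous_on_force [continuous_intros]:
  assumes "d > 0" "continuous_on S f"
  shows "continuous_on S (\<lambda>x. force q d (f x))"
proof -
  have "max (norm (f x)) d \<noteq> 0" for x using assms(1) by linarith
  then show ?thesis
    unfolding force_def using assms by (intro continuous_intros) auto
qed

lemma homotopic_linear_nonzero:
  fixes f g :: "'b::topological_space \<Rightarrow> 'c::real_normed_vector"
  assumes "continuous_on S f" "continuous_on S g"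
    and "\<And>x s. x \<in> S \<Longrightarrow> s \<in> {0..1} \<Longrightarrow> (1 - s) *\<^sub>R f x + s *\<^sub>R g x \<noteq> 0"
  shows "homotopic_with_canon (\<lambda>_. True) S (- {0}) f g"
  using assms by (intro homotopic_with_linear) (auto simp: closed_segment_def)

text \<open>The flow is a parameter of the locale, so that orbits for two truncation radii can be
  interpreted side by side.\<close>

locale shooting =
  fixes q d e :: real and H :: "real \<Rightarrow> 'a::euclidean_space" and y y' :: "'a \<Rightarrow> 'a \<Rightarrow> real \<Rightarrow> 'a"
  assumes q: "q \<ge> 2" and d: "d > 0" and e: "e > 0" and contH: "continuous_on {0..1} H"
    and y0 [simp]: "y p v 0 = p" and y'0 [simp]: "y' p v 0 = v"
    and der_y: "t \<in> {0..1} \<Longrightarrow> (y p v has_vector_derivative y' p v t) (at t within {0..1})"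
    and der_y': "t \<in> {0..1} \<Longrightarrow>
      (y' p v has_vector_derivative e *\<^sub>R force q d (y p v t - H t)) (at t within {0..1})"

definition shooting_field :: "real \<Rightarrow> real \<Rightarrow> real \<Rightarrow> (real \<Rightarrow> 'a) \<Rightarrow> real \<Rightarrow> 'a \<times> 'a \<Rightarrow> 'a::real_inner \<times> 'a" where
  "shooting_field q d e H t x = (snd x, e *\<^sub>R force q d (fst x - H t))"

lemma shooting_field_lipschitz:
  assumes "d > 0" "e \<ge> 0" "q \<ge> 0"
  shows "norm (shooting_field q d e H t x - shooting_field q d e H t x') \<le>
    (1 + e * ((q + 2) * d powr (- (q + 1)))) * norm (x - x')"
proof -
  define L where "L = (q + 2) * d powr (- (q + 1))"
  have n: "norm (snd x - snd x') \<le> norm (x - x')" "norm (fst x - fst x') \<le> norm (x - x')"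
    by (metis norm_snd_le prod.collapse snd_diff, metis norm_fst_le prod.collapse fst_diff)
  have "norm (shooting_field q d e H t x - shooting_field q d e H t x') =
      norm (snd x - snd x', e *\<^sub>R (force q d (fst x - H t) - force q d (fst x' - H t)))"
    by (simp add: shooting_field_def scaleR_diff_right)
  also have "\<dots> \<le> norm (snd x - snd x') + e * norm (force q d (fst x - H t) - force q d (fst x' - H t))"
    using norm_Pair_le[of "snd x - snd x'" "e *\<^sub>R (force q d (fst x - H t) - force q d (fst x' - H t))"] assms
    by simp
  also have "\<dots> \<le> norm (snd x - snd x') + e * (L * norm (fst x - fst x'))"
    using force_lipschitz[OF assms(1,3), of "fst x - H t" "fst x' - H t"] assms
    by (intro add_left_mono mult_left_mono) (auto simp: L_def)
  also have "\<dots> \<le> norm (x - x') + e * (L * norm (x - x'))"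
    using assms n
    by (intro add_mono mult_left_mono) (auto simp: L_def)
  finally show ?thesis by (simp add: L_def algebra_simps)
qed

lemma shooting_exists:
  fixes H :: "real \<Rightarrow> 'a::euclidean_space"
  assumes "q \<ge> 2" "d > 0" "e > 0" "continuous_on {0..1} H"
  obtains y y' where "shooting q d e H y y'"
proof -
  have "\<exists>X. X 0 = a \<and> (\<forall>t\<in>{0..1}. (X has_vector_derivative shooting_field q d e H t (X t)) (at t within {0..1}))" for a
  proof (rule lipschitz_ode_solution_exists[of "shooting_field q d e H"])
    show "continuous_on ({0..1} \<times> UNIV) (\<lambda>(t, x). shooting_field q d e H t x)"
      unfolding shooting_field_def case_prod_unfold using assms
      by (intro continuous_intros continuous_on_compose2[OF assms(4)]) auto
  qed (use shooting_field_lipschitz[of d e q] assms in auto)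
  then obtain X where X: "\<And>a. X a 0 = a"
    "\<And>a t. t \<in> {0..1} \<Longrightarrow> (X a has_vector_derivative shooting_field q d e H t (X a t)) (at t within {0..1})"
    by metis
  have "shooting q d e H (\<lambda>p v t. fst (X (p, v) t)) (\<lambda>p v t. snd (X (p, v) t))"
  proof
    fix p v and t :: real assume "t \<in> {0..1}"
    note D = X(2)[OF this, of "(p, v)"]
    show "((\<lambda>t. fst (X (p, v) t)) has_vector_derivative snd (X (p, v) t)) (at t within {0..1})"
      using bounded_linear.has_vector_derivative[OF bounded_linear_fst D] by (simp add: shooting_field_def)
    show "((\<lambda>t. snd (X (p, v) t)) has_vector_derivative e *\<^sub>R force q d (fst (X (p, v) t) - H t)) (at t within {0..1})"
      using bounded_linear.has_vector_derivative[OF bounded_linear_snd D] by (simp add: shooting_field_def)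
  qed (use assms X in auto)
  then show ?thesis by (rule that)
qed

section \<open>Dependence on initial values and behaviour far from the origin\<close>

context shooting
begin

definition force_bound :: real where "force_bound = d powr (- q)"

definition force_lip :: real where "force_lip = (q + 2) * d powr (- (q + 1))"

lemma force_bound_pos: "force_bound > 0" using d by (simp add: force_bound_def)

lemma force_lip_pos: "force_lip > 0" using d q by (simp add: force_lip_def)

lemma norm_force_le': "norm (force q d z) \<le> force_bound"
  unfolding force_bound_def using d q by (intro norm_force_le) auto

lemma force_lipschitz': "norm (force q d z - force q d w) \<le> force_lip * norm (z - w)"
  unfolding force_lip_def using d q by (intro force_lipschitz) auto

lemma flow_dist_le:
  assumes "t \<in> {0..1}"
    and u: "\<And>t. t \<in> {0..1} \<Longrightarrow> (u has_vector_derivative u' t) (at t within {0..1})"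
      "\<And>t. t \<in> {0..1} \<Longrightarrow> (u' has_vector_derivative e *\<^sub>R force q d (u t - H t)) (at t within {0..1})"
  shows "norm ((u t, u' t) - (y p v t, y' p v t)) \<le> exp (1 + e * force_lip) * norm ((u 0, u' 0) - (p, v))"
proof -
  define K where "K = 1 + e * force_lip"
  have K: "K \<ge> 0" using e force_lip_pos by (simp add: K_def)
  have "norm ((u t, u' t) - (y p v t, y' p v t)) \<le> exp (K * t) * norm ((u 0, u' 0) - (y p v 0, y' p v 0))"
  proof (rule lipschitz_ode_solutions_dist[of "shooting_field q d e H" K "\<lambda>t. (u t, u' t)" "\<lambda>t. (y p v t, y' p v t)"])
    show "norm (shooting_field q d e H t x - shooting_field q d e H t x') \<le> K * norm (x - x')" for t x x'
      using shooting_field_lipschitz[of d e q H t x x'] d e q by (simp add: K_def force_lip_def)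
  qed (use assms der_y der_y' in \<open>auto simp: shooting_field_def intro!: has_vector_derivative_Pair\<close>)
  also have "\<dots> \<le> exp K * norm ((u 0, u' 0) - (y p v 0, y' p v 0))"
    using assms K by (intro mult_right_mono) (auto simp: mult_left_le)
  finally show ?thesis by (simp add: K_def)
qed

lemma flow_unique:
  assumes "t \<in> {0..1}"
    and "\<And>t. t \<in> {0..1} \<Longrightarrow> (u has_vector_derivative u' t) (at t within {0..1})"
      "\<And>t. t \<in> {0..1} \<Longrightarrow> (u' has_vector_derivative e *\<^sub>R force q d (u t - H t)) (at t within {0..1})"
    and "u 0 = p" "u' 0 = v"
  shows "u t = y p v t" "u' t = y' p v t"
  using flow_dist_le[OF assms(1-3), of p v] assms(4,5) by (auto simp: norm_eq_zero zero_prod_def)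

lemma flow_lipschitz:
  assumes "t \<in> {0..1}"
  shows "norm (y p v t - y p' v' t) \<le> exp (1 + e * force_lip) * norm ((p, v) - (p', v'))"
    and "norm (y' p v t - y' p' v' t) \<le> exp (1 + e * force_lip) * norm ((p, v) - (p', v'))"
  using flow_dist_le[where u = "y p v" and u' = "y' p v" and p = p' and v = v', OF assms der_y der_y']
    norm_fst_le[of "y p v t - y p' v' t" "y' p v t - y' p' v' t"]
    norm_snd_le[of "y' p v t - y' p' v' t" "y p v t - y p' v' t"] by auto

lemma continuous_on_flow:
  assumes "t \<in> {0..1}"
  shows "continuous_on S (\<lambda>x. y (fst x) (snd x) t)" "continuous_on S (\<lambda>x. y' (fst x) (snd x) t)"
proof -
  have "(exp (1 + e * force_lip))-lipschitz_on S (\<lambda>x. y (fst x) (snd x) t)"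
       "(exp (1 + e * force_lip))-lipschitz_on S (\<lambda>x. y' (fst x) (snd x) t)"
    using flow_lipschitz[OF assms] by (auto simp: lipschitz_on_def dist_norm)
  then show "continuous_on S (\<lambda>x. y (fst x) (snd x) t)" "continuous_on S (\<lambda>x. y' (fst x) (snd x) t)"
    using lipschitz_on_continuous_on by blast+
qed

lemma continuous_on_y: "continuous_on {0..1} (y p v)"
  using der_y has_vector_derivative_continuous continuous_on_eq_continuous_within by blast

lemma continuous_on_y': "continuous_on {0..1} (y' p v)"
  using der_y' has_vector_derivative_continuous continuous_on_eq_continuous_within by blast

lemma velocity_bound:
  assumes "t \<in> {0..1}"
  shows "norm (y' p v t - v) \<le> e * force_bound"
proof -
  have "norm (y' p v t - y' p v 0) \<le> e * force_bound * \<bar>t - 0\<bar>"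
    using e norm_force_le' assms
    by (intro norm_diff_le_of_vector_derivative_bound[OF der_y']) (auto simp: mult_left_mono)
  also have "\<dots> \<le> e * force_bound * 1"
    using assms e force_bound_pos by (intro mult_left_mono) auto
  finally show ?thesis by simp
qed

lemma position_bound:
  assumes "t \<in> {0..1}"
  shows "norm (y p v t - p - t *\<^sub>R v) \<le> e * force_bound"
proof -
  have "((\<lambda>t. y p v t - t *\<^sub>R v) has_vector_derivative (y' p v t - v)) (at t within {0..1})" if "t \<in> {0..1}" for t
    by (rule derivative_eq_intros der_y that refl)+ simp
  then have "norm ((y p v t - t *\<^sub>R v) - (y p v 0 - 0 *\<^sub>R v)) \<le> e * force_bound * \<bar>t - 0\<bar>"
    using velocity_bound assms by (intro norm_diff_le_of_vector_derivative_bound) auto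
  also have "\<dots> \<le> e * force_bound * 1"
    using assms e force_bound_pos by (intro mult_left_mono) auto
  finally show ?thesis by (simp add: algebra_simps)
qed

text \<open>The two components of the displacement of the time-one map are exchanged: in this order the map
  is homotopic to the identity far away from the origin.\<close>

definition displacement :: "'a \<times> 'a \<Rightarrow> 'a \<times> 'a" where
  "displacement x = (y' (fst x) (snd x) 1 - snd x, y (fst x) (snd x) 1 - fst x)"

lemma continuous_on_displacement: "continuous_on S displacement"
  unfolding displacement_def[abs_def] by (intro continuous_intros continuous_on_flow) auto

lemma displacement_eq_0_iff: "displacement (p, v) = 0 \<longleftrightarrow> y p v 1 = p \<and> y' p v 1 = v"
  by (auto simp: displacement_def zero_prod_def)

text \<open>The frontier of a box with radii \<open>R\<close> in position and \<open>\<rho>\<close>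
  in velocity splits in two. Where \<open>norm v = \<rho>\<close>, the position changes by
  \<open>v\<close> up to the smaller error \<open>b\<close>, so the second component cannot vanish.
  Where \<open>norm p = R\<close>, the orbit relative to \<open>H\<close> keeps a positive inner
  product with \<open>p\<close>, so repulsion gives
  \<open>p \<bullet> (y' p v 1 - v) > 0\<close>.\<close>

lemma displacement_homotopic_id_outside:
  assumes "bounded K"
  obtains \<Omega> where "open \<Omega>" "bounded \<Omega>" "0 \<in> \<Omega>" "K \<subseteq> \<Omega>"
    "homotopic_with_canon (\<lambda>_. True) (frontier \<Omega>) (- {0}) displacement (\<lambda>x. x)"
proof -
  have "bounded (H ` {0..1})" by (intro compact_imp_bounded compact_continuous_image contH compact_Icc)
  then obtain m where m: "\<And>t. t \<in> {0..1} \<Longrightarrow> norm (H t) \<le> m" unfolding bounded_iff by blast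
  have "m \<ge> 0" using order_trans[OF norm_ge_zero m[of 0]] by simp
  obtain c where c: "c > 0" "\<And>x. x \<in> K \<Longrightarrow> norm x \<le> c" using assms by (auto simp: bounded_pos)
  define b where "b = e * force_bound"
  have b: "b > 0" using e force_bound_pos by (simp add: b_def)
  \<comment> \<open>\<open>\<rho> > b\<close> beats the position error,
    \<open>R > b + \<rho> + m\<close> beats the total deviation of \<open>y p v t - H t\<close> from
    \<open>p\<close>, and \<open>c\<close> makes the box contain \<open>K\<close>.\<close>
  define \<rho> where "\<rho> = b + c + 1"
  define R where "R = \<rho> + b + m + c + 1"
  have R: "R > 0" "\<rho> > 0" using b c \<open>m \<ge> 0\<close> by (auto simp: R_def \<rho>_def)
  define \<Omega> where "\<Omega> = ball (0::'a) R \<times> ball (0::'a) \<rho>"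
  show ?thesis
  proof
    show "open \<Omega>" "bounded \<Omega>" unfolding \<Omega>_def by (auto intro: open_Times bounded_Times)
    show "0 \<in> \<Omega>" using R by (simp add: \<Omega>_def zero_prod_def)
    show "K \<subseteq> \<Omega>"
    proof
      fix x assume "x \<in> K"
      then have "norm (fst x) \<le> c" "norm (snd x) \<le> c"
        using c(2)[of x] norm_fst_le[of "fst x" "snd x"] norm_snd_le[of "snd x" "fst x"] by auto
      then show "x \<in> \<Omega>" using b \<open>m \<ge> 0\<close> c by (auto simp: \<Omega>_def mem_Times_iff R_def \<rho>_def)
    qed
    show "homotopic_with_canon (\<lambda>_. True) (frontier \<Omega>) (- {0}) displacement (\<lambda>x. x)"
    proof (rule homotopic_linear_nonzero)
      fix x s assume "x \<in> frontier \<Omega>" and s: "s \<in> {0..1::real}"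
      obtain p v where x: "x = (p, v)" by (cases x)
      have pv: "norm p \<le> R" "norm v \<le> \<rho>" "norm p = R \<or> norm v = \<rho>"
        using \<open>x \<in> frontier \<Omega>\<close> R by (auto simp: \<Omega>_def x frontier_def closure_Times interior_Times)
      show "(1 - s) *\<^sub>R displacement x + s *\<^sub>R x \<noteq> 0"
      proof
        assume *: "(1 - s) *\<^sub>R displacement x + s *\<^sub>R x = 0"
        then have 1: "(1 - s) *\<^sub>R (y' p v 1 - v) + s *\<^sub>R p = 0" and 2: "(1 - s) *\<^sub>R (y p v 1 - p) + s *\<^sub>R v = 0"
          by (auto simp: x displacement_def zero_prod_def)
        show False
        proof (cases "norm v = \<rho>")
          case True
          have "v = - ((1 - s) *\<^sub>R (y p v 1 - p - 1 *\<^sub>R v))"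
            using 2 by (simp add: algebra_simps add_eq_0_iff)
          then have "norm v = (1 - s) * norm (y p v 1 - p - 1 *\<^sub>R v)"
            using s by (metis abs_of_nonneg atLeastAtMost_iff diff_ge_0_iff_ge norm_minus_cancel norm_scaleR)
          also have "\<dots> \<le> 1 * b"
            using s b position_bound[of 1 p v] by (intro mult_mono) (auto simp: b_def)
          finally show False using True c by (simp add: \<rho>_def)
        next
          case False
          then have p: "norm p = R" using pv by simp
          have pos: "p \<bullet> (e *\<^sub>R force q d (y p v t - H t)) > 0" if t: "t \<in> {0..1}" for t
          proof -
            have "norm (y p v t - H t - p) \<le> norm (y p v t - p - t *\<^sub>R v) + norm (t *\<^sub>R v) + norm (H t)"
              using norm_triangle_ineq[of "y p v t - p - t *\<^sub>R v" "t *\<^sub>R v"]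
                norm_triangle_ineq4[of "y p v t - p" "H t"] by (simp add: algebra_simps)
            also have "\<dots> \<le> b + \<rho> + m"
            proof (intro add_mono)
              show "norm (y p v t - p - t *\<^sub>R v) \<le> b" using position_bound[OF t] by (simp add: b_def)
              show "norm (t *\<^sub>R v) \<le> \<rho>" using t pv(2) mult_mono[of t 1 "norm v" \<rho>] by simp
            qed (use m t in auto)
            also have "\<dots> < R" using c by (simp add: R_def)
            finally have "norm (y p v t - H t - p) < norm p" using p by simp
            then have "\<bar>p \<bullet> (y p v t - H t - p)\<bar> < norm p * norm p"
              using Cauchy_Schwarz_ineq2[of p "y p v t - H t - p"] p R
              by (meson less_le_trans mult_strict_left_mono not_le order_trans)
            then have "p \<bullet> (y p v t - H t) > 0"
              by (simp add: inner_diff_right power2_norm_eq_inner[symmetric] power2_eq_square)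
            moreover have "max (norm (y p v t - H t)) d > 0" using d by simp
            ultimately show ?thesis using e by (simp add: inner_force)
          qed
          have "((\<lambda>t. p \<bullet> y' p v t) has_vector_derivative p \<bullet> (e *\<^sub>R force q d (y p v t - H t))) (at t within {0..1})"
            if "t \<in> {0..1}" for t
            using bounded_linear.has_vector_derivative[OF bounded_linear_inner_right der_y'[OF that]] .
          then obtain t where "t \<in> {0..1}" "p \<bullet> y' p v 1 - p \<bullet> y' p v 0 = p \<bullet> (e *\<^sub>R force q d (y p v t - H t))"
            using mvt_very_simple[of 0 1 "\<lambda>t. p \<bullet> y' p v t" "\<lambda>t h. h *\<^sub>R (p \<bullet> (e *\<^sub>R force q d (y p v t - H t)))"]
            by (auto simp: has_vector_derivative_def)
          then have "p \<bullet> (y' p v 1 - v) > 0" using pos by (simp add: inner_diff_right)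
          moreover have "p \<bullet> p > 0" using p R by (auto simp: power2_norm_eq_inner[symmetric])
          ultimately have "(1 - s) * (p \<bullet> (y' p v 1 - v)) + s * (p \<bullet> p) > 0"
            using s by (cases "s = 0") (auto intro: add_nonneg_pos)
          moreover have "p \<bullet> ((1 - s) *\<^sub>R (y' p v 1 - v) + s *\<^sub>R p) = 0" unfolding 1 by simp
          ultimately show False by (simp only: inner_add_right inner_scaleR_right)
        qed
      qed
    qed (intro continuous_intros continuous_on_displacement)+
  qed
qed

end

section \<open>Energy estimates for periodic solutions\<close>

lemma periodic_max_second_derivative_nonpos:
  fixes \<phi> :: "real \<Rightarrow> real"
  assumes 1: "\<And>t. t \<in> {0..1} \<Longrightarrow> (\<phi> has_real_derivative \<phi>' t) (at t within {0..1})"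
    and 2: "\<And>t. t \<in> {0..1} \<Longrightarrow> (\<phi>' has_real_derivative \<phi>'' t) (at t within {0..1})"
    and per: "\<phi> 0 = \<phi> 1" "\<phi>' 0 = \<phi>' 1"
  obtains t0 where "t0 \<in> {0..1}" "\<And>t. t \<in> {0..1} \<Longrightarrow> \<phi> t \<le> \<phi> t0" "\<phi>'' t0 \<le> 0"
proof -
  have "continuous_on {0..1} \<phi>"
    using 1 DERIV_continuous continuous_on_eq_continuous_within by blast
  then obtain t1 where t1: "t1 \<in> {0..1}" "\<And>t. t \<in> {0..1} \<Longrightarrow> \<phi> t \<le> \<phi> t1"
    using continuous_attains_sup[of "{0..1::real}" \<phi>] by auto
  \<comment> \<open>0 and 1 are the same point of the circle: \<open>t0 < 1\<close> leaves room for
    steps to the right and \<open>s0 > 0\<close> for steps to the left, and periodicity transfers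
    the value and the derivative between them.\<close>
  define t0 where "t0 = (if t1 = 1 then 0 else t1)"
  have t0: "0 \<le> t0" "t0 < 1" and max0: "\<And>t. t \<in> {0..1} \<Longrightarrow> \<phi> t \<le> \<phi> t0"
    using t1 per(1) by (auto simp: t0_def)
  define s0 where "s0 = (if t0 = 0 then 1 else t0)"
  have s0: "0 < s0" "s0 \<le> 1" "\<phi>' s0 = \<phi>' t0" "\<phi> s0 = \<phi> t0"
    using t0 per by (auto simp: s0_def)
  have "\<phi>' t0 \<le> 0"
  proof (rule ccontr)
    assume "\<not> ?thesis"
    then obtain r where r: "r > 0" "\<And>h. h > 0 \<Longrightarrow> t0 + h \<in> {0..1} \<Longrightarrow> h < r \<Longrightarrow> \<phi> t0 < \<phi> (t0 + h)"
      using has_real_derivative_pos_inc_right[of \<phi> "\<phi>' t0" t0 "{0..1}"] 1[of t0] t0 by auto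
    define h where "h = min (r / 2) (1 - t0)"
    have h: "h > 0" "t0 + h \<le> 1" "h < r" using r t0 by (auto simp: h_def)
    then have "\<phi> t0 < \<phi> (t0 + h)" using t0 by (intro r(2)) auto
    then show False using max0[of "t0 + h"] h t0 by auto
  qed
  moreover have "\<phi>' s0 \<ge> 0"
  proof (rule ccontr)
    assume "\<not> ?thesis"
    then obtain r where r: "r > 0" "\<And>h. h > 0 \<Longrightarrow> s0 - h \<in> {0..1} \<Longrightarrow> h < r \<Longrightarrow> \<phi> s0 < \<phi> (s0 - h)"
      using has_real_derivative_neg_dec_left[of \<phi> "\<phi>' s0" s0 "{0..1}"] 1[of s0] s0 by auto
    define h where "h = min (r / 2) s0"
    have h: "h > 0" "s0 - h \<ge> 0" "h < r" using r s0 by (auto simp: h_def)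
    then have "\<phi> s0 < \<phi> (s0 - h)" using s0 by (intro r(2)) auto
    then show False using max0[of "s0 - h"] h s0 by auto
  qed
  ultimately have z: "\<phi>' t0 = 0" using s0 by simp
  have "\<phi>'' t0 \<le> 0"
  proof (rule ccontr)
    assume "\<not> ?thesis"
    then obtain r where r: "r > 0" "\<And>h. h > 0 \<Longrightarrow> t0 + h \<in> {0..1} \<Longrightarrow> h < r \<Longrightarrow> \<phi>' t0 < \<phi>' (t0 + h)"
      using has_real_derivative_pos_inc_right[of \<phi>' "\<phi>'' t0" t0 "{0..1}"] 2[of t0] t0 by auto
    define h where "h = min (r / 2) (1 - t0)"
    have h: "h > 0" "t0 + h \<le> 1" "h < r" using r t0 by (auto simp: h_def)
    have "\<exists>x\<in>{t0<..<t0 + h}. \<phi> (t0 + h) - \<phi> t0 = (\<lambda>k. k * \<phi>' x) (t0 + h - t0)"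
    proof (rule mvt_simple)
      fix x assume x: "t0 \<le> x" "x \<le> t0 + h"
      have "(\<phi> has_derivative (\<lambda>k. k * \<phi>' x)) (at x within {0..1})"
        using 1[of x] x h t0 by (simp add: has_field_derivative_def mult_commute_abs)
      then show "(\<phi> has_derivative (\<lambda>k. k * \<phi>' x)) (at x within {t0..t0 + h})"
        by (rule has_derivative_subset) (use t0 h in auto)
    qed (use h in auto)
    then obtain x where x: "x \<in> {t0<..<t0 + h}" "\<phi> (t0 + h) - \<phi> t0 = h * \<phi>' x" by auto
    have "\<phi>' x > 0" using r(2)[of "x - t0"] x h t0 z by auto
    then have "\<phi> (t0 + h) > \<phi> t0" using x h by (smt (verit) mult_pos_pos)
    then show False using max0[of "t0 + h"] h t0 by auto
  qed
  then show ?thesis using that[of t0] t0 max0 by auto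
qed

lemma periodic_max_norm:
  fixes z :: "real \<Rightarrow> 'a::real_inner"
  assumes 1: "\<And>t. t \<in> {0..1} \<Longrightarrow> (z has_vector_derivative z' t) (at t within {0..1})"
    and 2: "\<And>t. t \<in> {0..1} \<Longrightarrow> (z' has_vector_derivative z'' t) (at t within {0..1})"
    and per: "z 0 = z 1" "z' 0 = z' 1"
  obtains t0 where "t0 \<in> {0..1}" "\<And>t. t \<in> {0..1} \<Longrightarrow> norm (z t) \<le> norm (z t0)"
    "(norm (z' t0))\<^sup>2 + z t0 \<bullet> z'' t0 \<le> 0"
proof -
  have D1: "((\<lambda>t. z t \<bullet> z t) has_real_derivative 2 * (z t \<bullet> z' t)) (at t within {0..1})" if "t \<in> {0..1}" for t
    using has_derivative_inner[OF 1[OF that, unfolded has_vector_derivative_def] 1[OF that, unfolded has_vector_derivative_def]]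
    by (simp add: has_field_derivative_def inner_commute algebra_simps)
      (auto elim!: has_derivative_eq_rhs simp: fun_eq_iff)
  have D2: "((\<lambda>t. 2 * (z t \<bullet> z' t)) has_real_derivative 2 * (z' t \<bullet> z' t + z t \<bullet> z'' t)) (at t within {0..1})"
    if "t \<in> {0..1}" for t
  proof -
    have "((\<lambda>t. z t \<bullet> z' t) has_derivative (\<lambda>h. h * (z' t \<bullet> z' t + z t \<bullet> z'' t))) (at t within {0..1})"
      using has_derivative_inner[OF 1[OF that, unfolded has_vector_derivative_def] 2[OF that, unfolded has_vector_derivative_def]]
      by (auto elim!: has_derivative_eq_rhs simp: fun_eq_iff algebra_simps)
    then have "((\<lambda>t. z t \<bullet> z' t) has_real_derivative (z' t \<bullet> z' t + z t \<bullet> z'' t)) (at t within {0..1})"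
      by (simp add: has_field_derivative_def mult_commute_abs)
    then show ?thesis by (rule DERIV_cmult)
  qed
  obtain t0 where t0: "t0 \<in> {0..1}" "\<And>t. t \<in> {0..1} \<Longrightarrow> z t \<bullet> z t \<le> z t0 \<bullet> z t0"
      "2 * (z' t0 \<bullet> z' t0 + z t0 \<bullet> z'' t0) \<le> 0"
    by (rule periodic_max_second_derivative_nonpos[OF D1 D2]) (use per in auto)
  show ?thesis
  proof (rule that[OF t0(1)])
    show "norm (z t) \<le> norm (z t0)" if "t \<in> {0..1}" for t
      using t0(2)[OF that] by (simp add: norm_le)
    show "(norm (z' t0))\<^sup>2 + z t0 \<bullet> z'' t0 \<le> 0"
      using t0(3) by (simp add: power2_norm_eq_inner)
  qed
qed

lemma norm_diff_le_integral:
  fixes f :: "real \<Rightarrow> 'a::euclidean_space"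
  assumes f: "\<And>t. t \<in> {0..1} \<Longrightarrow> (f has_vector_derivative f' t) (at t within {0..1})"
    and k: "continuous_on {0..1} k" "\<And>t. t \<in> {0..1} \<Longrightarrow> norm (f' t) \<le> k t"
    and st: "s \<in> {0..1}" "t \<in> {0..1}"
  shows "norm (f t - f s) \<le> integral {0..1} k"
proof -
  have *: "norm (f t - f s) \<le> integral {0..1} k" if st: "0 \<le> s" "s \<le> t" "t \<le> 1" for s t
  proof -
    have hi: "(f' has_integral f t - f s) {s..t}"
    proof (rule fundamental_theorem_of_calculus)
      show "(f has_vector_derivative f' x) (at x within {s..t})" if "x \<in> {s..t}" for x
        by (rule has_vector_derivative_within_subset[OF f]) (use st that in auto)
    qed (use st in auto)
    have int: "k integrable_on {0..1}" "k integrable_on {s..t}"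
      using st by (auto intro!: integrable_continuous_real continuous_on_subset[OF k(1)])
    have "norm (integral {s..t} f') \<le> integral {s..t} k"
      using hi int st k(2) by (intro Henstock_Kurzweil_Integration.integral_norm_bound_integral) auto
    also have "\<dots> \<le> integral {0..1} k"
      using int st k(2) by (intro integral_subset_le) (use order_trans[OF norm_ge_zero k(2)] in auto)
    finally show ?thesis using hi by (simp add: integral_unique)
  qed
  show ?thesis
    using *[of s t] *[of t s] st by (cases "s \<le> t") (auto simp: norm_minus_commute)
qed

text \<open>Integrating the derivative of \<open>z \<bullet> z'\<close> over a period shows that the
  integral of \<open>(norm z')\<^sup>2\<close> plus a nonnegative force term equals minus that of
  \<open>z \<bullet> h\<close>. As \<open>h\<close> has mean zero, \<open>z\<close> may be replaced
  there by \<open>z t - z 0\<close>, which is bounded by the length \<open>I\<close> of the orbit.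
  Cauchy-Schwarz then gives \<open>I * I \<le> I * M\<close>, so \<open>I \<le> M\<close>. The
  energy changes at the rate \<open>z' \<bullet> h\<close>, hence by at most
  \<open>M * I\<close>.\<close>

lemma periodic_solution_energy_bounds:
  fixes z :: "real \<Rightarrow> 'a::euclidean_space"
  assumes M: "M > 0" and e: "e \<ge> 0"
    and 1: "\<And>t. t \<in> {0..1} \<Longrightarrow> (z has_vector_derivative z' t) (at t within {0..1})"
    and 2: "\<And>t. t \<in> {0..1} \<Longrightarrow> (z' has_vector_derivative e *\<^sub>R force q d (z t) + h t) (at t within {0..1})"
    and per: "z 0 = z 1" "z' 0 = z' 1"
    and h: "(h has_integral 0) {0..1}" "\<And>t. t \<in> {0..1} \<Longrightarrow> norm (h t) \<le> M"
    and G: "force_potential q d G" and st: "s \<in> {0..1}" "t \<in> {0..1}"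
  shows "norm (z t - z s) \<le> M"
    and "(norm (z' t))\<^sup>2 / 2 - e * G (z t) \<le> (norm (z' s))\<^sup>2 / 2 - e * G (z s) + M\<^sup>2"
proof -
  define I where "I = integral {0..1} (\<lambda>t. norm (z' t))"
  have cz': "continuous_on {0..1} (\<lambda>t. norm (z' t))"
    by (intro continuous_on_norm continuous_on_vector_derivative) (rule 2)
  have zI: "norm (z t - z s) \<le> I" if "s \<in> {0..1}" "t \<in> {0..1}" for s t
    unfolding I_def by (rule norm_diff_le_integral[OF 1 cz' _ that]) auto
  have "((\<lambda>t. z t \<bullet> z' t) has_vector_derivative (norm (z' t))\<^sup>2 + z t \<bullet> (e *\<^sub>R force q d (z t) + h t)) (at t within {0..1})"
    if "t \<in> {0..1}" for t
    using has_derivative_inner[OF 1[OF that, unfolded has_vector_derivative_def] 2[OF that, unfolded has_vector_derivative_def]]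
    unfolding has_vector_derivative_def
    by (auto elim!: has_derivative_eq_rhs simp: fun_eq_iff algebra_simps power2_norm_eq_inner)
  then have i1: "((\<lambda>t. (norm (z' t))\<^sup>2 + z t \<bullet> (e *\<^sub>R force q d (z t) + h t)) has_integral z 1 \<bullet> z' 1 - z 0 \<bullet> z' 0) {0..1}"
    by (intro fundamental_theorem_of_calculus) auto
  have i2: "((\<lambda>t. z 0 \<bullet> h t) has_integral z 0 \<bullet> 0) {0..1}"
    using has_integral_linear[OF h(1) bounded_linear_inner_right[of "z 0"]] by (simp add: o_def)
  have int0: "((\<lambda>t. ((norm (z' t))\<^sup>2 + z t \<bullet> (e *\<^sub>R force q d (z t) + h t) - z 0 \<bullet> h t) / (2 * M)) has_integral 0) {0..1}"
    using has_integral_divide[OF has_integral_diff[OF i1 i2], of "2 * M"] per by simp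
  have intI: "((\<lambda>t. norm (z' t) - (I / 2 + M / 2)) has_integral I - (I / 2 + M / 2)) {0..1}"
    unfolding I_def
    using has_integral_diff[OF integrable_integral[OF integrable_continuous_real[OF cz']] has_integral_const_real[of "I / 2 + M / 2" 0 1]]
    by (simp add: I_def)
  \<comment> \<open>Cauchy-Schwarz in pointwise form:
    \<open>2 * M * norm z' \<le> (norm z')\<^sup>2 + M\<^sup>2\<close> is integrated, which is why
    the integrands are divided by \<open>2 * M\<close>.\<close>
  have "I - (I / 2 + M / 2) \<le> 0"
  proof (rule has_integral_le[OF intI int0])
    fix t :: real assume t: "t \<in> {0..1}"
    have "\<bar>(z t - z 0) \<bullet> h t\<bar> \<le> I * M"
      using Cauchy_Schwarz_ineq2[of "z t - z 0" "h t"] zI[of 0 t] h(2)[OF t] t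
      by (smt (verit) atLeastAtMost_iff mult_mono norm_ge_zero)
    moreover have "z t \<bullet> force q d (z t) \<ge> 0" by (simp add: inner_force)
    then have "e * (z t \<bullet> force q d (z t)) \<ge> 0" using e by simp
    ultimately have "(norm (z' t))\<^sup>2 - I * M \<le> (norm (z' t))\<^sup>2 + z t \<bullet> (e *\<^sub>R force q d (z t) + h t) - z 0 \<bullet> h t"
      by (simp add: inner_add_right inner_diff_left)
    then have "((norm (z' t))\<^sup>2 - I * M) / (2 * M) \<le> ((norm (z' t))\<^sup>2 + z t \<bullet> (e *\<^sub>R force q d (z t) + h t) - z 0 \<bullet> h t) / (2 * M)"
      using M by (intro divide_right_mono) auto
    moreover have "norm (z' t) - (I / 2 + M / 2) \<le> ((norm (z' t))\<^sup>2 - I * M) / (2 * M)"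
    proof -
      have "0 \<le> (norm (z' t) - M)\<^sup>2" by simp
      then show ?thesis using M by (simp add: field_simps power2_eq_square)
    qed
    ultimately show "norm (z' t) - (I / 2 + M / 2) \<le>
        ((norm (z' t))\<^sup>2 + z t \<bullet> (e *\<^sub>R force q d (z t) + h t) - z 0 \<bullet> h t) / (2 * M)" by linarith
  qed
  then have IM: "I \<le> M" by simp
  show "norm (z t - z s) \<le> M" using zI[OF st] IM by simp
  define E where "E t = (norm (z' t))\<^sup>2 / 2 - e * G (z t)" for t
  have E: "(E has_vector_derivative z' t \<bullet> h t) (at t within {0..1})" if t: "t \<in> {0..1}" for t
  proof -
    have "((\<lambda>t. (z' t \<bullet> z' t) / 2) has_derivative (\<lambda>k. (z' t \<bullet> (k *\<^sub>R (e *\<^sub>R force q d (z t) + h t)) +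
        (k *\<^sub>R (e *\<^sub>R force q d (z t) + h t)) \<bullet> z' t) / 2)) (at t within {0..1})"
      using 2[OF t] unfolding has_vector_derivative_def by (auto intro!: derivative_eq_intros)
    moreover have "((\<lambda>t. G (z t)) has_derivative (\<lambda>k. force q d (z t) \<bullet> (k *\<^sub>R z' t))) (at t within {0..1})"
      using 1[OF t] G unfolding has_vector_derivative_def force_potential_def
      by (intro has_derivative_compose[of z "\<lambda>k. k *\<^sub>R z' t" t "{0..1}" G "\<lambda>h. force q d (z t) \<bullet> h"]) auto
    ultimately have "((\<lambda>t. (z' t \<bullet> z' t) / 2 - e * G (z t)) has_derivative (\<lambda>k. (z' t \<bullet> (k *\<^sub>R (e *\<^sub>R force q d (z t) + h t)) +
        (k *\<^sub>R (e *\<^sub>R force q d (z t) + h t)) \<bullet> z' t) / 2 - e * (force q d (z t) \<bullet> (k *\<^sub>R z' t)))) (at t within {0..1})"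
      by (intro has_derivative_diff has_derivative_mult_right)
    then show ?thesis
      unfolding has_vector_derivative_def E_def[abs_def] power2_norm_eq_inner
      by (auto elim!: has_derivative_eq_rhs simp: fun_eq_iff algebra_simps inner_commute)
  qed
  have "norm (E t - E s) \<le> integral {0..1} (\<lambda>t. M * norm (z' t))"
  proof (rule norm_diff_le_integral[OF E _ _ st])
    show "continuous_on {0..1} (\<lambda>t. M * norm (z' t))" by (intro continuous_intros cz')
    show "norm (z' t \<bullet> h t) \<le> M * norm (z' t)" if "t \<in> {0..1}" for t
      using Cauchy_Schwarz_ineq2[of "z' t" "h t"] h(2)[OF that] mult_left_mono[OF h(2)[OF that] norm_ge_zero[of "z' t"]]
      by (simp add: mult.commute)
  qed
  also have "\<dots> = M * I" by (simp add: I_def)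
  also have "\<dots> \<le> M\<^sup>2" using IM M by (simp add: power2_eq_square)
  finally show "(norm (z' t))\<^sup>2 / 2 - e * G (z t) \<le> (norm (z' s))\<^sup>2 / 2 - e * G (z s) + M\<^sup>2"
    by (simp add: E_def)
qed

text \<open>Either the truncated solution stays in the core \<open>norm z < d\<close>, where the force is linear, or it
  never enters the core: entering it from a distance bounded below costs more energy than is available.\<close>

lemma truncated_periodic_solution_dichotomy:
  assumes q: "q \<ge> 2" and e: "e > 0" and M: "M > 0"
  obtains d0 where "d0 > 0" "M * d0 powr q < e"
    "\<And>d z z' h t0. 0 < d \<Longrightarrow> d \<le> d0 \<Longrightarrow>
      (\<And>t. t \<in> {0..1} \<Longrightarrow> (z has_vector_derivative z' t) (at t within {0..1})) \<Longrightarrow>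
      (\<And>t. t \<in> {0..1} \<Longrightarrow> (z' has_vector_derivative e *\<^sub>R force q d (z t) + h t) (at t within {0..1})) \<Longrightarrow>
      z 0 = z 1 \<Longrightarrow> z' 0 = z' 1 \<Longrightarrow>
      (h has_integral 0) {0..1} \<Longrightarrow> (\<And>t. t \<in> {0..1} \<Longrightarrow> norm (h t) \<le> M) \<Longrightarrow>
      t0 \<in> {0..1} \<Longrightarrow> norm (z t0 :: 'a::euclidean_space) \<le> d \<Longrightarrow> \<forall>t\<in>{0..1}. norm (z t) < d"
proof -
  \<comment> \<open>At a point of maximal norm \<open>s \<ge> d\<close> the repulsion cannot exceed
    the forcing: \<open>e * s powr (- q) \<le> M\<close>, that is \<open>c \<le> s\<close>.\<close>
  define c where "c = (e / M) powr (1 / q)"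
  have c: "c > 0" using e M by (simp add: c_def)
  have cq: "c powr q = e / M" using e M q by (simp add: c_def powr_powr)
  \<comment> \<open>The energy available near the core: kinetic energy at the maximum, where
    \<open>s < 2 * M + 1\<close>, the variation \<open>M\<^sup>2\<close> along the orbit, and the
    potential at distance at least \<open>c\<close>.\<close>
  define W where "W = M * (2 * M + 1) / 2 + M\<^sup>2 + e * (c powr (1 - q) / (q - 1))"
  have W: "W > 0" using M e q c by (auto simp: W_def intro!: add_pos_nonneg)
  define A where "A = (W + 1) * (q - 1) / e"
  have A: "A > 0" using W e q by (simp add: A_def)
  \<comment> \<open>The bound 1 rules out a maximum of \<open>2 * M + 1\<close> or more, since the
    orbit has diameter at most \<open>M\<close>; \<open>c / 2\<close> gives
    \<open>M * d0 powr q < e\<close>; the last bound makes the barrier at radius \<open>d\<close>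
    cost at least \<open>W + 1\<close>.\<close>
  define d0 where "d0 = min (min 1 (c / 2)) (A powr (1 / (1 - q)))"
  have d0: "d0 > 0" "d0 \<le> 1" "d0 < c" "d0 \<le> A powr (1 / (1 - q))"
    using c A by (auto simp: d0_def)
  show ?thesis
  proof (rule that[OF d0(1)])
    have "d0 powr q < c powr q" using d0 q by (intro powr_less_mono2) auto
    then show "M * d0 powr q < e" using M cq by (simp add: field_simps)
    fix d h t0 and z z' :: "real \<Rightarrow> 'a"
    assume d: "0 < d" "d \<le> d0"
      and 1: "\<And>t. t \<in> {0..1} \<Longrightarrow> (z has_vector_derivative z' t) (at t within {0..1})"
      and 2: "\<And>t. t \<in> {0..1} \<Longrightarrow> (z' has_vector_derivative e *\<^sub>R force q d (z t) + h t) (at t within {0..1})"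
      and per: "z 0 = z 1" "z' 0 = z' 1"
      and h: "(h has_integral 0) {0..1}" "\<And>t. t \<in> {0..1} \<Longrightarrow> norm (h t) \<le> M"
      and t0: "t0 \<in> {0..1}" "norm (z t0) \<le> d"
    have "q > 1" using q by simp
    then obtain G :: "'a \<Rightarrow> real" where G: "force_potential q d G"
      using force_potential_exists[OF d(1)] by blast
    have bounds: "norm (z t - z s) \<le> M"
      "(norm (z' t))\<^sup>2 / 2 - e * G (z t) \<le> (norm (z' s))\<^sup>2 / 2 - e * G (z s) + M\<^sup>2"
      if "s \<in> {0..1}" "t \<in> {0..1}" for s t
      by (rule periodic_solution_energy_bounds[OF M less_imp_le[OF e] 1 2 per h G that]; assumption)+
    obtain t1 where t1: "t1 \<in> {0..1}" "\<And>t. t \<in> {0..1} \<Longrightarrow> norm (z t) \<le> norm (z t1)"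
        "(norm (z' t1))\<^sup>2 + z t1 \<bullet> (e *\<^sub>R force q d (z t1) + h t1) \<le> 0"
      by (rule periodic_max_norm[OF 1 2 per]) (use that in blast)+
    define s where "s = norm (z t1)"
    have "\<bar>z t1 \<bullet> h t1\<bar> \<le> s * M"
      using Cauchy_Schwarz_ineq2[of "z t1" "h t1"] h(2)[OF t1(1)] mult_left_mono[OF h(2)[OF t1(1)] norm_ge_zero[of "z t1"]]
      by (simp add: s_def)
    then have main: "(norm (z' t1))\<^sup>2 + e * (s\<^sup>2 / max s d powr (q + 1)) \<le> s * M"
      using t1(3) by (simp add: inner_add_right inner_force s_def power2_norm_eq_inner)
    have nn: "e * (s\<^sup>2 / max s d powr (q + 1)) \<ge> 0" using e by simp
    have force_le: "e * (s\<^sup>2 / max s d powr (q + 1)) \<le> s * M" using main by (smt (verit) zero_le_power2)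
    have vel: "(norm (z' t1))\<^sup>2 \<le> s * M" using main nn by linarith
    show "\<forall>t\<in>{0..1}. norm (z t) < d"
    proof (cases "s < d")
      case True
      then show ?thesis using t1(2) unfolding s_def by (blast intro: le_less_trans)
    next
      case False
      then have s: "s \<ge> d" "s > 0" using d by auto
      have "s\<^sup>2 / s powr (q + 1) = s * s powr (- q)"
        using s by (simp add: powr_add powr_minus power2_eq_square field_simps)
      then have "s * (e * s powr (- q)) \<le> s * M"
        using force_le s by (simp add: max_absorb1 mult_ac)
      then have "e * s powr (- q) \<le> M" using s by simp
      then have "c powr q \<le> s powr q"
        using s M e by (simp add: cq powr_minus field_simps)
      then have sc: "c \<le> s" using s c q by (meson not_le powr_less_mono2 order_trans less_imp_le zero_less_numeral less_le_trans)
      show ?thesis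
      proof (cases "s \<ge> 2 * M + 1")
        case True
        have "norm (z t1 - z t0) \<le> M" by (rule bounds(1)[OF t0(1) t1(1)])
        then have "s \<le> M + norm (z t0)" unfolding s_def by norm
        then have False using True t0(2) d d0 M by linarith
        then show ?thesis ..
      next
        case False
        have "(norm (z' t0))\<^sup>2 / 2 - e * G (z t0) \<le> (norm (z' t1))\<^sup>2 / 2 - e * G (z t1) + M\<^sup>2"
          by (rule bounds(2)[OF t1(1) t0(1)])
        moreover have "e * G (z t0) \<le> e * (- (d powr (1 - q)) / (q - 1))"
          using G t0(2) e by (intro mult_left_mono) (auto simp: force_potential_def)
        moreover have "(norm (z' t1))\<^sup>2 / 2 \<le> M * (2 * M + 1) / 2"
        proof -
          have "s * M \<le> (2 * M + 1) * M" using False M by (intro mult_right_mono) auto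
          then show ?thesis using vel by (simp add: mult.commute)
        qed
        moreover have "e * G (z t1) = - (e * (s powr (1 - q) / (q - 1)))"
          using G s by (simp add: force_potential_def s_def)
        moreover have "e * (- (d powr (1 - q)) / (q - 1)) = - (e * (d powr (1 - q) / (q - 1)))" by simp
        moreover have "e * (s powr (1 - q) / (q - 1)) \<le> e * (c powr (1 - q) / (q - 1))"
          using e q sc c by (intro mult_left_mono divide_right_mono powr_mono2') auto
        moreover have "0 \<le> (norm (z' t0))\<^sup>2 / 2" by simp
        ultimately have "e * (d powr (1 - q) / (q - 1)) \<le> W"
          unfolding W_def by linarith
        moreover have "A \<le> d powr (1 - q)"
        proof -
          have "(A powr (1 / (1 - q))) powr (1 - q) \<le> d powr (1 - q)"
            using d d0 q by (intro powr_mono2') auto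
          then show ?thesis using A q by (simp add: powr_powr)
        qed
        then have "e * (A / (q - 1)) \<le> e * (d powr (1 - q) / (q - 1))"
          using e q by (intro mult_left_mono divide_right_mono) auto
        moreover have "e * (A / (q - 1)) = W + 1" using e q by (simp add: A_def)
        ultimately have False by simp
        then show ?thesis ..
      qed
    qed
  qed
qed

section \<open>The linear core\<close>

lemma exponential_growth_unique:
  fixes \<alpha> :: "real \<Rightarrow> 'a::real_inner"
  assumes "\<And>t. t \<in> {0..1} \<Longrightarrow> (\<alpha> has_vector_derivative c *\<^sub>R \<alpha> t) (at t within {0..1})"
    and "t \<in> {0..1}"
  shows "\<alpha> t = exp (c * t) *\<^sub>R \<alpha> 0"
proof -
  have "norm (\<alpha> t - exp (c * t) *\<^sub>R \<alpha> 0) \<le> exp (\<bar>c\<bar> * t) * norm (\<alpha> 0 - exp (c * 0) *\<^sub>R \<alpha> 0)"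
  proof (rule lipschitz_ode_solutions_dist[of "\<lambda>_ x. c *\<^sub>R x" "\<bar>c\<bar>" \<alpha>])
    show "((\<lambda>t. exp (c * t) *\<^sub>R \<alpha> 0) has_vector_derivative c *\<^sub>R exp (c * t) *\<^sub>R \<alpha> 0) (at t within {0..1})" for t
      by (auto intro!: derivative_eq_intros simp: has_vector_derivative_def)
  qed (use assms in \<open>auto simp: scaleR_diff_right[symmetric]\<close>)
  then show ?thesis by simp
qed

lemma periodic_linear_first_order_exists:
  fixes h :: "real \<Rightarrow> 'a::euclidean_space"
  assumes c: "c \<noteq> 0" and h: "continuous_on {0..1} h"
  obtains \<alpha> where "\<And>t. t \<in> {0..1} \<Longrightarrow> (\<alpha> has_vector_derivative c *\<^sub>R \<alpha> t + h t) (at t within {0..1})" "\<alpha> 0 = \<alpha> 1"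
proof -
  define J where "J t = integral {0..t} (\<lambda>s. exp (- (c * s)) *\<^sub>R h s)" for t
  \<comment> \<open>The initial value of the periodic solution: it solves
    \<open>a = exp c *\<^sub>R (a + J 1)\<close>.\<close>
  define a where "a = (exp c / (1 - exp c)) *\<^sub>R J 1"
  define \<alpha> where "\<alpha> t = exp (c * t) *\<^sub>R (a + J t)" for t
  have J: "(J has_vector_derivative exp (- (c * t)) *\<^sub>R h t) (at t within {0..1})" if "t \<in> {0..1}" for t
    unfolding J_def[abs_def] using that
    by (intro integral_has_vector_derivative) (auto intro!: continuous_intros h)
  show ?thesis
  proof (rule that)
    fix t :: real assume t: "t \<in> {0..1}"
    have "((\<lambda>t. a + J t) has_vector_derivative 0 + exp (- (c * t)) *\<^sub>R h t) (at t within {0..1})"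
      by (intro has_vector_derivative_add has_vector_derivative_const J t)
    moreover have "((\<lambda>t. exp (c * t)) has_real_derivative c * exp (c * t)) (at t within {0..1})"
      by (auto intro!: derivative_eq_intros)
    ultimately have "(\<alpha> has_vector_derivative exp (c * t) *\<^sub>R (0 + exp (- (c * t)) *\<^sub>R h t) + (c * exp (c * t)) *\<^sub>R (a + J t)) (at t within {0..1})"
      unfolding \<alpha>_def[abs_def] by (intro has_vector_derivative_scaleR)
    then show "(\<alpha> has_vector_derivative c *\<^sub>R \<alpha> t + h t) (at t within {0..1})"
      by (simp add: \<alpha>_def exp_minus_inverse add.commute)
  next
    have "exp c \<noteq> 1" using c by simp
    then have "exp c / (1 - exp c) = exp c * (exp c / (1 - exp c) + 1)" by (simp add: field_simps)
    then have "a = (exp c * (exp c / (1 - exp c) + 1)) *\<^sub>R J 1" by (simp only: a_def)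
    also have "\<dots> = \<alpha> 1" by (simp add: \<alpha>_def a_def scaleR_add_left scaleR_add_right distrib_left)
    finally show "\<alpha> 0 = \<alpha> 1" by (simp add: \<alpha>_def J_def)
  qed
qed

section \<open>Orbits that never leave the core\<close>

context shooting
begin

definition core :: "('a \<times> 'a) set" where
  "core = {x. \<forall>t\<in>{0..1}. norm (y (fst x) (snd x) t - H t) < d}"

definition closed_core :: "('a \<times> 'a) set" where
  "closed_core = {x. \<forall>t\<in>{0..1}. norm (y (fst x) (snd x) t - H t) \<le> d}"

lemma open_core: "open core"
  unfolding open_contains_ball
proof
  fix x assume x: "x \<in> core"
  have "continuous_on {0..1} (\<lambda>t. norm (y (fst x) (snd x) t - H t))"
    by (intro continuous_intros continuous_on_y contH)
  then obtain t0 where t0: "t0 \<in> {0..1}"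
      "\<And>t. t \<in> {0..1} \<Longrightarrow> norm (y (fst x) (snd x) t - H t) \<le> norm (y (fst x) (snd x) t0 - H t0)"
    using continuous_attains_sup[of "{0..1::real}"] by force
  define m where "m = norm (y (fst x) (snd x) t0 - H t0)"
  define K where "K = exp (1 + e * force_lip)"
  have m: "m < d" using x t0 by (auto simp: core_def m_def)
  have K: "K > 0" by (simp add: K_def)
  have "ball x ((d - m) / K) \<subseteq> core"
  proof
    fix x' assume "x' \<in> ball x ((d - m) / K)"
    then have x': "K * norm (x' - x) < d - m" using K by (simp add: dist_norm norm_minus_commute field_simps)
    have "norm (y (fst x') (snd x') t - H t) < d" if t: "t \<in> {0..1}" for t
    proof -
      have "norm (y (fst x') (snd x') t - y (fst x) (snd x) t) \<le> K * norm (x' - x)"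
        using flow_lipschitz(1)[OF t, of "fst x'" "snd x'" "fst x" "snd x"] by (simp add: K_def)
      moreover have "norm (y (fst x) (snd x) t - H t) \<le> m" using t0(2)[OF t] by (simp add: m_def)
      ultimately show ?thesis using x'
        norm_triangle_ineq[of "y (fst x') (snd x') t - y (fst x) (snd x) t" "y (fst x) (snd x) t - H t"] by simp
    qed
    then show "x' \<in> core" by (simp add: core_def)
  qed
  then show "\<exists>r>0. ball x r \<subseteq> core" using m K by (intro exI[of _ "(d - m) / K"]) auto
qed

lemma closure_core_subset: "closure core \<subseteq> closed_core"
proof (rule closure_minimal)
  have "closed_core = (\<Inter>t\<in>{0..1}. {x. norm (y (fst x) (snd x) t - H t) \<le> d})"
    by (auto simp: closed_core_def)
  moreover have "closed {x. norm (y (fst x) (snd x) t - H t) \<le> d}" if "t \<in> {0..1}" for t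
    by (intro closed_Collect_le continuous_intros continuous_on_flow that)
  ultimately show "closed closed_core" by (simp add: closed_INT)
qed (auto simp: core_def closed_core_def)

lemma bounded_core: "bounded core"
proof -
  have "bounded (H ` {0..1})" by (intro compact_imp_bounded compact_continuous_image contH compact_Icc)
  then obtain m where m: "\<And>t. t \<in> {0..1} \<Longrightarrow> norm (H t) \<le> m" unfolding bounded_iff by blast
  have "norm x \<le> (d + m) + (2 * (d + m) + e * force_bound)" if "x \<in> core" for x
  proof -
    have *: "norm (y (fst x) (snd x) t) \<le> d + m" if "t \<in> {0..1}" for t
    proof -
      have "norm (y (fst x) (snd x) t - H t) < d" using \<open>x \<in> core\<close> that by (auto simp: core_def)
      then show ?thesis using m[OF that] norm_triangle_ineq[of "y (fst x) (snd x) t - H t" "H t"] by simp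
    qed
    have "norm (fst x) \<le> d + m" using *[of 0] by simp
    moreover have "norm (snd x) \<le> norm (y (fst x) (snd x) 1) + norm (fst x) + norm (y (fst x) (snd x) 1 - fst x - snd x)"
      by norm
    ultimately show ?thesis
      using *[of 1] position_bound[of 1 "fst x" "snd x"] norm_Pair_le[of "fst x" "snd x"] by simp
  qed
  then show ?thesis by (rule boundedI)
qed

definition core_rate :: real where "core_rate = sqrt (e / d powr (q + 1))"

lemma core_rate: "core_rate > 0" "core_rate\<^sup>2 = e / d powr (q + 1)"
  using e d by (auto simp: core_rate_def)

lemma core_force: "norm z \<le> d \<Longrightarrow> e *\<^sub>R force q d z = core_rate\<^sup>2 *\<^sub>R z"
  by (simp add: force_inside core_rate divide_inverse)

text \<open>In the core the equation for the difference \<open>\<eta>\<close> of two orbits is \<open>\<eta>'' = k\<^sup>2 \<eta>\<close>, and the first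
  order combinations \<open>\<eta>' + k \<eta>\<close> and \<open>\<eta>' - k \<eta>\<close> decouple.\<close>

lemma displacement_monotone_core:
  assumes "x \<in> closed_core" "x' \<in> closed_core" "x \<noteq> x'"
  shows "(x - x') \<bullet> (displacement x - displacement x') > 0"
proof -
  define k where "k = core_rate"
  have k: "k > 0" using core_rate by (simp add: k_def)
  obtain p v p' v' where x: "x = (p, v)" "x' = (p', v')" by (cases x, cases x') auto
  define \<eta> where "\<eta> t = y p v t - y p' v' t" for t
  define \<eta>' where "\<eta>' t = y' p v t - y' p' v' t" for t
  have 1: "(\<eta> has_vector_derivative \<eta>' t) (at t within {0..1})" if "t \<in> {0..1}" for t
    unfolding \<eta>_def \<eta>'_def using that by (intro has_vector_derivative_diff der_y)
  have 2: "(\<eta>' has_vector_derivative (k\<^sup>2) *\<^sub>R \<eta> t) (at t within {0..1})" if t: "t \<in> {0..1}" for t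
  proof -
    have "norm (y p v t - H t) \<le> d" "norm (y p' v' t - H t) \<le> d"
      using assms t by (auto simp: closed_core_def x)
    then have "e *\<^sub>R force q d (y p v t - H t) - e *\<^sub>R force q d (y p' v' t - H t) = (k\<^sup>2) *\<^sub>R \<eta> t"
      by (simp add: core_force k_def \<eta>_def scaleR_diff_right)
    then show ?thesis
      using has_vector_derivative_diff[OF der_y'[OF t, of p v] der_y'[OF t, of p' v']] by (simp add: \<eta>'_def[abs_def])
  qed
  define \<alpha> where "\<alpha> t = \<eta>' t + k *\<^sub>R \<eta> t" for t
  define \<beta> where "\<beta> t = \<eta>' t - k *\<^sub>R \<eta> t" for t
  have sc: "((\<lambda>t. k *\<^sub>R \<eta> t) has_vector_derivative k *\<^sub>R \<eta>' t) (at t within {0..1})" if "t \<in> {0..1}" for t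
    using bounded_linear.has_vector_derivative[OF bounded_linear_scaleR_right 1[OF that]] .
  have "(\<alpha> has_vector_derivative k *\<^sub>R \<alpha> t) (at t within {0..1})" if "t \<in> {0..1}" for t
    using has_vector_derivative_add[OF 2[OF that] sc[OF that]]
    by (simp add: \<alpha>_def[abs_def] algebra_simps power2_eq_square)
  then have a1: "\<alpha> 1 = exp k *\<^sub>R \<alpha> 0" using exponential_growth_unique[of \<alpha> k 1] by simp
  have "(\<beta> has_vector_derivative (- k) *\<^sub>R \<beta> t) (at t within {0..1})" if "t \<in> {0..1}" for t
    using has_vector_derivative_diff[OF 2[OF that] sc[OF that]]
    by (simp add: \<beta>_def[abs_def] algebra_simps power2_eq_square)
  then have b1: "\<beta> 1 = exp (- k) *\<^sub>R \<beta> 0" using exponential_growth_unique[of \<beta> "- k" 1] by simp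
  have \<eta>: "\<eta> t = (1 / (2 * k)) *\<^sub>R (\<alpha> t - \<beta> t)" and \<eta>': "\<eta>' t = (1 / 2) *\<^sub>R (\<alpha> t + \<beta> t)" for t
    using k by (auto simp: \<alpha>_def \<beta>_def scaleR_add_left[symmetric] algebra_simps)
  have "(x - x') \<bullet> (displacement x - displacement x') = \<eta> 0 \<bullet> (\<eta>' 1 - \<eta>' 0) + \<eta>' 0 \<bullet> (\<eta> 1 - \<eta> 0)"
    by (simp add: x displacement_def \<eta>_def \<eta>'_def inner_diff_right algebra_simps)
  also have "\<dots> = ((exp k - 1) * (\<alpha> 0 \<bullet> \<alpha> 0) + (1 - exp (- k)) * (\<beta> 0 \<bullet> \<beta> 0)) / (2 * k)"
    unfolding \<eta> \<eta>' a1 b1 using k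
    by (simp add: inner_add_left inner_add_right inner_diff_left inner_diff_right inner_commute field_simps)
  finally have eq: "(x - x') \<bullet> (displacement x - displacement x') =
      ((exp k - 1) * (\<alpha> 0 \<bullet> \<alpha> 0) + (1 - exp (- k)) * (\<beta> 0 \<bullet> \<beta> 0)) / (2 * k)" .
  have "\<alpha> 0 \<noteq> 0 \<or> \<beta> 0 \<noteq> 0"
  proof (rule ccontr)
    assume "\<not> ?thesis"
    then have "\<eta> 0 = 0" "\<eta>' 0 = 0" using \<eta>[of 0] \<eta>'[of 0] by auto
    then show False using assms(3) by (simp add: x \<eta>_def \<eta>'_def)
  qed
  moreover have "exp k - 1 > 0" "1 - exp (- k) > 0" using k by auto
  ultimately have "(exp k - 1) * (\<alpha> 0 \<bullet> \<alpha> 0) + (1 - exp (- k)) * (\<beta> 0 \<bullet> \<beta> 0) > 0"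
    by (metis add_nonneg_pos add_pos_nonneg inner_ge_zero inner_gt_zero_iff less_imp_le mult_nonneg_nonneg mult_pos_pos)
  then show ?thesis unfolding eq using k by simp
qed

text \<open>The linear equation has a periodic solution \<open>z\<close>, and at its maximal norm
  \<open>k\<^sup>2 * norm z \<le> M\<close>, so \<open>M * d powr q < e\<close> keeps it strictly
  inside the core. Monotonicity makes the inner product of the displacement with
  \<open>x - x0\<close> positive, so a straight line homotopy works and no determinant has to be
  computed.\<close>

lemma core_homotopic:
  assumes H: "\<And>t. t \<in> {0..1} \<Longrightarrow> (H has_vector_derivative H' t) (at t within {0..1})"
      "\<And>t. t \<in> {0..1} \<Longrightarrow> (H' has_vector_derivative - h t) (at t within {0..1})" "H 0 = H 1" "H' 0 = H' 1"
    and h: "continuous_on {0..1} h" "\<And>t. t \<in> {0..1} \<Longrightarrow> norm (h t) \<le> M"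
    and M: "M > 0" "M * d powr q < e"
  obtains x0 where "x0 \<in> core"
    "homotopic_with_canon (\<lambda>_. True) (frontier core) (- {0}) displacement (\<lambda>x. x - x0)"
proof -
  define k where "k = core_rate"
  have k: "k > 0" using core_rate by (simp add: k_def)
  obtain \<alpha> where \<alpha>: "\<And>t. t \<in> {0..1} \<Longrightarrow> (\<alpha> has_vector_derivative k *\<^sub>R \<alpha> t + h t) (at t within {0..1})" "\<alpha> 0 = \<alpha> 1"
    using periodic_linear_first_order_exists[of k h] k h by auto
  obtain \<beta> where \<beta>: "\<And>t. t \<in> {0..1} \<Longrightarrow> (\<beta> has_vector_derivative (- k) *\<^sub>R \<beta> t + h t) (at t within {0..1})" "\<beta> 0 = \<beta> 1"
    using periodic_linear_first_order_exists[of "- k" h] k h by auto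
  \<comment> \<open>The second order operator is factored: \<open>\<alpha>\<close> plays the part of
    \<open>z' + k z\<close> and \<open>\<beta>\<close> that of \<open>z' - k z\<close>.\<close>
  define z where "z t = (1 / (2 * k)) *\<^sub>R (\<alpha> t - \<beta> t)" for t
  define z' where "z' t = (1 / 2) *\<^sub>R (\<alpha> t + \<beta> t)" for t
  have z1: "(z has_vector_derivative z' t) (at t within {0..1})" if t: "t \<in> {0..1}" for t
  proof -
    have "((\<lambda>t. (1 / (2 * k)) *\<^sub>R (\<alpha> t - \<beta> t)) has_vector_derivative
        (1 / (2 * k)) *\<^sub>R ((k *\<^sub>R \<alpha> t + h t) - ((- k) *\<^sub>R \<beta> t + h t))) (at t within {0..1})"
      using bounded_linear.has_vector_derivative[OF bounded_linear_scaleR_right has_vector_derivative_diff[OF \<alpha>(1)[OF t] \<beta>(1)[OF t]]] .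
    moreover have "(1 / (2 * k)) *\<^sub>R ((k *\<^sub>R \<alpha> t + h t) - ((- k) *\<^sub>R \<beta> t + h t)) = z' t"
      using k by (simp add: z'_def algebra_simps)
    ultimately show ?thesis by (simp add: z_def[abs_def])
  qed
  have z2: "(z' has_vector_derivative (k\<^sup>2) *\<^sub>R z t + h t) (at t within {0..1})" if t: "t \<in> {0..1}" for t
  proof -
    have "((\<lambda>t. (1 / 2) *\<^sub>R (\<alpha> t + \<beta> t)) has_vector_derivative
        (1 / 2) *\<^sub>R ((k *\<^sub>R \<alpha> t + h t) + ((- k) *\<^sub>R \<beta> t + h t))) (at t within {0..1})"
      using bounded_linear.has_vector_derivative[OF bounded_linear_scaleR_right has_vector_derivative_add[OF \<alpha>(1)[OF t] \<beta>(1)[OF t]]] .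
    moreover have "(1 / 2) *\<^sub>R ((k *\<^sub>R \<alpha> t + h t) + ((- k) *\<^sub>R \<beta> t + h t)) = (k\<^sup>2) *\<^sub>R z t + h t"
      using k by (simp add: z_def algebra_simps power2_eq_square scaleR_add_left[symmetric])
    ultimately show ?thesis by (simp add: z'_def[abs_def])
  qed
  have zper: "z 0 = z 1" "z' 0 = z' 1" using \<alpha> \<beta> by (auto simp: z_def z'_def)
  obtain t0 where t0: "t0 \<in> {0..1}" "\<And>t. t \<in> {0..1} \<Longrightarrow> norm (z t) \<le> norm (z t0)"
      "(norm (z' t0))\<^sup>2 + z t0 \<bullet> ((k\<^sup>2) *\<^sub>R z t0 + h t0) \<le> 0"
    by (rule periodic_max_norm[OF z1 z2 zper]) (use that in blast)+
  have "norm (z t0) < d"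
  proof (cases "z t0 = 0")
    case False
    have "\<bar>z t0 \<bullet> h t0\<bar> \<le> norm (z t0) * M"
      using Cauchy_Schwarz_ineq2[of "z t0" "h t0"] h(2)[OF t0(1)] mult_left_mono[OF h(2)[OF t0(1)] norm_ge_zero[of "z t0"]]
      by simp
    then have "k\<^sup>2 * (norm (z t0))\<^sup>2 \<le> norm (z t0) * M"
      using t0(3) by (simp add: inner_add_right power2_norm_eq_inner) (smt (verit) inner_ge_zero)
    then have "norm (z t0) * (k\<^sup>2 * norm (z t0)) \<le> norm (z t0) * M"
      by (simp add: power2_eq_square mult_ac)
    then have "k\<^sup>2 * norm (z t0) \<le> M" using False by simp
    moreover have "M < k\<^sup>2 * d"
      using M d by (simp add: k_def core_rate powr_add field_simps)
    ultimately have "k\<^sup>2 * norm (z t0) < k\<^sup>2 * d" by simp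
    then show ?thesis using k by simp
  qed (use d in simp)
  then have zd: "norm (z t) < d" if "t \<in> {0..1}" for t using t0(2)[OF that] by simp
  define p where "p = z 0 + H 0"
  define v where "v = z' 0 + H' 0"
  have Y: "z t + H t = y p v t" "z' t + H' t = y' p v t" if t: "t \<in> {0..1}" for t
  proof -
    have D1: "((\<lambda>t. z t + H t) has_vector_derivative z' t + H' t) (at t within {0..1})" if "t \<in> {0..1}" for t
      using that by (intro has_vector_derivative_add z1 H)
    have D2: "((\<lambda>t. z' t + H' t) has_vector_derivative e *\<^sub>R force q d (z t + H t - H t)) (at t within {0..1})"
      if t: "t \<in> {0..1}" for t
      using has_vector_derivative_add[OF z2[OF t] H(2)[OF t]] zd[OF t] by (simp add: core_force k_def)
    show "z t + H t = y p v t" "z' t + H' t = y' p v t"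
      by (rule flow_unique[of t "\<lambda>t. z t + H t" "\<lambda>t. z' t + H' t", OF t D1 D2]; simp add: p_def v_def)+
  qed
  define x0 where "x0 = (p, v)"
  have core: "x0 \<in> core"
    unfolding core_def x0_def using zd by (simp add: Y(1)[symmetric])
  have zero: "displacement x0 = 0"
    unfolding x0_def displacement_eq_0_iff using Y[of 1] Y[of 0] zper H by simp
  have "homotopic_with_canon (\<lambda>_. True) (frontier core) (- {0}) displacement (\<lambda>x. x - x0)"
  proof (rule homotopic_linear_nonzero)
    fix x s assume "x \<in> frontier core" and s: "s \<in> {0..1::real}"
    then have x: "x \<in> closed_core" "x \<noteq> x0"
      using core open_core closure_core_subset by (auto simp: frontier_def interior_open)
    have x0: "x0 \<in> closed_core" using core by (auto simp: core_def closed_core_def)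
    have "(x - x0) \<bullet> displacement x > 0" using displacement_monotone_core[OF x(1) x0 x(2)] zero by simp
    moreover have "(x - x0) \<bullet> (x - x0) > 0" using x by simp
    ultimately have "(1 - s) * ((x - x0) \<bullet> displacement x) + s * ((x - x0) \<bullet> (x - x0)) > 0"
      using s by (cases "s = 0") (auto intro: add_nonneg_pos)
    then have "(x - x0) \<bullet> ((1 - s) *\<^sub>R displacement x + s *\<^sub>R (x - x0)) > 0"
      by (simp only: inner_add_right inner_scaleR_right)
    then show "(1 - s) *\<^sub>R displacement x + s *\<^sub>R (x - x0) \<noteq> 0" by force
  qed (intro continuous_intros continuous_on_displacement)+
  then show ?thesis using that core by blast
qed

end

section \<open>Reduction to the initial point\<close>

locale small_shooting = shooting +
  fixes G :: "'a \<Rightarrow> real"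
  assumes small: "e * force_lip \<le> 1 / 4" and G: "force_potential q d G"
begin

text \<open>Let \<open>N\<close> be the largest distance of the two orbits and \<open>a\<close> the
  initial difference. The relative acceleration is at most \<open>N / 4\<close>, so
  \<open>N \<le> N / 4 + a\<close>, that is \<open>N \<le> 4 / 3 * a\<close>; the constants 2 and
  1/2 are rounded up from 4/3 and 1/3.\<close>

lemma flow_difference_bounds:
  assumes t: "t \<in> {0..1}"
  shows "norm (y p v t - y p' v' t) \<le> 2 * (norm (p - p') + norm (v - v'))"
    and "norm ((y p v t - y p' v' t) - (p - p') - t *\<^sub>R (v - v')) \<le> (norm (p - p') + norm (v - v')) / 2"
proof -
  define \<eta> where "\<eta> t = y p v t - y p' v' t" for t
  define \<eta>' where "\<eta>' t = y' p v t - y' p' v' t" for t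
  define a where "a = norm (p - p') + norm (v - v')"
  have 1: "(\<eta> has_vector_derivative \<eta>' t) (at t within {0..1})" if "t \<in> {0..1}" for t
    unfolding \<eta>_def \<eta>'_def using that by (intro has_vector_derivative_diff der_y)
  have 2: "(\<eta>' has_vector_derivative e *\<^sub>R (force q d (y p v t - H t) - force q d (y p' v' t - H t))) (at t within {0..1})"
    if t: "t \<in> {0..1}" for t
    using has_vector_derivative_diff[OF der_y'[OF t, of p v] der_y'[OF t, of p' v']]
    by (simp add: \<eta>'_def[abs_def] scaleR_diff_right)
  have "continuous_on {0..1} (\<lambda>t. norm (\<eta> t))"
    unfolding \<eta>_def by (intro continuous_intros continuous_on_y)
  then obtain t0 where t0: "t0 \<in> {0..1}" "\<And>t. t \<in> {0..1} \<Longrightarrow> norm (\<eta> t) \<le> norm (\<eta> t0)"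
    using continuous_attains_sup[of "{0..1::real}"] by force
  define N where "N = norm (\<eta> t0)"
  have acc: "norm (e *\<^sub>R (force q d (y p v t - H t) - force q d (y p' v' t - H t))) \<le> N / 4" if t: "t \<in> {0..1}" for t
  proof -
    have "norm (e *\<^sub>R (force q d (y p v t - H t) - force q d (y p' v' t - H t))) \<le> e * (force_lip * norm (\<eta> t))"
      using force_lipschitz'[of "y p v t - H t" "y p' v' t - H t"] e by (simp add: \<eta>_def mult_left_mono)
    also have "\<dots> \<le> e * force_lip * N"
      using t0(2)[OF t] e force_lip_pos by (simp add: N_def mult.assoc mult_left_mono)
    also have "\<dots> \<le> (1 / 4) * N" using small by (intro mult_right_mono) (auto simp: N_def)
    finally show ?thesis by simp
  qed
  have vel: "norm (\<eta>' t - \<eta>' 0) \<le> N / 4" if "t \<in> {0..1}" for t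
  proof -
    have "norm (\<eta>' t - \<eta>' 0) \<le> N / 4 * \<bar>t - 0\<bar>"
      by (rule norm_diff_le_of_vector_derivative_bound[OF 2 acc]) (use that in auto)
    also have "\<dots> \<le> N / 4 * 1" using that by (intro mult_left_mono) (auto simp: N_def)
    finally show ?thesis by simp
  qed
  have pos: "norm (\<eta> t - \<eta> 0 - t *\<^sub>R \<eta>' 0) \<le> N / 4" if "t \<in> {0..1}" for t
  proof -
    have "((\<lambda>t. \<eta> t - t *\<^sub>R \<eta>' 0) has_vector_derivative (\<eta>' t - \<eta>' 0)) (at t within {0..1})" if "t \<in> {0..1}" for t
      by (rule derivative_eq_intros 1 that refl)+ simp
    then have "norm ((\<eta> t - t *\<^sub>R \<eta>' 0) - (\<eta> 0 - 0 *\<^sub>R \<eta>' 0)) \<le> N / 4 * \<bar>t - 0\<bar>"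
      using vel that by (intro norm_diff_le_of_vector_derivative_bound) auto
    also have "\<dots> \<le> N / 4 * 1" using that by (intro mult_left_mono) (auto simp: N_def)
    finally show ?thesis by (simp add: algebra_simps)
  qed
  have init: "\<eta> 0 = p - p'" "\<eta>' 0 = v - v'" by (auto simp: \<eta>_def \<eta>'_def)
  have "N \<le> norm (\<eta> t0 - \<eta> 0 - t0 *\<^sub>R \<eta>' 0) + norm (\<eta> 0) + norm (t0 *\<^sub>R \<eta>' 0)"
  proof -
    have "norm (\<eta> t0) \<le> norm (\<eta> t0 - \<eta> 0 - r) + norm (\<eta> 0) + norm r" for r by norm
    then show ?thesis unfolding N_def .
  qed
  also have "norm (t0 *\<^sub>R \<eta>' 0) \<le> norm (\<eta>' 0)" using t0 by (simp add: mult_left_le_one_le)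
  finally have "N \<le> N / 4 + norm (\<eta> 0) + norm (\<eta>' 0)" using pos[OF t0(1)] by simp
  then have N: "N \<le> 4 / 3 * a" by (simp add: a_def init)
  have a: "a \<ge> 0" by (simp add: a_def)
  show "norm (y p v t - y p' v' t) \<le> 2 * (norm (p - p') + norm (v - v'))"
    using t0(2)[OF t] N a unfolding a_def[symmetric] by (simp add: N_def \<eta>_def)
  show "norm ((y p v t - y p' v' t) - (p - p') - t *\<^sub>R (v - v')) \<le> (norm (p - p') + norm (v - v')) / 2"
    using pos[OF t] N a unfolding a_def[symmetric] by (simp add: init) (simp add: \<eta>_def)
qed

text \<open>As a function of \<open>v\<close>, \<open>y p v 1 - p\<close> differs from the identity
  by a map with Lipschitz constant 1/2; that map has a unique fixed point, and its fixed points are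
  the closing velocities.\<close>

lemma closing_velocity_exists: "\<exists>!v. y p v 1 = p"
proof -
  have "dist (v - (y p v 1 - p)) (v' - (y p v' 1 - p)) \<le> (1 / 2) * dist v v'" for v v'
    using flow_difference_bounds(2)[of 1 p v p v'] by (simp add: dist_norm norm_minus_commute algebra_simps)
  then have "\<exists>!v. v - (y p v 1 - p) = v"
    using banach_fix_type[of "1 / 2" "\<lambda>v. v - (y p v 1 - p)"] by simp
  moreover have "v - (y p v 1 - p) = v \<longleftrightarrow> y p v 1 = p" for v by auto
  ultimately show ?thesis by simp
qed

definition closing_velocity :: "'a \<Rightarrow> 'a" where "closing_velocity p = (THE v. y p v 1 = p)"

lemma closing_velocity: "y p (closing_velocity p) 1 = p"
  unfolding closing_velocity_def by (rule theI'[OF closing_velocity_exists])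

lemma closing_velocity_unique: "y p v 1 = p \<Longrightarrow> v = closing_velocity p"
  using closing_velocity closing_velocity_exists by blast

lemma norm_closing_velocity_le: "norm (closing_velocity p) \<le> e * force_bound"
  using position_bound[of 1 p "closing_velocity p"] by (simp add: closing_velocity)

text \<open>Both orbits return, so the difference of the end positions cancels that of the initial
  ones, and \<open>norm (v - v') \<le> (norm (p - p') + norm (v - v')) / 2\<close> remains for the
  closing velocities \<open>v\<close>, \<open>v'\<close>.\<close>

lemma closing_velocity_lipschitz: "norm (closing_velocity p - closing_velocity p') \<le> norm (p - p')"
  using flow_difference_bounds(2)[of 1 p "closing_velocity p" p' "closing_velocity p'"]
  by (simp add: closing_velocity norm_minus_commute)

lemma continuous_on_closing_velocity: "continuous_on S closing_velocity"
  using closing_velocity_lipschitz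
  by (intro lipschitz_on_continuous_on[of 1]) (auto simp: lipschitz_on_def dist_norm)

definition kick :: "'a \<Rightarrow> 'a" where
  "kick p = y' p (closing_velocity p) 1 - closing_velocity p"

lemma displacement_eq_0_iff_kick: "displacement (p, v) = 0 \<longleftrightarrow> v = closing_velocity p \<and> kick p = 0"
  using closing_velocity[of p] closing_velocity_unique[of p v] by (auto simp: displacement_eq_0_iff kick_def)

lemma norm_kick_le: "norm (kick p) \<le> e * force_bound"
  unfolding kick_def by (rule velocity_bound) simp

lemma continuous_on_kick: "continuous_on S kick"
proof -
  have "continuous_on S (\<lambda>p. (\<lambda>x. y' (fst x) (snd x) 1) (p, closing_velocity p))"
    by (rule continuous_on_compose2[OF continuous_on_flow(2)[of 1 UNIV]])
      (auto intro!: continuous_intros continuous_on_closing_velocity)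
  then show ?thesis
    unfolding kick_def[abs_def] by (auto intro!: continuous_intros continuous_on_closing_velocity)
qed

section \<open>Variational description of the closing orbits\<close>

abbreviation Y :: "'a \<Rightarrow> real \<Rightarrow> 'a" where "Y p \<equiv> y p (closing_velocity p)"
abbreviation Y' :: "'a \<Rightarrow> real \<Rightarrow> 'a" where "Y' p \<equiv> y' p (closing_velocity p)"

text \<open>The gradient of \<open>action\<close> at \<open>p\<close> is the velocity jump \<open>kick p\<close> of the orbit that returns to \<open>p\<close>.\<close>

definition action :: "'a \<Rightarrow> real" where
  "action p = integral {0..1} (\<lambda>t. (norm (Y' p t))\<^sup>2 / 2 + e * G (Y p t - H t))"

lemma continuous_on_G: "continuous_on S G"
  using G unfolding force_potential_def
  by (meson continuous_at_imp_continuous_on has_derivative_continuous)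

lemma action_integrable: "(\<lambda>t. (norm (Y' p t))\<^sup>2 / 2 + e * G (Y p t - H t)) integrable_on {0..1}"
  by (intro integrable_continuous_real continuous_intros continuous_on_y continuous_on_y' contH
      continuous_on_compose2[OF continuous_on_G[of UNIV]]) auto

text \<open>First variation with a one-sided remainder. Integrating the derivative of
  \<open>Y' p t \<bullet> \<eta> t\<close> leaves the boundary term
  \<open>kick p \<bullet> k\<close>, as \<open>\<eta>\<close> equals \<open>k\<close> at both ends.
  The quadratic term of the kinetic energy is a gain, and the potential loses at most
  \<open>force_lip * (norm \<eta>)\<^sup>2\<close> with \<open>norm \<eta> \<le> 4 * norm k\<close>,
  whence 16. A lower bound is what ascent steps call for.\<close>

lemma action_lower_quadratic:
  "action (p + k) \<ge> action p + kick p \<bullet> k - 16 * e * force_lip * (norm k)\<^sup>2"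
proof -
  define \<eta> where "\<eta> t = Y (p + k) t - Y p t" for t
  define \<eta>' where "\<eta>' t = Y' (p + k) t - Y' p t" for t
  define F where "F t = force q d (Y p t - H t)" for t
  have 1: "(\<eta> has_vector_derivative \<eta>' t) (at t within {0..1})" if "t \<in> {0..1}" for t
    unfolding \<eta>_def \<eta>'_def using that by (intro has_vector_derivative_diff der_y)
  have "((\<lambda>t. Y' p t \<bullet> \<eta> t) has_vector_derivative (Y' p t \<bullet> \<eta>' t + e * (F t \<bullet> \<eta> t))) (at t within {0..1})"
    if "t \<in> {0..1}" for t
    using has_derivative_inner[OF der_y'[OF that, unfolded has_vector_derivative_def] 1[OF that, unfolded has_vector_derivative_def]]
    unfolding has_vector_derivative_def
    by (auto elim!: has_derivative_eq_rhs simp: fun_eq_iff algebra_simps F_def)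
  then have "((\<lambda>t. Y' p t \<bullet> \<eta>' t + e * (F t \<bullet> \<eta> t)) has_integral Y' p 1 \<bullet> \<eta> 1 - Y' p 0 \<bullet> \<eta> 0) {0..1}"
    by (intro fundamental_theorem_of_calculus) auto
  moreover have "Y' p 1 \<bullet> \<eta> 1 - Y' p 0 \<bullet> \<eta> 0 = kick p \<bullet> k"
    by (simp add: \<eta>_def closing_velocity kick_def inner_diff_left)
  ultimately have "((\<lambda>t. Y' p t \<bullet> \<eta>' t + e * (F t \<bullet> \<eta> t)) has_integral kick p \<bullet> k) {0..1}" by simp
  from has_integral_diff[OF this has_integral_const_real[of "16 * e * force_lip * (norm k)\<^sup>2" 0 1]]
  have low: "((\<lambda>t. Y' p t \<bullet> \<eta>' t + e * (F t \<bullet> \<eta> t) - 16 * e * force_lip * (norm k)\<^sup>2) has_integral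
      kick p \<bullet> k - 16 * e * force_lip * (norm k)\<^sup>2) {0..1}" by simp
  from has_integral_diff[OF integrable_integral[OF action_integrable[of "p + k"]] integrable_integral[OF action_integrable[of p]]]
  have up: "((\<lambda>t. ((norm (Y' (p + k) t))\<^sup>2 / 2 + e * G (Y (p + k) t - H t)) - ((norm (Y' p t))\<^sup>2 / 2 + e * G (Y p t - H t)))
     has_integral action (p + k) - action p) {0..1}" by (simp add: action_def)
  have "kick p \<bullet> k - 16 * e * force_lip * (norm k)\<^sup>2 \<le> action (p + k) - action p"
  proof (rule has_integral_le[OF low up])
    fix t :: real assume t: "t \<in> {0..1}"
    have "norm (\<eta> t) \<le> 2 * (norm k + norm (closing_velocity (p + k) - closing_velocity p))"
      using flow_difference_bounds(1)[OF t, of "p + k" "closing_velocity (p + k)" p "closing_velocity p"] by (simp add: \<eta>_def)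
    also have "\<dots> \<le> 4 * norm k" using closing_velocity_lipschitz[of "p + k" p] by simp
    finally have "(norm (\<eta> t))\<^sup>2 \<le> (4 * norm k)\<^sup>2" by (intro power_mono) auto
    then have "force_lip * (norm (\<eta> t))\<^sup>2 \<le> force_lip * (16 * (norm k)\<^sup>2)"
      using force_lip_pos by (intro mult_left_mono) (auto simp: power_mult_distrib)
    moreover have "G ((Y p t - H t) + \<eta> t) - G (Y p t - H t) \<ge> F t \<bullet> \<eta> t - force_lip * (norm (\<eta> t))\<^sup>2"
      using force_potential_lower_quadratic[OF G d, of "Y p t - H t" "\<eta> t"] q by (simp add: F_def force_lip_def)
    moreover have "(Y p t - H t) + \<eta> t = Y (p + k) t - H t" by (simp add: \<eta>_def)
    ultimately have "F t \<bullet> \<eta> t - force_lip * (16 * (norm k)\<^sup>2) \<le> G (Y (p + k) t - H t) - G (Y p t - H t)" by simp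
    then have "e * (F t \<bullet> \<eta> t - force_lip * (16 * (norm k)\<^sup>2)) \<le> e * (G (Y (p + k) t - H t) - G (Y p t - H t))"
      using e by (intro mult_left_mono) auto
    then have "e * (F t \<bullet> \<eta> t) - 16 * e * force_lip * (norm k)\<^sup>2 \<le> e * G (Y (p + k) t - H t) - e * G (Y p t - H t)"
      by (simp add: algebra_simps)
    moreover have "(norm (Y' (p + k) t))\<^sup>2 / 2 = (norm (Y' p t))\<^sup>2 / 2 + Y' p t \<bullet> \<eta>' t + (norm (\<eta>' t))\<^sup>2 / 2"
      by (simp add: \<eta>'_def power2_norm_eq_inner inner_diff_left inner_diff_right inner_commute field_simps)
    moreover have "(norm (\<eta>' t))\<^sup>2 / 2 \<ge> 0" by simp
    ultimately show "Y' p t \<bullet> \<eta>' t + e * (F t \<bullet> \<eta> t) - 16 * e * force_lip * (norm k)\<^sup>2 \<le>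
        ((norm (Y' (p + k) t))\<^sup>2 / 2 + e * G (Y (p + k) t - H t)) - ((norm (Y' p t))\<^sup>2 / 2 + e * G (Y p t - H t))"
      by linarith
  qed
  then show ?thesis by simp
qed

text \<open>The lower bound, read once at \<open>p\<close> and once at \<open>x\<close>, bounds the
  difference of the actions from both sides.\<close>

lemma continuous_on_action: "continuous_on S action"
proof -
  have "isCont action p" for p
  proof -
    define b where "b x = e * force_bound * norm (x - p) + 16 * e * force_lip * (norm (x - p))\<^sup>2" for x
    have lim: "(b \<longlongrightarrow> 0) (at p)"
      unfolding b_def[abs_def] by (auto intro!: tendsto_eq_intros)
    have "norm (action x - action p) \<le> b x" for x
    proof -
      have c: "\<bar>kick p' \<bullet> (x' - p')\<bar> \<le> e * force_bound * norm (x' - p')" for p' x'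
        using Cauchy_Schwarz_ineq2[of "kick p'" "x' - p'"] norm_kick_le[of p'] by (meson mult_right_mono norm_ge_zero order_trans)
      show ?thesis
        using action_lower_quadratic[of p "x - p"] action_lower_quadratic[of x "p - x"] c[of p x] c[of x p]
        by (simp add: b_def norm_minus_commute abs_le_iff)
    qed
    then have "((\<lambda>x. action x - action p) \<longlongrightarrow> 0) (at p)"
      by (intro Lim_null_comparison[OF _ lim]) (simp add: always_eventually)
    then show ?thesis by (simp add: isCont_def LIM_zero_iff)
  qed
  then show ?thesis by (simp add: continuous_at_imp_continuous_on)
qed

text \<open>For small \<open>e\<close> the closing orbit nearly rests at \<open>p\<close>: its speed
  and its excursion are at most \<open>2 * b\<close> with \<open>b = e * force_bound\<close>, and
  each contributes \<open>2 * b\<^sup>2\<close>. The error is quadratic in \<open>e\<close>, the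
  averaged potential enters linearly.\<close>

lemma action_approx:
  "\<bar>action p - e * integral {0..1} (\<lambda>t. G (p - H t))\<bar> \<le> 4 * (e * force_bound)\<^sup>2"
proof -
  define b where "b = e * force_bound"
  have b: "b > 0" using e force_bound_pos by (simp add: b_def)
  have int: "(\<lambda>t. G (p - H t)) integrable_on {0..1}"
    by (intro integrable_continuous_real continuous_on_compose2[OF continuous_on_G[of UNIV]] continuous_intros contH) auto
  have hi: "((\<lambda>t. ((norm (Y' p t))\<^sup>2 / 2 + e * G (Y p t - H t)) - e * G (p - H t)) has_integral
      (action p - e * integral {0..1} (\<lambda>t. G (p - H t)))) {0..1}"
    unfolding action_def
    by (intro has_integral_diff integrable_integral action_integrable has_integral_mult_right int)
  have "norm (action p - e * integral {0..1} (\<lambda>t. G (p - H t))) \<le> (4 * b\<^sup>2) * measure lborel {0..1::real}"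
  proof (rule has_integral_bound_real[OF _ finite.emptyI hi])
    fix t :: real assume "t \<in> {0..1} - {}"
    then have t: "t \<in> {0..1}" by simp
    have "norm (Y' p t) \<le> norm (Y' p t - closing_velocity p) + norm (closing_velocity p)" by norm
    then have v: "norm (Y' p t) \<le> 2 * b"
      using velocity_bound[OF t, of p "closing_velocity p"] norm_closing_velocity_le[of p] by (simp add: b_def)
    then have v2: "(norm (Y' p t))\<^sup>2 \<le> (2 * b)\<^sup>2" by (intro power_mono) auto
    have "norm (Y p t - p) \<le> norm (Y p t - p - r) + norm r" for r by norm
    from this[of "t *\<^sub>R closing_velocity p"]
    have "norm (Y p t - p) \<le> norm (Y p t - p - t *\<^sub>R closing_velocity p) + norm (t *\<^sub>R closing_velocity p)" .
    moreover have "norm (t *\<^sub>R closing_velocity p) \<le> norm (closing_velocity p)"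
      using t by (simp add: mult_left_le_one_le)
    ultimately have x: "norm (Y p t - p) \<le> 2 * b"
      using position_bound[OF t, of p "closing_velocity p"] norm_closing_velocity_le[of p] by (simp add: b_def)
    have "\<bar>G (Y p t - H t) - G (p - H t)\<bar> \<le> force_bound * norm ((Y p t - H t) - (p - H t))"
      unfolding force_bound_def by (rule force_potential_lipschitz[OF G d]) (use q in simp)
    also have "\<dots> \<le> force_bound * (2 * b)"
      using x force_bound_pos by (intro mult_left_mono) auto
    finally have "e * \<bar>G (Y p t - H t) - G (p - H t)\<bar> \<le> e * (force_bound * (2 * b))"
      using e by (intro mult_left_mono) auto
    also have "\<dots> = 2 * b\<^sup>2" by (simp add: b_def power2_eq_square)
    finally have "\<bar>e * (G (Y p t - H t) - G (p - H t))\<bar> \<le> 2 * b\<^sup>2" using e by (simp add: abs_mult)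
    then show "norm (((norm (Y' p t))\<^sup>2 / 2 + e * G (Y p t - H t)) - e * G (p - H t)) \<le> 4 * b\<^sup>2"
    proof -
      have "0 \<le> (norm (Y' p t))\<^sup>2 / 2" "(norm (Y' p t))\<^sup>2 / 2 \<le> 2 * b\<^sup>2"
        using v2 by (auto simp: power_mult_distrib)
      moreover have "\<bar>e * G (Y p t - H t) - e * G (p - H t)\<bar> \<le> 2 * b\<^sup>2"
        using \<open>\<bar>e * (G (Y p t - H t) - G (p - H t))\<bar> \<le> 2 * b\<^sup>2\<close> by (simp add: right_diff_distrib)
      ultimately show ?thesis unfolding real_norm_def by linarith
    qed
  qed (use b in auto)
  then show ?thesis by (simp add: b_def)
qed

end

context small_shooting
begin

text \<open>Discrete gradient ascent for the action pushes a superlevel set into a small ball around its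
  unique critical point, so on its frontier \<open>- kick\<close> is homotopic to a translation.\<close>

lemma tube_homotopic:
  fixes J :: "'a \<Rightarrow> 'a"
  assumes D: "open D" and K: "compact K" "K \<subseteq> D"
    and c: "x1 \<in> K" "c < action x1" "\<And>p. p \<in> D \<Longrightarrow> p \<notin> K \<Longrightarrow> action p \<le> c"
    and \<rho>: "e * force_bound < \<rho>"
    and J: "linear J" "\<And>x. x \<bullet> J x = 0" "\<And>x. J x = 0 \<Longrightarrow> x = 0"
  obtains U x0 where "open U" "bounded U" "x0 \<in> U" "closure U \<subseteq> K \<times> cball 0 \<rho>" "displacement x0 = 0"
    "(\<forall>x. fst x \<in> K \<longrightarrow> norm (snd x) \<le> \<rho> \<longrightarrow> displacement x = 0 \<longrightarrow> x = x0) \<longrightarrow>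
      homotopic_with_canon (\<lambda>_. True) (frontier U) (- {0}) displacement (\<lambda>x. x - x0)"
proof -
  define C where "C = 16 * e * force_lip"
  have C: "C > 0" using e force_lip_pos by (simp add: C_def)
  define b where "b = e * force_bound"
  have b: "b > 0" using e force_bound_pos by (simp add: b_def)
  have \<rho>0: "\<rho> > 0" using \<rho> b by (simp add: b_def)
  obtain r where r: "r > 0" "(\<Union>p\<in>K. ball p r) \<subseteq> D"
    using compact_subset_open_imp_ball_epsilon_subset[OF K(1) D K(2)] by blast
  \<comment> \<open>\<open>\<tau> * C \<le> 1 / 2\<close> makes the quadratic loss at most half of
    the linear gain, and \<open>\<tau> * b \<le> r / 2\<close> keeps a step from \<open>K\<close>
    inside \<open>D\<close>.\<close>
  define \<tau> where "\<tau> = min (1 / (2 * C)) (r / (2 * b))"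
  have \<tau>: "\<tau> > 0" using C r b by (simp add: \<tau>_def)
  have "\<tau> \<le> 1 / (2 * C)" "\<tau> \<le> r / (2 * b)" by (auto simp: \<tau>_def)
  then have \<tau>C: "\<tau> * C \<le> 1 / 2" and \<tau>b: "\<tau> * b \<le> r / 2" using C b by (auto simp: field_simps)
  define T where "T s p = p + (s * \<tau>) *\<^sub>R kick p" for s p
  define A where "A = {p \<in> K. c \<le> action p}"
  have step: "T s p \<in> D" "action p + s * \<tau> / 2 * (norm (kick p))\<^sup>2 \<le> action (T s p)"
    if p: "p \<in> K" and s: "s \<in> {0..1}" for s p
  proof -
    have s\<tau>: "0 \<le> s * \<tau>" "s * \<tau> \<le> \<tau>" using s \<tau> by (auto simp: mult_left_le_one_le)
    have "norm ((s * \<tau>) *\<^sub>R kick p) \<le> \<tau> * b"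
      using s\<tau> norm_kick_le[of p] by (auto simp: b_def intro!: mult_mono)
    then have "T s p \<in> ball p r" using \<tau>b r by (simp add: T_def dist_norm)
    then show "T s p \<in> D" using r(2) p by blast
    have "s * \<tau> * C \<le> 1 / 2" using mult_right_mono[OF s\<tau>(2), of C] C \<tau>C by simp
    have "C * (norm ((s * \<tau>) *\<^sub>R kick p))\<^sup>2 = (s * \<tau>) * (s * \<tau> * C) * (norm (kick p))\<^sup>2"
      by (simp add: power_mult_distrib) (simp add: power2_eq_square mult_ac)
    also have "\<dots> \<le> (s * \<tau>) * (1 / 2) * (norm (kick p))\<^sup>2"
      using s\<tau> \<open>s * \<tau> * C \<le> 1 / 2\<close> by (intro mult_right_mono mult_left_mono) auto
    also have "\<dots> = s * \<tau> / 2 * (norm (kick p))\<^sup>2" by simp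
    finally have "C * (norm ((s * \<tau>) *\<^sub>R kick p))\<^sup>2 \<le> s * \<tau> / 2 * (norm (kick p))\<^sup>2" .
    moreover have "kick p \<bullet> ((s * \<tau>) *\<^sub>R kick p) = 2 * (s * \<tau> / 2 * (norm (kick p))\<^sup>2)"
      by (simp add: power2_norm_eq_inner)
    ultimately show "action p + s * \<tau> / 2 * (norm (kick p))\<^sup>2 \<le> action (T s p)"
      using action_lower_quadratic[of p "(s * \<tau>) *\<^sub>R kick p"] unfolding T_def C_def[symmetric] by linarith
  qed
  \<comment> \<open>A step that left \<open>K\<close> would end at a value at most \<open>c\<close>,
    hence would gain nothing; but without a gain the point does not move at all.\<close>
  have stepA: "T s p \<in> A" "action p \<le> action (T s p)" if p: "p \<in> A" and s: "s \<in> {0..1}" for s p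
  proof -
    have p': "p \<in> K" "c \<le> action p" using p by (auto simp: A_def)
    have nn: "0 \<le> s * \<tau> / 2 * (norm (kick p))\<^sup>2" using s \<tau> by simp
    then show le: "action p \<le> action (T s p)" using step(2)[OF p'(1) s] by linarith
    have "T s p \<in> K"
    proof (rule ccontr)
      assume nK: "T s p \<notin> K"
      then have "action (T s p) \<le> c" using c(3) step(1)[OF p'(1) s] by blast
      then have "s * \<tau> / 2 * (norm (kick p))\<^sup>2 = 0" using step(2)[OF p'(1) s] p' nn by linarith
      then have "T s p = p" using \<tau> by (auto simp: T_def)
      then show False using nK p' by simp
    qed
    then show "T s p \<in> A" using le p' by (simp add: A_def)
  qed
  obtain p0 where p0: "p0 \<in> K" "\<And>p. p \<in> K \<Longrightarrow> action p \<le> action p0"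
    using continuous_attains_sup[OF K(1) _ continuous_on_action] c(1) by blast
  have cp0: "c < action p0" using p0(2)[OF c(1)] c(2) by simp
  have critical: "kick p = 0" if p: "p \<in> K" "action p0 \<le> action p" for p
  proof -
    have "action (T 1 p) \<le> action p"
      using p0(2)[of "T 1 p"] c(3)[OF step(1)[OF p(1), of 1]] cp0 p(2) by (cases "T 1 p \<in> K") auto
    then have "\<tau> / 2 * (norm (kick p))\<^sup>2 \<le> 0" using step(2)[OF p(1), of 1] by simp
    then show ?thesis using \<tau> by (simp add: mult_le_0_iff)
  qed
  define x0 where "x0 = (p0, closing_velocity p0)"
  define Op where "Op = {p \<in> D. c < action p}"
  have openO: "open Op"
  proof -
    have "Op = D \<inter> {p. c < action p}" by (auto simp: Op_def)
    then show ?thesis using D by (auto intro!: open_Int open_Collect_less continuous_on_action)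
  qed
  have OK: "Op \<subseteq> K" using c(3) by (force simp: Op_def)
  have p0O: "p0 \<in> Op" using p0 K(2) cp0 by (auto simp: Op_def)
  have "A = K \<inter> {p. c \<le> action p}" by (auto simp: A_def)
  then have compA: "compact A"
    using K(1) by (simp add: compact_Int_closed closed_Collect_le continuous_on_action)
  have clA: "closure Op \<subseteq> A"
    using OK compA by (intro closure_minimal) (auto simp: A_def Op_def compact_imp_closed)
  define U where "U = Op \<times> ball (0::'a) \<rho>"
  have X: "fst x \<in> closure Op" "norm (snd x) \<le> \<rho>" "fst x \<in> frontier Op \<or> norm (snd x) = \<rho>" if "x \<in> frontier U" for x
    using that \<rho>0 openO by (auto simp: U_def frontier_def closure_Times interior_Times)
  show ?thesis
  proof (rule that[of U x0, OF _ _ _ _ _ impI])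
    show "open U" unfolding U_def by (intro open_Times openO) auto
    show "bounded U" unfolding U_def
      using OK K(1) by (intro bounded_Times) (auto intro: bounded_subset compact_imp_bounded)
    show "x0 \<in> U"
      using p0O \<rho> norm_closing_velocity_le[of p0] by (simp add: U_def x0_def)
    show "closure U \<subseteq> K \<times> cball 0 \<rho>"
      using clA \<rho>0 by (auto simp: U_def closure_Times A_def)
    show "displacement x0 = 0"
      unfolding x0_def displacement_eq_0_iff_kick using critical p0 by simp
    assume uniq: "\<forall>x. fst x \<in> K \<longrightarrow> norm (snd x) \<le> \<rho> \<longrightarrow> displacement x = 0 \<longrightarrow> x = x0"
    have zero: "p = p0" if "p \<in> K" "kick p = 0" for p
      using uniq[rule_format, of "(p, closing_velocity p)"] that norm_closing_velocity_le[of p] \<rho>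
      by (simp add: displacement_eq_0_iff_kick x0_def)
    have frA: "p \<in> A" "p \<noteq> p0" "kick p \<noteq> 0" if "p \<in> frontier Op" for p
    proof -
      show "p \<in> A" "p \<noteq> p0" using that clA openO p0O by (auto simp: frontier_def interior_open)
      then show "kick p \<noteq> 0" using zero by (auto simp: A_def)
    qed
    obtain r0 where r0: "r0 > 0" "ball p0 r0 \<subseteq> Op" using openO p0O openE by blast
    \<comment> \<open>By compactness and uniqueness of the maximum, the points of \<open>A\<close>
      above some level \<open>m\<close> lie in the ball around \<open>p0\<close>.\<close>
    obtain m where m: "\<And>p. p \<in> A \<Longrightarrow> m < action p \<Longrightarrow> p \<in> ball p0 r0" "m < action p0"
    proof (cases "A - ball p0 r0 = {}")
      case True
      then have "A \<subseteq> ball p0 r0" by blast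
      then show ?thesis using that[of c] cp0 by blast
    next
      case False
      have "compact (A - ball p0 r0)" using compA by (intro compact_diff) auto
      then obtain p where p: "p \<in> A - ball p0 r0" "\<And>p'. p' \<in> A - ball p0 r0 \<Longrightarrow> action p' \<le> action p"
        using continuous_attains_sup[OF _ False continuous_on_action] by blast
      have "action p < action p0"
      proof (rule ccontr)
        assume "\<not> ?thesis"
        then have "p = p0" using zero[of p] critical[of p] p(1) by (auto simp: A_def)
        then show False using p(1) r0 by simp
      qed
      moreover have "p' \<in> ball p0 r0" if "p' \<in> A" "action p < action p'" for p'
        using p(2)[of p'] that by (cases "p' \<in> ball p0 r0") auto
      ultimately show ?thesis using that[of "action p"] by blast
    qed
    \<comment> \<open>Up to level \<open>m\<close> the gradient is bounded away from 0, so each step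
      there gains at least \<open>\<tau> / 2 * \<beta>\<close>; after finitely many steps all of
      \<open>A\<close> has moved into the ball.\<close>
    obtain \<beta> where \<beta>: "\<beta> > 0" "\<And>p. p \<in> A \<Longrightarrow> action p \<le> m \<Longrightarrow> \<beta> \<le> (norm (kick p))\<^sup>2"
    proof (cases "A \<inter> {p. action p \<le> m} = {}")
      case True
      then show ?thesis using that[of 1] by auto
    next
      case False
      have "compact (A \<inter> {p. action p \<le> m})"
        using compA by (intro compact_Int_closed closed_Collect_le continuous_on_action continuous_on_const)
      moreover have "continuous_on (A \<inter> {p. action p \<le> m}) (\<lambda>p. (norm (kick p))\<^sup>2)"
        by (intro continuous_intros continuous_on_kick)
      ultimately obtain p where p: "p \<in> A \<inter> {p. action p \<le> m}"
          "\<And>p'. p' \<in> A \<inter> {p. action p \<le> m} \<Longrightarrow> (norm (kick p))\<^sup>2 \<le> (norm (kick p'))\<^sup>2"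
        using continuous_attains_inf[OF _ False, of "\<lambda>p. (norm (kick p))\<^sup>2"] by blast
      have "kick p \<noteq> 0" using zero[of p] p(1) m(2) by (auto simp: A_def)
      then show ?thesis using that[of "(norm (kick p))\<^sup>2"] p(2) by auto
    qed
    define it where "it n = (T 1 ^^ n)" for n :: nat
    have it_Suc: "it (Suc n) p = T 1 (it n p)" for n p by (simp add: it_def)
    have itA: "it n p \<in> A" if "p \<in> A" for n p
      using that by (induction n) (auto simp: it_Suc stepA, simp add: it_def)
    have it_mono: "action (it n p) \<le> action (it (Suc n) p)" if "p \<in> A" for n p
      using stepA(2)[OF itA[OF that], of 1] by (simp add: it_Suc)
    have it_low: "m < action (it n p) \<or> c + real n * (\<tau> / 2 * \<beta>) \<le> action (it n p)" if p: "p \<in> A" for n p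
    proof (induction n)
      case 0
      then show ?case using p by (simp add: it_def A_def)
    next
      case (Suc n)
      show ?case
      proof (cases "m < action (it n p)")
        case True
        then show ?thesis using it_mono[OF p, of n] by linarith
      next
        case False
        then have "c + real n * (\<tau> / 2 * \<beta>) \<le> action (it n p)" using Suc by simp
        moreover have "\<tau> / 2 * \<beta> \<le> \<tau> / 2 * (norm (kick (it n p)))\<^sup>2"
          using \<beta>(2)[OF itA[OF p]] False \<tau> by (intro mult_left_mono) auto
        moreover have "it n p \<in> K" using itA[OF p] by (simp add: A_def)
        then have "action (it n p) + \<tau> / 2 * (norm (kick (it n p)))\<^sup>2 \<le> action (it (Suc n) p)"
          using step(2)[of "it n p" 1] by (simp add: it_Suc)
        ultimately have "c + (real n * (\<tau> / 2 * \<beta>) + \<tau> / 2 * \<beta>) \<le> action (it (Suc n) p)" by linarith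
        then show ?thesis by (simp only: of_nat_Suc distrib_right mult_1 add.commute simp_thms)
      qed
    qed
    have "\<tau> / 2 * \<beta> > 0" using \<tau> \<beta> by simp
    then obtain N where "m - c < real N * (\<tau> / 2 * \<beta>)"
      using reals_Archimedean3 by blast
    then have itN: "it N p \<in> ball p0 r0" if "p \<in> A" for p
      using it_low[OF that, of N] m(1)[OF itA[OF that, of N]] by linarith
    have contT: "continuous_on UNIV (T 1)"
      unfolding T_def[abs_def] by (intro continuous_intros continuous_on_kick)
    have contit: "continuous_on UNIV (it n)" for n
    proof (induction n)
      case (Suc n)
      then show ?case unfolding it_Suc[abs_def] by (intro continuous_on_compose2[OF contT]) auto
    qed (simp add: it_def id_def)
    \<comment> \<open>In each homotopy below, a vanishing second component forces the velocity to be
      shorter than \<open>\<rho>\<close>, so the position lies on the frontier of the superlevel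
      set, where \<open>kick p \<noteq> 0\<close> and \<open>p \<noteq> p0\<close>. Only the first
      component then has to be controlled.\<close>
    define hom where "hom f g \<longleftrightarrow> homotopic_with_canon (\<lambda>_. True) (frontier U) (- {0::'a \<times> 'a}) f g" for f g
    have trans: "hom f g \<Longrightarrow> hom g h \<Longrightarrow> hom f h" for f g h
      unfolding hom_def by (rule homotopic_with_trans)
    have lin: "hom (\<lambda>x. (g (fst x), snd x)) (\<lambda>x. (g' (fst x), snd x))"
      if g: "continuous_on UNIV g" "continuous_on UNIV g'"
        and nz: "\<And>p s. p \<in> frontier Op \<Longrightarrow> s \<in> {0..1} \<Longrightarrow> (1 - s) *\<^sub>R g p + s *\<^sub>R g' p \<noteq> 0" for g g'
      unfolding hom_def
    proof (rule homotopic_linear_nonzero)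
      fix x s assume x: "x \<in> frontier U" and s: "s \<in> {0..1::real}"
      show "(1 - s) *\<^sub>R (g (fst x), snd x) + s *\<^sub>R (g' (fst x), snd x) \<noteq> 0"
      proof
        assume "(1 - s) *\<^sub>R (g (fst x), snd x) + s *\<^sub>R (g' (fst x), snd x) = 0"
        then have 1: "(1 - s) *\<^sub>R g (fst x) + s *\<^sub>R g' (fst x) = 0" and 2: "(1 - s) *\<^sub>R snd x + s *\<^sub>R snd x = 0"
          by (auto simp: zero_prod_def)
        then have "snd x = 0" by (simp add: scaleR_add_left[symmetric])
        then have "fst x \<in> frontier Op" using X[OF x] \<rho>0 by simp
        then show False using nz s 1 by blast
      qed
    qed (auto intro!: continuous_intros continuous_on_compose2[OF g(1)] continuous_on_compose2[OF g(2)])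
    have h1: "hom displacement (\<lambda>x. (kick (fst x), snd (displacement x)))"
      unfolding hom_def
    proof (rule homotopic_linear_nonzero)
      fix x s assume x: "x \<in> frontier U" and s: "s \<in> {0..1::real}"
      obtain p v where pv: "x = (p, v)" by (cases x)
      show "(1 - s) *\<^sub>R displacement x + s *\<^sub>R (kick (fst x), snd (displacement x)) \<noteq> 0"
      proof
        assume *: "(1 - s) *\<^sub>R displacement x + s *\<^sub>R (kick (fst x), snd (displacement x)) = 0"
        then have "(1 - s) *\<^sub>R (y p v 1 - p) + s *\<^sub>R (y p v 1 - p) = 0"
          by (auto simp: pv displacement_def zero_prod_def)
        then have "y p v 1 = p" by (simp add: scaleR_add_left[symmetric])
        then have v: "v = closing_velocity p" by (rule closing_velocity_unique)
        then have "(1 - s) *\<^sub>R kick p + s *\<^sub>R kick p = 0"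
          using * by (auto simp: pv displacement_def zero_prod_def kick_def)
        then have "kick p = 0" by (simp add: scaleR_add_left[symmetric])
        moreover have "p \<in> frontier Op"
          using X[OF x] v norm_closing_velocity_le[of p] \<rho> by (auto simp: pv)
        ultimately show False using frA(3) by blast
      qed
    qed (auto intro!: continuous_intros continuous_on_displacement continuous_on_compose2[OF continuous_on_kick[of UNIV]])
    \<comment> \<open>\<open>y p v 1 - p\<close> differs from \<open>v - closing_velocity p\<close>
      by at most half the norm of the latter.\<close>
    have h2: "hom (\<lambda>x. (kick (fst x), snd (displacement x))) (\<lambda>x. (kick (fst x), snd x - closing_velocity (fst x)))"
      unfolding hom_def
    proof (rule homotopic_linear_nonzero)
      fix x s assume x: "x \<in> frontier U" and s: "s \<in> {0..1::real}"
      obtain p v where pv: "x = (p, v)" by (cases x)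
      define \<zeta> where "\<zeta> = v - closing_velocity p"
      show "(1 - s) *\<^sub>R (kick (fst x), snd (displacement x)) + s *\<^sub>R (kick (fst x), snd x - closing_velocity (fst x)) \<noteq> 0"
      proof
        assume "(1 - s) *\<^sub>R (kick (fst x), snd (displacement x)) + s *\<^sub>R (kick (fst x), snd x - closing_velocity (fst x)) = 0"
        then have 1: "(1 - s) *\<^sub>R kick p + s *\<^sub>R kick p = 0"
          and 2: "(1 - s) *\<^sub>R (y p v 1 - p) + s *\<^sub>R \<zeta> = 0"
          by (auto simp: pv displacement_def zero_prod_def \<zeta>_def)
        have "norm (y p v 1 - p - \<zeta>) \<le> norm \<zeta> / 2"
          using flow_difference_bounds(2)[of 1 p v p "closing_velocity p"] by (simp add: closing_velocity \<zeta>_def)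
        then have "(1 - s) * norm (y p v 1 - p - \<zeta>) \<le> 1 * (norm \<zeta> / 2)"
          using s by (intro mult_mono) auto
        moreover have "\<zeta> = - ((1 - s) *\<^sub>R (y p v 1 - p - \<zeta>))"
          using 2 by (simp add: algebra_simps add_eq_0_iff)
        then have "norm \<zeta> = (1 - s) * norm (y p v 1 - p - \<zeta>)"
          using s by (metis abs_of_nonneg atLeastAtMost_iff diff_ge_0_iff_ge norm_minus_cancel norm_scaleR)
        ultimately have "norm \<zeta> \<le> norm \<zeta> / 2" by linarith
        then have "\<zeta> = 0" by simp
        then have "p \<in> frontier Op"
          using X[OF x] norm_closing_velocity_le[of p] \<rho> by (auto simp: pv \<zeta>_def)
        moreover have "kick p = 0" using 1 by (simp add: scaleR_add_left[symmetric])
        ultimately show False using frA(3) by blast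
      qed
    qed (auto intro!: continuous_intros continuous_on_displacement continuous_on_compose2[OF continuous_on_kick[of UNIV]]
        continuous_on_compose2[OF continuous_on_closing_velocity[of UNIV]])
    have h3: "hom (\<lambda>x. (kick (fst x), snd x - closing_velocity (fst x))) (\<lambda>x. (kick (fst x), snd x))"
      unfolding hom_def
    proof (rule homotopic_linear_nonzero)
      fix x s assume x: "x \<in> frontier U" and s: "s \<in> {0..1::real}"
      obtain p v where pv: "x = (p, v)" by (cases x)
      show "(1 - s) *\<^sub>R (kick (fst x), snd x - closing_velocity (fst x)) + s *\<^sub>R (kick (fst x), snd x) \<noteq> 0"
      proof
        assume "(1 - s) *\<^sub>R (kick (fst x), snd x - closing_velocity (fst x)) + s *\<^sub>R (kick (fst x), snd x) = 0"
        then have 1: "(1 - s) *\<^sub>R kick p + s *\<^sub>R kick p = 0"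
          and 2: "(1 - s) *\<^sub>R (v - closing_velocity p) + s *\<^sub>R v = 0"
          by (auto simp: pv zero_prod_def)
        have "v = (1 - s) *\<^sub>R closing_velocity p" using 2 by (simp add: algebra_simps)
        then have "norm v \<le> 1 * norm (closing_velocity p)" using s by (auto intro!: mult_left_le_one_le)
        then have "p \<in> frontier Op"
          using X[OF x] norm_closing_velocity_le[of p] \<rho> by (auto simp: pv)
        moreover have "kick p = 0" using 1 by (simp add: scaleR_add_left[symmetric])
        ultimately show False using frA(3) by blast
      qed
    qed (auto intro!: continuous_intros continuous_on_compose2[OF continuous_on_kick[of UNIV]]
        continuous_on_compose2[OF continuous_on_closing_velocity[of UNIV]])
    have h4: "hom (\<lambda>x. (kick (fst x), snd x)) (\<lambda>x. (it (Suc 0) (fst x) - fst x, snd x))"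
    proof (rule lin)
      fix p s assume p: "p \<in> frontier Op" and s: "s \<in> {0..1::real}"
      have "(1 - s) + s * \<tau> > 0" using s \<tau> by (cases "s = 1") (auto intro: add_pos_nonneg)
      moreover have "(1 - s) *\<^sub>R kick p + s *\<^sub>R (it (Suc 0) p - p) = ((1 - s) + s * \<tau>) *\<^sub>R kick p"
        by (simp add: it_def T_def scaleR_add_left)
      ultimately show "(1 - s) *\<^sub>R kick p + s *\<^sub>R (it (Suc 0) p - p) \<noteq> 0" using frA(3)[OF p] by simp
    qed (intro continuous_intros continuous_on_kick contit)+
    \<comment> \<open>The first step strictly raises the action and later steps, even partial ones,
      never lower it, so the interpolated iterate does not come back to \<open>p\<close>.\<close>
    have h5: "hom (\<lambda>x. (it (Suc 0) (fst x) - fst x, snd x)) (\<lambda>x. (it (Suc n) (fst x) - fst x, snd x))" for n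
    proof (induction n)
      case 0
      show ?case
      proof (rule lin)
        fix p s assume p: "p \<in> frontier Op"
        have "(1 - s) *\<^sub>R (it (Suc 0) p - p) + s *\<^sub>R (it (Suc 0) p - p) = it (Suc 0) p - p"
          by (simp only: scaleR_add_left[symmetric]) simp
        also have "\<dots> = \<tau> *\<^sub>R kick p" by (simp add: it_def T_def)
        finally show "(1 - s) *\<^sub>R (it (Suc 0) p - p) + s *\<^sub>R (it (Suc 0) p - p) \<noteq> 0"
          using \<tau> frA(3)[OF p] by (simp only: scaleR_eq_0_iff) simp
      qed (intro continuous_intros contit)+
    next
      case (Suc n)
      have "hom (\<lambda>x. (it (Suc n) (fst x) - fst x, snd x)) (\<lambda>x. (it (Suc (Suc n)) (fst x) - fst x, snd x))"
      proof (rule lin)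
        fix p s assume p: "p \<in> frontier Op" and s: "s \<in> {0..1::real}"
        have pA: "p \<in> A" "p \<in> K" using frA(1)[OF p] by (auto simp: A_def)
        have "action p + \<tau> / 2 * (norm (kick p))\<^sup>2 \<le> action (it (Suc 0) p)"
          using step(2)[OF pA(2), of 1] by (simp add: it_def)
        moreover have "\<tau> / 2 * (norm (kick p))\<^sup>2 > 0" using \<tau> frA(3)[OF p] by simp
        moreover have "action (it (Suc 0) p) \<le> action (it (Suc n) p)"
          by (induction n) (use it_mono[OF pA(1)] in \<open>auto intro: order_trans\<close>)
        moreover have "action (it (Suc n) p) \<le> action (T s (it (Suc n) p))"
          using stepA(2)[OF itA[OF pA(1)] s] .
        ultimately have "T s (it (Suc n) p) \<noteq> p" by auto
        moreover have "(1 - s) *\<^sub>R (it (Suc n) p - p) + s *\<^sub>R (it (Suc (Suc n)) p - p) = T s (it (Suc n) p) - p"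
          unfolding it_Suc[of "Suc n"] by (simp add: T_def algebra_simps)
        ultimately show "(1 - s) *\<^sub>R (it (Suc n) p - p) + s *\<^sub>R (it (Suc (Suc n)) p - p) \<noteq> 0" by simp
      qed (intro continuous_intros contit)+
      then show ?case using Suc trans by blast
    qed
    \<comment> \<open>The segment from the iterate to \<open>p0\<close> stays in a ball around
      \<open>p0\<close> that does not contain \<open>p\<close>.\<close>
    have h6: "hom (\<lambda>x. (it (Suc N) (fst x) - fst x, snd x)) (\<lambda>x. (p0 - fst x, snd x))"
    proof (rule lin)
      fix p s assume p: "p \<in> frontier Op" and s: "s \<in> {0..1::real}"
      have "it (Suc N) p = it N (T 1 p)" by (simp add: it_def funpow_swap1)
      then have "it (Suc N) p \<in> ball p0 r0"
        using itN[OF stepA(1)[OF frA(1)[OF p], of 1]] by simp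
      then have "norm (s *\<^sub>R (p0 - p) + (1 - s) *\<^sub>R (it (Suc N) p - p) - (p0 - p)) < r0"
      proof -
        assume a: "it (Suc N) p \<in> ball p0 r0"
        have "s *\<^sub>R (p0 - p) + (1 - s) *\<^sub>R (it (Suc N) p - p) - (p0 - p) = (1 - s) *\<^sub>R (it (Suc N) p - p0)"
          by (simp add: algebra_simps)
        then have "norm (s *\<^sub>R (p0 - p) + (1 - s) *\<^sub>R (it (Suc N) p - p) - (p0 - p)) \<le> 1 * norm (it (Suc N) p - p0)"
          using s by (auto intro!: mult_left_le_one_le)
        then show ?thesis using a by (simp add: dist_norm norm_minus_commute)
      qed
      moreover have "p \<notin> ball p0 r0" using p r0(2) openO by (auto simp: frontier_def interior_open)
      then have "r0 \<le> norm (0 - (p0 - p))" by (simp add: dist_norm norm_minus_commute)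
      ultimately show "(1 - s) *\<^sub>R (it (Suc N) p - p) + s *\<^sub>R (p0 - p) \<noteq> 0"
        by (auto simp: add.commute)
    qed (intro continuous_intros contit)+
    have contJ: "continuous_on UNIV (\<lambda>p. J (p - p0))"
      using J(1) by (intro continuous_on_compose2[OF linear_continuous_on[of J UNIV]] continuous_intros)
        (auto simp: linear_conv_bounded_linear)
    \<comment> \<open>\<open>p0 - p\<close> is turned into \<open>p - p0\<close> by way of
      \<open>J\<close>: nonzero orthogonal vectors are never opposite, so both straight line
      homotopies avoid 0. An injective skew \<open>J\<close> exists in the plane, but in no odd
      dimension.\<close>
    have h7: "hom (\<lambda>x. (p0 - fst x, snd x)) (\<lambda>x. (J (fst x - p0), snd x))"
    proof (rule lin)
      fix p s assume p: "p \<in> frontier Op" and s: "s \<in> {0..1::real}"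
      show "(1 - s) *\<^sub>R (p0 - p) + s *\<^sub>R J (p - p0) \<noteq> 0"
      proof
        assume *: "(1 - s) *\<^sub>R (p0 - p) + s *\<^sub>R J (p - p0) = 0"
        have "(p - p0) \<bullet> ((1 - s) *\<^sub>R (p0 - p) + s *\<^sub>R J (p - p0)) = (1 - s) * ((p - p0) \<bullet> (p0 - p))"
          using J(2) by (simp add: inner_add_right)
        then have "(1 - s) * ((p - p0) \<bullet> (p0 - p)) = 0" using * by simp
        moreover have "(p - p0) \<bullet> (p0 - p) = - ((p - p0) \<bullet> (p - p0))"
          by (metis inner_minus_right minus_diff_eq)
        ultimately have "s = 1" using frA(2)[OF p] by simp
        then show False using * J(3) frA(2)[OF p] by force
      qed
    qed (intro continuous_intros contJ)+
    have h8: "hom (\<lambda>x. (J (fst x - p0), snd x)) (\<lambda>x. (fst x - p0, snd x))"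
    proof (rule lin)
      fix p s assume p: "p \<in> frontier Op" and s: "s \<in> {0..1::real}"
      show "(1 - s) *\<^sub>R J (p - p0) + s *\<^sub>R (p - p0) \<noteq> 0"
      proof
        assume *: "(1 - s) *\<^sub>R J (p - p0) + s *\<^sub>R (p - p0) = 0"
        have "(p - p0) \<bullet> ((1 - s) *\<^sub>R J (p - p0) + s *\<^sub>R (p - p0)) = s * ((p - p0) \<bullet> (p - p0))"
          using J(2) by (simp add: inner_add_right)
        then have "s = 0" using * frA(2)[OF p] by simp
        then show False using * J(3) frA(2)[OF p] by force
      qed
    qed (intro continuous_intros contJ)+
    have h9: "hom (\<lambda>x. (fst x - p0, snd x)) (\<lambda>x. x - x0)"
      unfolding hom_def
    proof (rule homotopic_linear_nonzero)
      fix x s assume x: "x \<in> frontier U" and s: "s \<in> {0..1::real}"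
      obtain p v where pv: "x = (p, v)" by (cases x)
      show "(1 - s) *\<^sub>R (fst x - p0, snd x) + s *\<^sub>R (x - x0) \<noteq> 0"
      proof
        assume "(1 - s) *\<^sub>R (fst x - p0, snd x) + s *\<^sub>R (x - x0) = 0"
        then have 1: "(1 - s) *\<^sub>R (p - p0) + s *\<^sub>R (p - p0) = 0"
          and 2: "(1 - s) *\<^sub>R v + s *\<^sub>R (v - closing_velocity p0) = 0"
          by (auto simp: pv zero_prod_def x0_def)
        have "v = s *\<^sub>R closing_velocity p0" using 2 by (simp add: algebra_simps)
        then have "norm v \<le> 1 * norm (closing_velocity p0)" using s by (auto intro!: mult_left_le_one_le)
        then have "p \<in> frontier Op"
          using X[OF x] norm_closing_velocity_le[of p0] \<rho> by (auto simp: pv)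
        moreover have "p = p0" using 1 by (simp add: scaleR_add_left[symmetric])
        ultimately show False using frA(2) by blast
      qed
    qed (intro continuous_intros)+
    have "hom displacement (\<lambda>x. x - x0)"
      by (intro trans[OF h1] trans[OF h2] trans[OF h3] trans[OF h4] trans[OF h5[of N]] trans[OF h6] trans[OF h7] trans[OF h8] h9)
    then show "homotopic_with_canon (\<lambda>_. True) (frontier U) (- {0}) displacement (\<lambda>x. x - x0)"
      by (simp add: hom_def)
  qed
qed

end

section \<open>Bounded components of the complement of the curve\<close>

text \<open>This is where the strong force condition \<open>q \<ge> 2\<close> enters.\<close>

lemma potential_blowup:
  fixes H :: "real \<Rightarrow> 'a::euclidean_space"
  assumes q: "q \<ge> 2" and \<Lambda>: "\<Lambda> \<ge> 1"
    and lip: "\<And>s t. s \<in> {0..1} \<Longrightarrow> t \<in> {0..1} \<Longrightarrow> norm (H t - H s) \<le> \<Lambda> * \<bar>t - s\<bar>"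
    and x: "x \<notin> H ` {0..1}" and t1: "t1 \<in> {0..1}" "norm (x - H t1) \<le> \<eta>" and \<eta>: "0 < \<eta>" "\<eta> \<le> 1 / 2"
  shows "ln (1 + 1 / (2 * \<eta>)) / \<Lambda> \<le> integral {0..1} (\<lambda>t. norm (x - H t) powr (1 - q))"
proof -
  define f where "f t = norm (x - H t) powr (1 - q)" for t
  \<comment> \<open>Within time \<open>\<tau>\<close> of \<open>t1\<close> the distance from
    \<open>x\<close> to \<open>H t\<close> is at most \<open>\<eta> + 1 / 2 \<le> 1\<close>, where
    \<open>r powr (1 - q) \<ge> 1 / r\<close>; and \<open>\<tau> \<le> 1 / 2\<close> lets a window
    on one side of \<open>t1\<close> fit into [0,1].\<close>
  define \<tau> where "\<tau> = 1 / (2 * \<Lambda>)"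
  have \<tau>: "0 < \<tau>" "\<tau> \<le> 1 / 2" "\<Lambda> * \<tau> = 1 / 2" using \<Lambda> by (auto simp: \<tau>_def field_simps)
  have contH: "continuous_on {0..1} H"
    using lip \<Lambda> by (intro lipschitz_on_continuous_on[of \<Lambda>]) (auto simp: lipschitz_on_def dist_norm norm_minus_commute abs_minus_commute)
  have nz: "norm (x - H t) > 0" if "t \<in> {0..1}" for t using x that by auto
  have contf: "continuous_on {0..1} f"
    unfolding f_def[abs_def] using nz by (intro continuous_intros contH) fastforce
  have low: "1 / (\<eta> + \<Lambda> * \<bar>t - t1\<bar>) \<le> f t" if t: "t \<in> {0..1}" "\<bar>t - t1\<bar> \<le> \<tau>" for t
  proof -
    have "norm (x - H t) \<le> norm (x - H t1) + norm (H t1 - H t)" by norm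
    also have "\<dots> \<le> \<eta> + \<Lambda> * \<bar>t - t1\<bar>" using t1 lip[OF t(1) t1(1)] by (simp add: abs_minus_commute)
    finally have a: "norm (x - H t) \<le> \<eta> + \<Lambda> * \<bar>t - t1\<bar>" .
    have "\<Lambda> * \<bar>t - t1\<bar> \<le> \<Lambda> * \<tau>" using t(2) \<Lambda> by (intro mult_left_mono) auto
    then have a1: "norm (x - H t) \<le> 1" using a \<eta> \<tau> by linarith
    have "1 / (\<eta> + \<Lambda> * \<bar>t - t1\<bar>) \<le> 1 / norm (x - H t)"
      using a nz[OF t(1)] by (intro frac_le) auto
    also have "\<dots> = norm (x - H t) powr (- 1)" using nz[OF t(1)] by (simp add: powr_minus_divide)
    also have "\<dots> \<le> norm (x - H t) powr (1 - q)" using nz[OF t(1)] a1 q by (intro powr_mono') auto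
    finally show ?thesis by (simp add: f_def)
  qed
  \<comment> \<open>Up to the factor \<open>1 / \<Lambda>\<close> this is the integral of
    \<open>1 / (\<eta> + \<Lambda> * \<bar>t - t1\<bar>)\<close> over the window. For
    \<open>q = 2\<close> the comparison with \<open>1 / r\<close> is an equality, the borderline
    case in which the bound still diverges as \<open>\<eta>\<close> tends to 0.\<close>
  have ln: "ln (\<eta> + \<Lambda> * \<tau>) - ln \<eta> = ln (1 + 1 / (2 * \<eta>))"
  proof -
    have "ln (\<eta> + \<Lambda> * \<tau>) - ln \<eta> = ln ((\<eta> + \<Lambda> * \<tau>) / \<eta>)"
      using \<eta> \<tau> by (intro ln_divide_pos[symmetric]) auto
    also have "(\<eta> + \<Lambda> * \<tau>) / \<eta> = 1 + 1 / (2 * \<eta>)" using \<eta> unfolding \<tau>(3) by (simp add: field_simps)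
    finally show ?thesis .
  qed
  have part: "ln (1 + 1 / (2 * \<eta>)) / \<Lambda> \<le> integral {0..1} f"
    if ab: "{a..b} \<subseteq> {0..1}" "a \<le> b" "\<And>t. t \<in> {a..b} \<Longrightarrow> \<bar>t - t1\<bar> \<le> \<tau>"
      and g: "((\<lambda>t. 1 / (\<eta> + \<Lambda> * \<bar>t - t1\<bar>)) has_integral ln (1 + 1 / (2 * \<eta>)) / \<Lambda>) {a..b}" for a b
  proof -
    have int: "f integrable_on {0..1}" "f integrable_on {a..b}"
      using ab(1) by (auto intro!: integrable_continuous_real continuous_on_subset[OF contf])
    have "ln (1 + 1 / (2 * \<eta>)) / \<Lambda> \<le> integral {a..b} f"
      by (rule has_integral_le[OF g integrable_integral[OF int(2)]]) (use low ab in blast)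
    also have "\<dots> \<le> integral {0..1} f"
      using int ab(1) by (intro integral_subset_le) (auto simp: f_def)
    finally show ?thesis .
  qed
  have "ln (1 + 1 / (2 * \<eta>)) / \<Lambda> \<le> integral {0..1} f"
  proof (cases "t1 \<le> 1 / 2")
    case True
    show ?thesis
    proof (rule part[of t1 "t1 + \<tau>"])
      have "((\<lambda>t. 1 / (\<eta> + \<Lambda> * (t - t1))) has_integral
          ln (\<eta> + \<Lambda> * (t1 + \<tau> - t1)) / \<Lambda> - ln (\<eta> + \<Lambda> * (t1 - t1)) / \<Lambda>) {t1..t1 + \<tau>}"
      proof (rule fundamental_theorem_of_calculus)
        fix t assume "t \<in> {t1..t1 + \<tau>}"
        then have "\<eta> + \<Lambda> * (t - t1) > 0" using \<eta> \<Lambda> by (intro add_pos_nonneg) auto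
        then have "((\<lambda>t. ln (\<eta> + \<Lambda> * (t - t1))) has_real_derivative \<Lambda> / (\<eta> + \<Lambda> * (t - t1))) (at t within {t1..t1 + \<tau>})"
          by (auto intro!: derivative_eq_intros simp: divide_inverse)
        from DERIV_cdivide[OF this, of \<Lambda>]
        have "((\<lambda>t. ln (\<eta> + \<Lambda> * (t - t1)) / \<Lambda>) has_real_derivative 1 / (\<eta> + \<Lambda> * (t - t1))) (at t within {t1..t1 + \<tau>})"
          using \<Lambda> by simp
        then show "((\<lambda>t. ln (\<eta> + \<Lambda> * (t - t1)) / \<Lambda>) has_vector_derivative 1 / (\<eta> + \<Lambda> * (t - t1))) (at t within {t1..t1 + \<tau>})"
          by (simp add: has_real_derivative_iff_has_vector_derivative)
      qed (use \<tau> in auto)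
      moreover have "ln (\<eta> + \<Lambda> * (t1 + \<tau> - t1)) / \<Lambda> - ln (\<eta> + \<Lambda> * (t1 - t1)) / \<Lambda> = ln (1 + 1 / (2 * \<eta>)) / \<Lambda>"
        using ln by (simp add: diff_divide_distrib[symmetric])
      ultimately have "((\<lambda>t. 1 / (\<eta> + \<Lambda> * (t - t1))) has_integral ln (1 + 1 / (2 * \<eta>)) / \<Lambda>) {t1..t1 + \<tau>}" by simp
      then show "((\<lambda>t. 1 / (\<eta> + \<Lambda> * \<bar>t - t1\<bar>)) has_integral ln (1 + 1 / (2 * \<eta>)) / \<Lambda>) {t1..t1 + \<tau>}"
        by (rule has_integral_eq[rotated]) auto
    qed (use t1 \<tau> True in auto)
  next
    case False
    show ?thesis
    proof (rule part[of "t1 - \<tau>" t1])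
      have "((\<lambda>t. 1 / (\<eta> + \<Lambda> * (t1 - t))) has_integral
          - (ln (\<eta> + \<Lambda> * (t1 - t1)) / \<Lambda>) - - (ln (\<eta> + \<Lambda> * (t1 - (t1 - \<tau>))) / \<Lambda>)) {t1 - \<tau>..t1}"
      proof (rule fundamental_theorem_of_calculus)
        fix t assume "t \<in> {t1 - \<tau>..t1}"
        then have "\<eta> + \<Lambda> * (t1 - t) > 0" using \<eta> \<Lambda> by (intro add_pos_nonneg) auto
        then have "((\<lambda>t. ln (\<eta> + \<Lambda> * (t1 - t))) has_real_derivative - \<Lambda> / (\<eta> + \<Lambda> * (t1 - t))) (at t within {t1 - \<tau>..t1})"
          by (auto intro!: derivative_eq_intros simp: divide_inverse)
        from DERIV_minus[OF DERIV_cdivide[OF this, of \<Lambda>]]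
        have "((\<lambda>t. - (ln (\<eta> + \<Lambda> * (t1 - t)) / \<Lambda>)) has_real_derivative 1 / (\<eta> + \<Lambda> * (t1 - t))) (at t within {t1 - \<tau>..t1})"
          using \<Lambda> by simp
        then show "((\<lambda>t. - (ln (\<eta> + \<Lambda> * (t1 - t)) / \<Lambda>)) has_vector_derivative 1 / (\<eta> + \<Lambda> * (t1 - t))) (at t within {t1 - \<tau>..t1})"
          by (simp add: has_real_derivative_iff_has_vector_derivative)
      qed (use \<tau> in auto)
      moreover have "- (ln (\<eta> + \<Lambda> * (t1 - t1)) / \<Lambda>) - - (ln (\<eta> + \<Lambda> * (t1 - (t1 - \<tau>))) / \<Lambda>) = ln (1 + 1 / (2 * \<eta>)) / \<Lambda>"
        using ln by (simp add: diff_divide_distrib[symmetric])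
      ultimately have "((\<lambda>t. 1 / (\<eta> + \<Lambda> * (t1 - t))) has_integral ln (1 + 1 / (2 * \<eta>)) / \<Lambda>) {t1 - \<tau>..t1}" by simp
      then show "((\<lambda>t. 1 / (\<eta> + \<Lambda> * \<bar>t - t1\<bar>)) has_integral ln (1 + 1 / (2 * \<eta>)) / \<Lambda>) {t1 - \<tau>..t1}"
        by (rule has_integral_eq[rotated]) auto
    qed (use t1 \<tau> False in auto)
  qed
  then show ?thesis by (simp add: f_def[abs_def])
qed

text \<open>Near the frontier of \<open>D\<close> the averaged potential falls far below its value
  at an inner point \<open>x1\<close>, and for small \<open>e\<close> the action inherits this,
  which yields a superlevel set compactly inside \<open>D\<close>. The constants \<open>d1\<close>
  and \<open>e1\<close> are fixed before \<open>e\<close> and \<open>d\<close>. The homotopy is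
  conditional on uniqueness of the zero, since further critical points could change the
  degree.\<close>

lemma tube_in_bounded_component:
  fixes H :: "real \<Rightarrow> real^2"
  assumes q: "q \<ge> 2"
    and lip: "\<And>s t. s \<in> {0..1} \<Longrightarrow> t \<in> {0..1} \<Longrightarrow> norm (H t - H s) \<le> \<Lambda> * \<bar>t - s\<bar>"
    and D: "open D" "bounded D" "D \<noteq> {}" "D \<inter> H ` {0..1} = {}" "frontier D \<subseteq> H ` {0..1}"
  obtains d1 e1 where "d1 > 0" "e1 > 0"
    "\<And>e d y y'. 0 < e \<Longrightarrow> e \<le> e1 \<Longrightarrow> 0 < d \<Longrightarrow> d \<le> d1 \<Longrightarrow> shooting q d e H y y' \<Longrightarrow>
      \<exists>U x0. open U \<and> x0 \<in> U \<and> bounded U \<and> closure U \<subseteq> D \<times> UNIV \<and>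
        (\<forall>x\<in>closure U. \<forall>t\<in>{0..1}. d < norm (y (fst x) (snd x) t - H t)) \<and>
        shooting.displacement y y' x0 = 0 \<and>
        ((\<forall>x. fst x \<in> D \<longrightarrow> (\<forall>t\<in>{0..1}. d < norm (y (fst x) (snd x) t - H t)) \<longrightarrow>
            shooting.displacement y y' x = 0 \<longrightarrow> x = x0) \<longrightarrow>
          homotopic_with_canon (\<lambda>_. True) (frontier U) (- {0}) (shooting.displacement y y') (\<lambda>x. x - x0))"
proof -
  define \<Gamma> where "\<Gamma> = H ` {0..1}"
  define \<Lambda>' where "\<Lambda>' = max \<Lambda> 1"
  have \<Lambda>': "\<Lambda>' \<ge> 1" by (simp add: \<Lambda>'_def)
  have lip': "norm (H t - H s) \<le> \<Lambda>' * \<bar>t - s\<bar>" if "s \<in> {0..1}" "t \<in> {0..1}" for s t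
    using lip[OF that] mult_right_mono[of \<Lambda> \<Lambda>' "\<bar>t - s\<bar>"] by (simp add: \<Lambda>'_def)
  have contH: "continuous_on {0..1} H"
    using lip' \<Lambda>' by (intro lipschitz_on_continuous_on[of \<Lambda>']) (auto simp: lipschitz_on_def dist_norm norm_minus_commute abs_minus_commute)
  have comp\<Gamma>: "compact \<Gamma>" unfolding \<Gamma>_def by (intro compact_continuous_image contH compact_Icc)
  have \<Gamma>ne: "\<Gamma> \<noteq> {}" by (simp add: \<Gamma>_def)
  obtain x1 where x1: "x1 \<in> D" using D by blast
  have "x1 \<notin> \<Gamma>" using x1 D by (auto simp: \<Gamma>_def)
  then have inf1: "infdist x1 \<Gamma> > 0"
    using in_closed_iff_infdist_zero[OF compact_imp_closed[OF comp\<Gamma>] \<Gamma>ne, of x1] infdist_nonneg[of x1 \<Gamma>] by linarith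
  define V where "V x = integral {0..1} (\<lambda>t. norm (x - H t) powr (1 - q))" for x
  \<comment> \<open>\<open>W\<close> makes the logarithm of the blow-up estimate exceed
    \<open>V x1\<close> by \<open>2 * (q - 1)\<close>, a drop of the averaged potential
    \<open>- (V p / (q - 1))\<close> by 2. The bound \<open>infdist x1 \<Gamma>\<close> on
    \<open>\<eta>\<close> puts \<open>x1\<close> into \<open>K\<close>.\<close>
  define W where "W = \<Lambda>' * (V x1 + 2 * (q - 1))"
  define \<eta> where "\<eta> = min (min (1 / 2) (infdist x1 \<Gamma>)) (1 / (2 * exp W))"
  have \<eta>: "0 < \<eta>" "\<eta> \<le> 1 / 2" "\<eta> \<le> infdist x1 \<Gamma>" "\<eta> \<le> 1 / (2 * exp W)"
    using inf1 by (auto simp: \<eta>_def)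
  have blow: "V x1 + 2 * (q - 1) \<le> V x" if "x \<notin> \<Gamma>" "infdist x \<Gamma> \<le> \<eta>" for x
  proof -
    obtain g where g: "g \<in> \<Gamma>" "infdist x \<Gamma> = dist x g"
      by (rule infdist_attains_inf[OF compact_imp_closed[OF comp\<Gamma>] \<Gamma>ne])
    then obtain t1 where "t1 \<in> {0..1}" "g = H t1" by (auto simp: \<Gamma>_def)
    with g have t1: "t1 \<in> {0..1}" "dist x (H t1) = infdist x \<Gamma>" by simp_all
    have "\<eta> * (2 * exp W) \<le> 1" using \<eta>(4) by (simp add: pos_le_divide_eq)
    then have "exp W \<le> 1 / (2 * \<eta>)" using \<eta>(1) by (simp add: pos_le_divide_eq mult_ac)
    then have "exp W \<le> 1 + 1 / (2 * \<eta>)" by simp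
    then have "ln (exp W) \<le> ln (1 + 1 / (2 * \<eta>))"
      by (subst ln_le_cancel_iff) (auto intro: less_le_trans[OF exp_gt_zero])
    then have "W \<le> ln (1 + 1 / (2 * \<eta>))" by simp
    then have "V x1 + 2 * (q - 1) \<le> ln (1 + 1 / (2 * \<eta>)) / \<Lambda>'"
      using \<Lambda>' by (simp add: W_def field_simps)
    also have "\<dots> \<le> V x"
      unfolding V_def using potential_blowup[OF q \<Lambda>' lip' _ t1(1) _ \<eta>(1,2), of x] that t1(2)
      by (auto simp: \<Gamma>_def dist_norm)
    finally show ?thesis .
  qed
  \<comment> \<open>Points of \<open>K\<close> are at least \<open>8 * d1\<close> away from the
    curve, while orbits of the tube deviate from their start by at most
    \<open>d1 + d1 / 2\<close>.\<close>
  define d1 where "d1 = \<eta> / 8"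
  have d1: "d1 > 0" using \<eta> by (simp add: d1_def)
  define B where "B = d1 powr (- q)"
  define L where "L = (q + 2) * d1 powr (- (q + 1))"
  have B: "B > 0" and L: "L > 0" using d1 q by (auto simp: B_def L_def)
  \<comment> \<open>In this order the bounds provide the smallness required by
    \<open>small_shooting\<close>, a closing velocity below \<open>d1\<close>, and an action error
    of at most \<open>e / 2\<close>.\<close>
  define e1 where "e1 = min (1 / (4 * L)) (min (d1 / (2 * B)) (1 / (8 * B\<^sup>2)))"
  have e1: "e1 > 0" "e1 \<le> 1 / (4 * L)" "e1 \<le> d1 / (2 * B)" "e1 \<le> 1 / (8 * B\<^sup>2)"
    using B L d1 by (auto simp: e1_def)
  define D' where "D' = {p \<in> D. \<eta> / 2 < infdist p \<Gamma>}"
  define K where "K = {p \<in> D. \<eta> \<le> infdist p \<Gamma>}"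
  have cinf: "continuous_on S (\<lambda>p. infdist p \<Gamma>)" for S by (intro continuous_intros)
  have openD': "open D'"
  proof -
    have "D' = D \<inter> {p. \<eta> / 2 < infdist p \<Gamma>}" by (auto simp: D'_def)
    moreover have "open {p. \<eta> / 2 < infdist p \<Gamma>}" by (intro open_Collect_less cinf continuous_on_const)
    ultimately show ?thesis using D(1) by (simp only: open_Int)
  qed
  have compK: "compact K"
  proof -
    have "p \<in> D" if "p \<in> closure D" "\<eta> \<le> infdist p \<Gamma>" for p
    proof (rule ccontr)
      assume "p \<notin> D"
      then have "p \<in> \<Gamma>" using that D(1,5) by (auto simp: frontier_def interior_open \<Gamma>_def)
      then show False using that(2) \<eta>(1) by simp
    qed
    then have "K = closure D \<inter> {p. \<eta> \<le> infdist p \<Gamma>}"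
      using closure_subset by (auto simp: K_def)
    then show ?thesis
      using D(2) by (auto intro!: compact_Int_closed closed_Collect_le cinf)
  qed
  have KD': "K \<subseteq> D'" using \<eta> by (auto simp: K_def D'_def)
  have x1K: "x1 \<in> K" using x1 \<eta> by (simp add: K_def)
  show ?thesis
  proof (rule that[OF d1 e1(1)])
    fix e d y y'
    assume e: "0 < e" "e \<le> e1" and d: "0 < d" "d \<le> d1" and sh: "shooting q d e H y y'"
    interpret S: shooting q d e H y y' by (rule sh)
    obtain y1 y1' where sh1: "shooting q d1 e H y1 y1'"
      using shooting_exists[OF q d1 e(1) contH] by blast
    interpret S1: shooting q d1 e H y1 y1' by (rule sh1)
    have "q > 1" using q by simp
    then obtain G :: "real^2 \<Rightarrow> real" where G: "force_potential q d1 G"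
      using force_potential_exists[OF d1] by blast
    have fb: "S1.force_bound = B" and fl: "S1.force_lip = L"
      by (simp_all add: S1.force_bound_def S1.force_lip_def B_def L_def)
    have eL: "e * L \<le> 1 / 4"
      using mult_right_mono[OF order_trans[OF e(2) e1(2)], of L] L by simp
    have eB: "e * B \<le> d1 / 2"
      using mult_right_mono[OF order_trans[OF e(2) e1(3)], of B] B by simp
    have eB2: "4 * (e * B)\<^sup>2 \<le> e / 2"
    proof -
      have "e * B\<^sup>2 \<le> 1 / 8"
        using mult_right_mono[OF order_trans[OF e(2) e1(4)], of "B\<^sup>2"] B by simp
      then have "e * (e * B\<^sup>2) \<le> e * (1 / 8)" using e by (intro mult_left_mono) auto
      then show ?thesis by (simp add: power_mult_distrib power2_eq_square mult_ac)
    qed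
    interpret T: small_shooting q d1 e H y1 y1' G
      by unfold_locales (use eL fl G in auto)
    have far: "d1 \<le> norm (p - H t)" if "p \<in> D'" "t \<in> {0..1}" for p t
    proof -
      have "infdist p \<Gamma> \<le> dist p (H t)" using that(2) by (intro infdist_le) (auto simp: \<Gamma>_def)
      then show ?thesis using that(1) \<eta> by (simp add: D'_def d1_def dist_norm)
    qed
    have V: "integral {0..1} (\<lambda>t. G (p - H t)) = - (V p / (q - 1))" if "p \<in> D'" for p
    proof -
      have "integral {0..1} (\<lambda>t. G (p - H t)) = integral {0..1} (\<lambda>t. (- 1 / (q - 1)) * norm (p - H t) powr (1 - q))"
        using G far[OF that] by (intro integral_cong) (auto simp: force_potential_def)
      then show ?thesis by (simp add: V_def)
    qed
    have approx: "\<bar>T.action p - e * (- (V p / (q - 1)))\<bar> \<le> e / 2" if "p \<in> D'" for p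
      using T.action_approx[of p] eB2 unfolding V[OF that] fb by linarith
    \<comment> \<open>The level lies in the middle of the drop by \<open>2 * e\<close>: the error
      \<open>e / 2\<close> leaves \<open>x1\<close> above it and the shell between \<open>K\<close>
      and the rim of \<open>D'\<close> below it.\<close>
    define c where "c = e * (- (V x1 / (q - 1))) - e"
    have c1: "c < T.action x1"
      using approx[OF subsetD[OF KD' x1K]] e unfolding c_def by linarith
    have c2: "T.action p \<le> c" if "p \<in> D'" "p \<notin> K" for p
    proof -
      have "p \<notin> \<Gamma>" "infdist p \<Gamma> \<le> \<eta>" using that D(4) by (auto simp: D'_def K_def \<Gamma>_def)
      then have "(V x1 + 2 * (q - 1)) / (q - 1) \<le> V p / (q - 1)"
        using blow q by (intro divide_right_mono) auto
      moreover have "(V x1 + 2 * (q - 1)) / (q - 1) = V x1 / (q - 1) + 2" using q by (simp add: field_simps)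
      ultimately have "- (V p / (q - 1)) \<le> - (V x1 / (q - 1)) - 2" by linarith
      then have "e * (- (V p / (q - 1))) \<le> e * (- (V x1 / (q - 1)) - 2)" using e by (intro mult_left_mono) auto
      then have "e * (- (V p / (q - 1))) \<le> e * (- (V x1 / (q - 1))) - e * 2" by (simp only: right_diff_distrib)
      then show ?thesis using approx[OF that(1)] e unfolding c_def by linarith
    qed
    \<comment> \<open>The rotation by a right angle, available because the curve is planar.\<close>
    define J :: "real^2 \<Rightarrow> real^2" where "J x = vector [- (x $ 2), x $ 1]" for x
    have J: "linear J" "\<And>x. x \<bullet> J x = 0" "\<And>x. J x = 0 \<Longrightarrow> x = 0"
      by (auto simp: J_def linear_iff vec_eq_iff forall_2 inner_vec_def sum_2)
    have rho: "e * S1.force_bound < d1" using eB d1 by (simp add: fb)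
    obtain U x0 where U: "open U" "bounded U" "x0 \<in> U" "closure U \<subseteq> K \<times> cball 0 d1"
        "S1.displacement x0 = 0"
        "(\<forall>x. fst x \<in> K \<longrightarrow> norm (snd x) \<le> d1 \<longrightarrow> S1.displacement x = 0 \<longrightarrow> x = x0) \<longrightarrow>
          homotopic_with_canon (\<lambda>_. True) (frontier U) (- {0}) S1.displacement (\<lambda>x. x - x0)"
    proof (rule T.tube_homotopic[OF openD' compK KD' x1K c1 _ rho J(1)])
      show "\<And>p. p \<in> D' \<Longrightarrow> p \<notin> K \<Longrightarrow> T.action p \<le> c" by (rule c2)
      show "\<And>x. x \<bullet> J x = 0" "\<And>x. J x = 0 \<Longrightarrow> x = 0" by (rule J(2), rule J(3))
    qed (rule that)
    have orbit1: "d1 < norm (y1 p v t - H t)" if "p \<in> K" "norm v \<le> d1" "t \<in> {0..1}" for p v t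
    proof -
      have "\<eta> \<le> norm (p - H t)"
      proof -
        have "infdist p \<Gamma> \<le> dist p (H t)" using that(3) by (intro infdist_le) (auto simp: \<Gamma>_def)
        then show ?thesis using that(1) by (simp add: K_def dist_norm)
      qed
      moreover have "norm (p - H t) \<le> norm (y1 p v t - p - w) + norm w + norm (y1 p v t - H t)" for w by norm
      from this[of "t *\<^sub>R v"]
      have "norm (p - H t) \<le> norm (y1 p v t - p - t *\<^sub>R v) + norm (t *\<^sub>R v) + norm (y1 p v t - H t)" .
      moreover have "norm (t *\<^sub>R v) \<le> d1"
        using that mult_left_le_one_le[of "norm v" t] by simp
      ultimately show ?thesis
        using S1.position_bound[OF that(3), of p v] eB d1 unfolding fb by (simp add: d1_def)
    qed
    \<comment> \<open>Orbits of the tube never meet the ball where the forces for \<open>d1\<close>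
      and \<open>d\<close> differ, so by uniqueness they are orbits of both equations.\<close>
    have same: "y1 p v t = y p v t" "y1' p v t = y' p v t" if pv: "p \<in> K" "norm v \<le> d1" and t: "t \<in> {0..1}" for p v t
    proof -
      have D2: "(y1' p v has_vector_derivative e *\<^sub>R force q d (y1 p v t - H t)) (at t within {0..1})" if "t \<in> {0..1}" for t
        using S1.der_y'[OF that, of p v] force_cong[of d1 "y1 p v t - H t" d q] orbit1[OF pv that] d by simp
      show "y1 p v t = y p v t" "y1' p v t = y' p v t"
        by (rule S.flow_unique[OF t S1.der_y D2]; simp)+
    qed
    have disp: "S1.displacement x = S.displacement x" if "fst x \<in> K" "norm (snd x) \<le> d1" for x
      using same[OF that, of 1] by (simp add: S1.displacement_def S.displacement_def)
    have cl: "fst x \<in> K" "norm (snd x) \<le> d1" if "x \<in> closure U" for x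
    proof -
      have "x \<in> K \<times> cball 0 d1" using U(4) that by blast
      then show "fst x \<in> K" "norm (snd x) \<le> d1" by (auto simp: mem_Times_iff)
    qed
    have orbit: "d < norm (y (fst x) (snd x) t - H t)" if "fst x \<in> K" "norm (snd x) \<le> d1" "t \<in> {0..1}" for x t
      using orbit1[OF that] same(1)[OF that] d by simp
    show "\<exists>U x0. open U \<and> x0 \<in> U \<and> bounded U \<and> closure U \<subseteq> D \<times> UNIV \<and>
        (\<forall>x\<in>closure U. \<forall>t\<in>{0..1}. d < norm (y (fst x) (snd x) t - H t)) \<and>
        S.displacement x0 = 0 \<and>
        ((\<forall>x. fst x \<in> D \<longrightarrow> (\<forall>t\<in>{0..1}. d < norm (y (fst x) (snd x) t - H t)) \<longrightarrow>
            S.displacement x = 0 \<longrightarrow> x = x0) \<longrightarrow>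
          homotopic_with_canon (\<lambda>_. True) (frontier U) (- {0}) S.displacement (\<lambda>x. x - x0))"
    proof (intro exI[of _ U] exI[of _ x0] conjI impI ballI)
      have x0cl: "x0 \<in> closure U" using U(3) closure_subset by blast
      show "S.displacement x0 = 0" using disp[OF cl[OF x0cl]] U(5) by simp
      show "closure U \<subseteq> D \<times> UNIV" using U(4) by (auto simp: K_def)
      show "d < norm (y (fst x) (snd x) t - H t)" if "x \<in> closure U" "t \<in> {0..1}" for x t
        using orbit[OF cl[OF that(1)] that(2)] .
      assume uniq: "\<forall>x. fst x \<in> D \<longrightarrow> (\<forall>t\<in>{0..1}. d < norm (y (fst x) (snd x) t - H t)) \<longrightarrow>
            S.displacement x = 0 \<longrightarrow> x = x0"
      have "homotopic_with_canon (\<lambda>_. True) (frontier U) (- {0}) S1.displacement (\<lambda>x. x - x0)"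
      proof (rule U(6)[rule_format])
        fix x assume x: "fst x \<in> K" "norm (snd x) \<le> d1" "S1.displacement x = 0"
        have "fst x \<in> D" using x by (simp add: K_def)
        then show "x = x0" using uniq orbit[OF x(1,2)] disp[OF x(1,2)] x(3) by metis
      qed
      then show "homotopic_with_canon (\<lambda>_. True) (frontier U) (- {0}) S.displacement (\<lambda>x. x - x0)"
        by (rule homotopic_with_eq) (use disp cl in \<open>auto simp: frontier_def\<close>)
    qed (use U in auto)
  qed
qed

section \<open>Multiplicity of solutions\<close>

lemma truncated_zero_gives_solution:
  fixes H :: "real \<Rightarrow> real^2"
  assumes sh: "shooting q d e H y y'" and l: "l > 0" "e = l powr (- (q + 1))"
    and H: "\<And>t. t \<in> {0..1} \<Longrightarrow> (H has_vector_derivative H' t) (at t within {0..1})"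
      "\<And>t. t \<in> {0..1} \<Longrightarrow> (H' has_vector_derivative - h t) (at t within {0..1})" "H 0 = H 1" "H' 0 = H' 1"
    and x: "shooting.displacement y y' x = 0" "\<And>t. t \<in> {0..1} \<Longrightarrow> d < norm (y (fst x) (snd x) t - H t)"
  shows "(\<lambda>t\<in>{0..1}. l *\<^sub>R (y (fst x) (snd x) t - H t)) \<in> repulsive_solutions q l h"
proof -
  interpret S: shooting q d e H y y' by (rule sh)
  obtain p v where pv: "x = (p, v)" by (cases x)
  have per: "y p v 1 = p" "y' p v 1 = v" using x(1) by (simp_all add: pv S.displacement_eq_0_iff)
  define z where "z t = y p v t - H t" for t
  define u where "u = (\<lambda>t\<in>{0..1}. l *\<^sub>R z t)"
  define w where "w t = l *\<^sub>R (y' p v t - H' t)" for t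
  define a where "a t = l *\<^sub>R (e *\<^sub>R force q d (z t) + h t)" for t
  have zd: "d < norm (z t)" if "t \<in> {0..1}" for t using x(2)[OF that] by (simp add: z_def pv)
  have u1: "(u has_vector_derivative w t) (at t within {0..1})" if t: "t \<in> {0..1}" for t
  proof -
    have "((\<lambda>t. l *\<^sub>R z t) has_vector_derivative w t) (at t within {0..1})"
      unfolding z_def[abs_def] w_def
      using bounded_linear.has_vector_derivative[OF bounded_linear_scaleR_right has_vector_derivative_diff[OF S.der_y[OF t] H(1)[OF t]]] .
    then show ?thesis
      by (rule has_vector_derivative_transform[OF t, rotated]) (simp add: u_def)
  qed
  have w1: "(w has_vector_derivative a t) (at t within {0..1})" if t: "t \<in> {0..1}" for t
    using bounded_linear.has_vector_derivative[OF bounded_linear_scaleR_right has_vector_derivative_diff[OF S.der_y'[OF t] H(2)[OF t]], of l p v]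
    by (simp add: w_def[abs_def] a_def z_def)
  have "periodic_with_second_deriv u a"
    unfolding periodic_with_second_deriv_def
    by (intro exI[of _ w]) (use u1 w1 per H in \<open>auto simp: u_def w_def z_def\<close>)
  moreover have "a t - u t /\<^sub>R (norm (u t) powr (q + 1)) = l *\<^sub>R h t" if t: "t \<in> {0..1}" for t
  proof -
    have "u t = l *\<^sub>R z t" using t by (simp add: u_def)
    moreover have "force q d (z t) = z t /\<^sub>R (norm (z t) powr (q + 1))"
      using zd[OF t] by (intro force_outside) simp
    moreover have "(l * norm (z t)) powr (q + 1) = l powr (q + 1) * norm (z t) powr (q + 1)"
      using l by (simp add: powr_mult)
    moreover have "e = inverse (l powr (q + 1))" by (simp only: l(2) powr_minus)
    ultimately show ?thesis
      using l(1) by (simp add: a_def scaleR_add_right mult_ac)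
  qed
  moreover have "u t \<noteq> 0" if "t \<in> {0..1}" for t
    using zd[OF that] l S.d that by (auto simp: u_def)
  ultimately have "u \<in> repulsive_solutions q l h"
    unfolding repulsive_solutions_def by (auto simp: u_def)
  then show ?thesis by (simp add: u_def z_def pv)
qed

text \<open>The initial velocity is recovered from the orbit as its one-sided derivative at
  0.\<close>

lemma truncated_zero_solution_inj:
  fixes H :: "real \<Rightarrow> real^2"
  assumes sh: "shooting q d e H y y'" and l: "l > 0"
    and eq: "(\<lambda>t\<in>{0..1}. l *\<^sub>R (y (fst x) (snd x) t - H t)) = (\<lambda>t\<in>{0..1}. l *\<^sub>R (y (fst x') (snd x') t - H t))"
  shows "x = x'"
proof -
  interpret S: shooting q d e H y y' by (rule sh)
  have same: "y (fst x) (snd x) t = y (fst x') (snd x') t" if "t \<in> {0..1}" for t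
    using fun_cong[OF eq, of t] that l by simp
  have "fst x = fst x'" using same[of 0] by simp
  moreover have "(y (fst x) (snd x) has_vector_derivative snd x') (at 0 within {0..1})"
    by (rule has_vector_derivative_transform[of 0 "{0..1}" _ "y (fst x') (snd x')"])
      (use same S.der_y[of 0 "fst x'" "snd x'"] in auto)
  then have "snd x = snd x'"
    using vector_derivative_unique_within_closed_interval[of 0 1 0 "y (fst x) (snd x)" "snd x" "snd x'"]
      S.der_y[of 0 "fst x" "snd x"] by simp
  ultimately show ?thesis by (simp add: prod_eq_iff)
qed

theorem theorem2p1:
  fixes q :: real and h H :: "real \<Rightarrow> real^2" and r :: nat
  assumes "q \<ge> 2"
    and "continuous_on {0..1} h"
    and "(h has_integral 0) {0..1}"
    and "periodic_with_second_deriv H (\<lambda>t. - h t)"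
    and "finite (bounded_components (- (H ` {0..1}))) \<Longrightarrow>
           r = card (bounded_components (- (H ` {0..1})))"
    and "r \<ge> 1"
  shows "\<forall>\<^sub>F l in at_top. \<exists>S \<subseteq> repulsive_solutions q l h. finite S \<and> card S = r + 1"
proof -
  obtain H' where H: "\<And>t. t \<in> {0..1} \<Longrightarrow> (H has_vector_derivative H' t) (at t within {0..1})"
      "\<And>t. t \<in> {0..1} \<Longrightarrow> (H' has_vector_derivative - h t) (at t within {0..1})" "H 0 = H 1" "H' 0 = H' 1"
    using assms(4) unfolding periodic_with_second_deriv_def by blast
  have contH: "continuous_on {0..1} H" and contH': "continuous_on {0..1} H'"
    using continuous_on_vector_derivative[OF H(1)] continuous_on_vector_derivative[OF H(2)] by auto
  have "bounded (H' ` {0..1})" by (intro compact_imp_bounded compact_continuous_image contH' compact_Icc)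
  then obtain \<Lambda> where \<Lambda>: "\<And>t. t \<in> {0..1} \<Longrightarrow> norm (H' t) \<le> \<Lambda>" unfolding bounded_iff by blast
  have lip: "norm (H t - H s) \<le> \<Lambda> * \<bar>t - s\<bar>" if "s \<in> {0..1}" "t \<in> {0..1}" for s t
    by (rule norm_diff_le_of_vector_derivative_bound[OF H(1) \<Lambda> that])
  have "bounded (h ` {0..1})" by (intro compact_imp_bounded compact_continuous_image assms(2) compact_Icc)
  then obtain M where M: "M > 0" "\<And>t. t \<in> {0..1} \<Longrightarrow> norm (h t) \<le> M" unfolding bounded_pos by blast
  define \<Gamma> where "\<Gamma> = H ` {0..1}"
  have closed\<Gamma>: "closed \<Gamma>"
    unfolding \<Gamma>_def by (intro compact_imp_closed compact_continuous_image contH compact_Icc)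
  \<comment> \<open>With infinitely many components \<open>r\<close> is arbitrary, and any
    \<open>r\<close> of them will do.\<close>
  obtain I where I: "finite I" "card I = r" "I \<subseteq> bounded_components (- \<Gamma>)"
  proof (cases "finite (bounded_components (- \<Gamma>))")
    case True
    then show ?thesis using that assms(5) by (simp add: \<Gamma>_def)
  next
    case False
    then show ?thesis using that infinite_arbitrarily_large[of "bounded_components (- \<Gamma>)" r] by blast
  qed
  have comp: "D \<in> components (- \<Gamma>)" "bounded D" if "D \<in> I" for D
    using I(3) that by (auto simp: bounded_components_def)
  have D: "open D" "bounded D" "D \<noteq> {}" "D \<inter> H ` {0..1} = {}" "frontier D \<subseteq> H ` {0..1}" if "D \<in> I" for D
  proof -
    note c = comp(1)[OF that]
    show "open D" using open_components[OF _ c] closed\<Gamma> by (simp add: open_Compl)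
    show "bounded D" by (rule comp(2)[OF that])
    show "D \<noteq> {}" using c in_components_nonempty by blast
    show "D \<inter> H ` {0..1} = {}" using in_components_subset[OF c] by (auto simp: \<Gamma>_def)
    show "frontier D \<subseteq> H ` {0..1}" using frontier_of_components_closed_complement[OF closed\<Gamma> c] by (simp add: \<Gamma>_def)
  qed
  have disjD: "D \<inter> E = {}" if "D \<in> I" "E \<in> I" "D \<noteq> E" for D E
    using components_nonoverlap[OF comp(1)[OF that(1)] comp(1)[OF that(2)]] that(3) by simp
  define P where "P D d e y y' U x0 \<longleftrightarrow> open U \<and> x0 \<in> U \<and> bounded U \<and> closure U \<subseteq> D \<times> UNIV \<and>
        (\<forall>x\<in>closure U. \<forall>t\<in>{0..1}. d < norm (y (fst x) (snd x) t - H t)) \<and>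
        shooting.displacement y y' x0 = 0 \<and>
        ((\<forall>x. fst x \<in> D \<longrightarrow> (\<forall>t\<in>{0..1}. d < norm (y (fst x) (snd x) t - H t)) \<longrightarrow>
            shooting.displacement y y' x = 0 \<longrightarrow> x = x0) \<longrightarrow>
          homotopic_with_canon (\<lambda>_. True) (frontier U) (- {0}) (shooting.displacement y y') (\<lambda>x. x - x0))"
    for D :: "(real^2) set" and d e :: real and y y' :: "real^2 \<Rightarrow> real^2 \<Rightarrow> real \<Rightarrow> real^2" and U x0
  have "\<exists>d1 e1. d1 > 0 \<and> e1 > 0 \<and> (\<forall>e d y y'. 0 < e \<longrightarrow> e \<le> e1 \<longrightarrow> 0 < d \<longrightarrow> d \<le> d1 \<longrightarrow>
      shooting q d e H y y' \<longrightarrow> (\<exists>U x0. P D d e y y' U x0))" if DI: "D \<in> I" for D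
  proof -
    obtain d1 e1 where "d1 > 0" "e1 > 0" and *: "\<And>e d y y'. 0 < e \<Longrightarrow> e \<le> e1 \<Longrightarrow> 0 < d \<Longrightarrow> d \<le> d1 \<Longrightarrow>
        shooting q d e H y y' \<Longrightarrow> \<exists>U x0. P D d e y y' U x0"
      unfolding P_def using tube_in_bounded_component[OF assms(1) lip D[OF DI]] by blast
    then show ?thesis by blast
  qed
  then obtain d1 e1 where de: "\<And>D. D \<in> I \<Longrightarrow> d1 D > 0 \<and> e1 D > 0 \<and> (\<forall>e d y y'. 0 < e \<longrightarrow> e \<le> e1 D \<longrightarrow> 0 < d \<longrightarrow> d \<le> d1 D \<longrightarrow>
      shooting q d e H y y' \<longrightarrow> (\<exists>U x0. P D d e y y' U x0))"
    by metis
  have Ine: "I \<noteq> {}" using I(2) assms(6) by auto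
  define ds where "ds = Min (d1 ` I)"
  define es where "es = Min (e1 ` I)"
  have ds: "ds > 0" "\<And>D. D \<in> I \<Longrightarrow> ds \<le> d1 D" and es: "es > 0" "\<And>D. D \<in> I \<Longrightarrow> es \<le> e1 D"
    using I(1) Ine de by (auto simp: ds_def es_def)
  have sol: "\<exists>S \<subseteq> repulsive_solutions q l h. finite S \<and> card S = r + 1"
    if l: "l > 0" "l powr (- (q + 1)) \<le> es" for l
  proof -
    define e where "e = l powr (- (q + 1))"
    have e: "e > 0" "e \<le> es" using l by (auto simp: e_def)
    obtain d0 where d0: "d0 > 0" "M * d0 powr q < e"
      and dich: "\<And>d z z' k t0. 0 < d \<Longrightarrow> d \<le> d0 \<Longrightarrow>
      (\<And>t. t \<in> {0..1} \<Longrightarrow> (z has_vector_derivative z' t) (at t within {0..1})) \<Longrightarrow>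
      (\<And>t. t \<in> {0..1} \<Longrightarrow> (z' has_vector_derivative e *\<^sub>R force q d (z t) + k t) (at t within {0..1})) \<Longrightarrow>
      z 0 = z 1 \<Longrightarrow> z' 0 = z' 1 \<Longrightarrow>
      (k has_integral 0) {0..1} \<Longrightarrow> (\<And>t. t \<in> {0..1} \<Longrightarrow> norm (k t) \<le> M) \<Longrightarrow>
      t0 \<in> {0..1} \<Longrightarrow> norm (z t0 :: real^2) \<le> d \<Longrightarrow> \<forall>t\<in>{0..1}. norm (z t) < d"
      by (rule truncated_periodic_solution_dichotomy[OF assms(1) e(1) M(1), where ?'a = "real^2"]) blast
    \<comment> \<open>The radius is chosen after \<open>e\<close>: \<open>d0\<close> depends on
      \<open>e\<close>, whereas the tubes tolerate every \<open>d \<le> ds\<close>.\<close>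
    define d where "d = min ds d0"
    have d: "d > 0" "d \<le> d0" "\<And>D. D \<in> I \<Longrightarrow> d \<le> d1 D" using ds d0 by (auto simp: d_def intro: min.coboundedI1)
    obtain y y' where sh: "shooting q d e H y y'"
      using shooting_exists[OF assms(1) d(1) e(1) contH] by blast
    interpret S: shooting q d e H y y' by (rule sh)
    define Z where "Z = {x. S.displacement x = 0 \<and> (\<forall>t\<in>{0..1}. d < norm (y (fst x) (snd x) t - H t))}"
    \<comment> \<open>A zero outside \<open>Z\<close> has an orbit meeting the closed ball of radius
      \<open>d\<close>; by the dichotomy it then stays in the open ball throughout.\<close>
    have zeros: "x \<in> S.core \<or> x \<in> Z" if x: "S.displacement x = 0" for x
    proof (rule ccontr)
      assume n: "\<not> ?thesis"
      then obtain t0 where t0: "t0 \<in> {0..1}" "norm (y (fst x) (snd x) t0 - H t0) \<le> d"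
        using x by (force simp: Z_def)
      have per: "y (fst x) (snd x) 1 = fst x" "y' (fst x) (snd x) 1 = snd x"
        using x S.displacement_eq_0_iff[of "fst x" "snd x"] by auto
      have "\<forall>t\<in>{0..1}. norm (y (fst x) (snd x) t - H t) < d"
      proof (rule dich[where z = "\<lambda>t. y (fst x) (snd x) t - H t" and z' = "\<lambda>t. y' (fst x) (snd x) t - H' t"
            and k = h and ?t0.0 = t0])
        show "((\<lambda>t. y (fst x) (snd x) t - H t) has_vector_derivative y' (fst x) (snd x) t - H' t) (at t within {0..1})"
          if "t \<in> {0..1}" for t
          by (intro has_vector_derivative_diff S.der_y H that)
        show "((\<lambda>t. y' (fst x) (snd x) t - H' t) has_vector_derivative
            e *\<^sub>R force q d (y (fst x) (snd x) t - H t) + h t) (at t within {0..1})" if "t \<in> {0..1}" for t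
          using has_vector_derivative_diff[OF S.der_y'[OF that] H(2)[OF that]] by simp
      qed (use per H d t0 assms(3) M(2) in auto)
      then show False using n by (simp add: S.core_def)
    qed
    have "\<exists>U x0. P D d e y y' U x0" if "D \<in> I" for D
      using de[OF that] e d(1) d(3)[OF that] es(2)[OF that] sh by (meson order_trans)
    then obtain U x0 where U: "\<And>D. D \<in> I \<Longrightarrow> P D d e y y' (U D) (x0 D)" by metis
    have UD: "open (U D)" "x0 D \<in> U D" "bounded (U D)" "closure (U D) \<subseteq> D \<times> UNIV"
        "S.displacement (x0 D) = 0" "\<And>x t. x \<in> closure (U D) \<Longrightarrow> t \<in> {0..1} \<Longrightarrow> d < norm (y (fst x) (snd x) t - H t)"
      if "D \<in> I" for D
      using U[OF that] unfolding P_def by blast+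
    have x0Z: "x0 D \<in> Z" "fst (x0 D) \<in> D" if "D \<in> I" for D
    proof -
      have "x0 D \<in> closure (U D)" using UD(2)[OF that] closure_subset by blast
      then show "x0 D \<in> Z" "fst (x0 D) \<in> D"
        using UD(4-6)[OF that] by (auto simp: Z_def mem_Times_iff)
    qed
    have injx: "inj_on x0 I"
    proof (rule inj_onI, rule ccontr)
      fix D E assume "D \<in> I" "E \<in> I" "x0 D = x0 E" "D \<noteq> E"
      then show False using x0Z(2)[of D] x0Z(2)[of E] disjD[of D E] by auto
    qed
    \<comment> \<open>Otherwise each tube holds the only zero of \<open>Z\<close> over its
      component, so the core and the \<open>r\<close> tubes are \<open>r + 1\<close> regions of
      degree one that enclose all zeros, where exactly one such region is allowed.\<close>
    have "\<not> Z \<subseteq> x0 ` I"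
    proof
      assume Zsub: "Z \<subseteq> x0 ` I"
      have uniq: "x = x0 D" if DI: "D \<in> I" and xD: "fst x \<in> D" and xZ: "x \<in> Z" for x D
      proof -
        obtain E where "E \<in> I" "x = x0 E" using Zsub xZ by blast
        then show ?thesis using x0Z(2)[of E] disjD[of D E] DI xD by (cases "D = E") auto
      qed
      have homU: "homotopic_with_canon (\<lambda>_. True) (frontier (U D)) (- {0}) S.displacement (\<lambda>x. x - x0 D)"
        if "D \<in> I" for D
        using U[OF that] uniq[OF that] unfolding P_def by (simp add: Z_def)
      obtain c0 where c0: "c0 \<in> S.core"
          "homotopic_with_canon (\<lambda>_. True) (frontier S.core) (- {0}) S.displacement (\<lambda>x. x - c0)"
      proof (rule S.core_homotopic[OF H assms(2) M(2) M(1)])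
        have "d powr q \<le> d0 powr q" using d assms(1) by (intro powr_mono2) auto
        then show "M * d powr q < e" using d0(2) M(1) mult_left_mono[of "d powr q" "d0 powr q" M] by linarith
      qed (use that in blast)+
      \<comment> \<open>\<open>None\<close> indexes the core and \<open>Some D\<close> the tube over
        \<open>D\<close>.\<close>
      define W where "W i = (case i of None \<Rightarrow> S.core | Some D \<Rightarrow> U D)" for i
      define w where "w i = (case i of None \<Rightarrow> c0 | Some D \<Rightarrow> x0 D)" for i
      define II where "II = insert None (Some ` I)"
      have "finite II" using I(1) by (simp add: II_def)
      have "bounded (\<Union>i\<in>II. closure (W i))"
        using UD(3) S.bounded_core I(1) by (auto simp: II_def W_def)
      then obtain \<Omega> where \<Omega>: "open \<Omega>" "bounded \<Omega>" "0 \<in> \<Omega>" "(\<Union>i\<in>II. closure (W i)) \<subseteq> \<Omega>"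
          "homotopic_with_canon (\<lambda>_. True) (frontier \<Omega>) (- {0}) S.displacement (\<lambda>x. x)"
        by (rule S.displacement_homotopic_id_outside)
      have coreU: "closure S.core \<inter> closure (U D) = {}" if "D \<in> I" for D
      proof -
        have "x \<notin> closure S.core" if "x \<in> closure (U D)" for x
          using UD(6)[OF \<open>D \<in> I\<close> that, of 0] S.closure_core_subset by (force simp: S.closed_core_def)
        then show ?thesis by blast
      qed
      have UU: "closure (U D) \<inter> closure (U E) = {}" if "D \<in> I" "E \<in> I" "D \<noteq> E" for D E
        using UD(4)[OF that(1)] UD(4)[OF that(2)] disjD[OF that] by fastforce
      \<comment> \<open>The dimension 4 is that of the phase space of pairs of plane
        vectors.\<close>
      have "card II = 1"
      proof (rule card_regions_of_degree_one[where ?'n = 4 and f = S.displacement and U = W and z = w,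
            OF _ \<Omega>(1-3) \<open>finite II\<close>])
        show "closure (W i) \<inter> closure (W j) = {}" if "i \<in> II" "j \<in> II" "i \<noteq> j" for i j
        proof -
          consider E where "i = None" "j = Some E" "E \<in> I" | D where "i = Some D" "j = None" "D \<in> I"
            | D E where "i = Some D" "j = Some E" "D \<in> I" "E \<in> I" "D \<noteq> E"
            using \<open>i \<in> II\<close> \<open>j \<in> II\<close> \<open>i \<noteq> j\<close> by (auto simp: II_def)
          then show ?thesis
            by cases (use coreU UU in \<open>simp_all add: W_def Int_commute[of _ "closure S.core"]\<close>)
        qed
        show "S.displacement x \<noteq> 0" if "x \<in> closure \<Omega> - (\<Union>i\<in>II. W i)" for x
        proof
          assume "S.displacement x = 0"
          then consider "x \<in> S.core" | "x \<in> Z" using zeros by blast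
          then show False
          proof cases
            case 1
            then show False using that by (auto simp: II_def W_def)
          next
            case 2
            then obtain D where "D \<in> I" "x = x0 D" using Zsub by blast
            then show False using that UD(2)[of D] by (auto simp: II_def W_def)
          qed
        qed
        show "closure (W i) \<subseteq> \<Omega>" if "i \<in> II" for i using \<Omega>(4) that by blast
        show "open (W i)" "w i \<in> W i" "homotopic_with_canon (\<lambda>_. True) (frontier (W i)) (- {0}) S.displacement (\<lambda>x. x - w i)"
          if "i \<in> II" for i
          using that UD(1,2) S.open_core c0 homU by (auto simp: II_def W_def w_def)
      qed (use \<Omega>(5) S.continuous_on_displacement in auto)
      moreover have "card II = r + 1"
        using I by (simp add: II_def card_insert_if card_image)
      ultimately show False using assms(6) by simp
    qed
    \<comment> \<open>Nothing is known about the position of \<open>x'\<close>; being distinct from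
      the zeros in the tubes is enough for the count.\<close>
    then obtain x' where x': "x' \<in> Z" "x' \<notin> x0 ` I" by blast
    define X where "X = insert x' (x0 ` I)"
    have X: "finite X" "card X = r + 1" "X \<subseteq> Z"
      using x' I x0Z(1) by (auto simp: X_def card_image[OF injx])
    define u where "u x = (\<lambda>t\<in>{0..1}. l *\<^sub>R (y (fst x) (snd x) t - H t))" for x
    have "inj_on u X"
      by (rule inj_onI) (use truncated_zero_solution_inj[OF sh l(1)] in \<open>auto simp: u_def\<close>)
    moreover have "u x \<in> repulsive_solutions q l h" if "x \<in> X" for x
      unfolding u_def
      by (rule truncated_zero_gives_solution[OF sh l(1) e_def H]) (use X(3) that in \<open>auto simp: Z_def\<close>)
    ultimately show ?thesis
      using X by (intro exI[of _ "u ` X"]) (auto simp: card_image)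
  qed
  have "((\<lambda>l. l powr (- (q + 1))) \<longlongrightarrow> 0) at_top"
    by (rule tendsto_neg_powr) (use assms(1) filterlim_ident in auto)
  then have "\<forall>\<^sub>F l in at_top. l powr (- (q + 1)) < es"
    using es(1) by (rule order_tendstoD(2))
  then show ?thesis
    using eventually_gt_at_top[of 0] by eventually_elim (rule sol, auto)
qed

end
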